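(* Let $W=G(\ell,1,n)$ and let $c=(c_0,d_0,\dots,d_{\ell-1})$ be a deformation parameter with $c_0=j/k$ for positive coprime integers $j$ and $k$ with $2\le k\le n$. The socle $S$ of the polynomial representation $\mathbf{C}[\mathfrak{h}]=\mathbf{C}[x_1,\dots,x_n]$ of $H_c$ has as vector space basis the set of all $f_\mu$, $\mu\in\mathbf{Z}_{\ge0}^n$, such that $\mu$ is $(\ell j,k)$-admissible and such that $\mu^-_{m+1}\ge p$ for all integers $m,p$ with $0\le m\le n-1$, $p>0$, $p\not\equiv0$ mod $\ell$ and $$d_0-d_{-p}+\ell mc_0=p.$$ Here $f_\mu$ is the non-symmetric Jack polynomial of type $G(\ell,1,n)$ specialized at $c_0=j/k$.
   Context: Cherednik algebra. $G(\ell,1,n)$ is the group of $n\times n$ monomial matrices with non-zero entries $\ell$th roots of $1$, acting on $\mathfrak{h}=\mathbf{C}^n$ and on $\mathbf{C}[\mathfrak{h}]$ by $(wf)(v)=f(w^{-1}v)$. Fix a primitive $\ell$th root of unity $\zeta$; $\zeta_i$ is the diagonal matrix with $\zeta$ in position $i$ and $1$ elsewhere on the diagonal, $s_{ij}$ the transposition matrix, $e_{ir}=\frac1\ell\sum_{t=0}^{\ell-1}\zeta^{-tr}\zeta_i^t$. The $d_i$ satisfy $d_0+\cdots+d_{\ell-1}=0$, and $d_i$ is defined for all $i\in\mathbf{Z}$ by $d_{i+\ell}=d_i$. Dunkl operators: $$y_if=\frac{\partial f}{\partial x_i}-c_0\sum_{j'\ne i}\sum_{r=0}^{\ell-1}\frac{f-\zeta_i^rs_{ij'}\zeta_i^{-r}f}{x_i-\zeta^rx_{j'}}-\frac1{x_i}\sum_{r=0}^{\ell-1}(d_0-d_r)e_{ir}f;$$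 $H_c\subseteq\mathrm{End}_{\mathbf{C}}(\mathbf{C}[\mathfrak{h}])$ is generated by $W$, $\mathbf{C}[\mathfrak{h}]$ and the $y_i$. The socle is the sum of the simple $H_c$-submodules. Combinatorics. For $\mu\in\mathbf{Z}_{\ge0}^n$, $\mu^-$ is the non-decreasing rearrangement and $w_\mu\in S_n$ the longest permutation with $w_\mu\cdot\mu=\mu^-$, where $(w\cdot\mu)_i=\mu_{w^{-1}(i)}$. $\mu$ is $(a,k)$-admissible if for all $k\le i\le n$, $\mu^-_i\ge\mu^-_{i-(k-1)}+a$, with equality implying $w_\mu^{-1}(i)<w_\mu^{-1}(i-(k-1))$. Jack polynomials. Treating $c_0$ as an indeterminate, put $z_i=y_ix_i+c_0\sum_{1\le j'<i}\sum_{r=0}^{\ell-1}\zeta_i^rs_{ij'}\zeta_i^{-r}$. Then $f_\mu\in\mathbf{C}(c_0)[x_1,\dots,x_n]$ is the unique polynomial in which $x^\mu$ has coefficient $1$ and with $\zeta_if_\mu=\zeta^{-\mu_i}f_\mu$, $z_if_\mu=\left(\mu_i+1-(d_0-d_{-\mu_i-1})-\ell c_0(w_\mu(i)-1)\right)f_\mu$ for all $i$; it does not depend on the $d_i$. For $(\ell j,k)$-admissible $\mu$, $f_\mu$ has no pole at $c_0=j/k$. *)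

theory Defs
  imports
    Complex_Main
    "HOL-Library.Poly_Mapping"
    "HOL-Library.FuncSet"
    "HOL-Combinatorics.Permutations"
    "HOL-Computational_Algebra.Computational_Algebra"
    "HOL-Computational_Algebra.Field_as_Ring"
    "Jordan_Normal_Form.Gauss_Jordan_Elimination"
begin

text \<open>
  Matrices are 0-indexed in the library, so the variables are \<open>x\<^sub>0, \<dots>, x\<^sub>n\<^sub>-\<^sub>1\<close> and all indices
  \<open>i \<in> {1..n}\<close> of the mathematical text are shifted to \<open>i \<in> {0..<n}\<close>, including the positions
  and values of permutations and the entries of \<open>\<mu>\<close> and \<open>\<mu>\<^sup>-\<close>.

  Everything up to the Dunkl operators is defined over an arbitrary coefficient field, because the
  operators are needed both over the complex numbers and over the field of rational functions
  in an indeterminate \<open>c\<^sub>0\<close>.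
\<close>

text \<open>Finitely supported families of coefficients, in the variables \<open>x\<^sub>i\<close> for all natural \<open>i\<close>;
  the ring in the first \<open>n\<close> variables is the carrier set \<open>poly_ring n\<close>.\<close>

type_synonym 'a mpol = "(nat \<Rightarrow>\<^sub>0 nat) \<Rightarrow>\<^sub>0 'a"

definition exponents :: "nat \<Rightarrow> (nat \<Rightarrow>\<^sub>0 nat) set" where
  "exponents n = {\<mu>. Poly_Mapping.keys \<mu> \<subseteq> {0..<n}}"

definition poly_ring :: "nat \<Rightarrow> 'a::zero mpol set" where
  "poly_ring n = {f. Poly_Mapping.keys f \<subseteq> exponents n}"

definition const :: "'a::zero \<Rightarrow> 'a mpol" where
  "const a = Poly_Mapping.single 0 a"

definition var :: "nat \<Rightarrow> 'a::zero_neq_one mpol" where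
  "var i = Poly_Mapping.single (Poly_Mapping.single i 1) 1"

definition scale :: "'a::comm_semiring_1 \<Rightarrow> 'a mpol \<Rightarrow> 'a mpol" where
  "scale a f = const a * f"

interpretation mpol: vector_space "scale :: 'a::field \<Rightarrow> 'a mpol \<Rightarrow> 'a mpol"
proof
  fix a b :: 'a and f g :: "'a mpol"
  show "scale a (f + g) = scale a f + scale a g"
    by (simp add: scale_def distrib_left)
  show "scale (a + b) f = scale a f + scale b f"
    by (simp add: scale_def const_def single_add distrib_right)
  show "scale a (scale b f) = scale (a * b) f"
    by (simp add: scale_def const_def mult.assoc[symmetric] mult_single)
  show "scale 1 f = f"
    by (simp add: scale_def const_def)
qed

definition subst :: "(nat \<Rightarrow> 'a::comm_semiring_1 mpol) \<Rightarrow> 'a mpol \<Rightarrow> 'a mpol" where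
  "subst g f = (\<Sum>m\<in>Poly_Mapping.keys f. const (Poly_Mapping.lookup f m) *
     (\<Prod>i\<in>Poly_Mapping.keys m. g i ^ Poly_Mapping.lookup m i))"

text \<open>The truncated subtraction for \<open>m\<^sub>i = 0\<close> is harmless since the coefficient is then 0.\<close>

definition pderiv_var :: "nat \<Rightarrow> 'a::comm_semiring_1 mpol \<Rightarrow> 'a mpol" where
  "pderiv_var i f = (\<Sum>m\<in>Poly_Mapping.keys f.
     Poly_Mapping.single (m - Poly_Mapping.single i 1)
       (of_nat (Poly_Mapping.lookup m i) * Poly_Mapping.lookup f m))"

text \<open>The quotient \<open>f / g\<close> when \<open>g\<close> divides \<open>f\<close>; it is only used in that case.\<close>

definition exact_div :: "'a::field mpol \<Rightarrow> 'a mpol \<Rightarrow> 'a mpol" where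
  "exact_div f g = (THE q. q * g = f)"

lemma exact_div_mult: "g \<noteq> 0 \<Longrightarrow> exact_div (q * g) g = q"
  unfolding exact_div_def by (rule the_equality) auto

definition G_group :: "nat \<Rightarrow> nat \<Rightarrow> complex mat set" where
  "G_group l n = {w \<in> carrier_mat n n.
     (\<forall>a<n. \<exists>!b. b < n \<and> w $$ (a, b) \<noteq> 0) \<and>
     (\<forall>b<n. \<exists>!a. a < n \<and> w $$ (a, b) \<noteq> 0) \<and>
     (\<forall>a<n. \<forall>b<n. w $$ (a, b) \<noteq> 0 \<longrightarrow> w $$ (a, b) ^ l = 1)}"

text \<open>\<open>(w f)(v) = f (w\<^sup>-\<^sup>1 v)\<close>: the variable \<open>x\<^sub>a\<close> is replaced by the \<open>a\<close>-th coordinate of \<open>w\<^sup>-\<^sup>1 x\<close>.\<close>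

definition act :: "nat \<Rightarrow> 'a::field mat \<Rightarrow> 'a mpol \<Rightarrow> 'a mpol" where
  "act n w = subst (\<lambda>a. \<Sum>b<n. scale (the (mat_inverse w) $$ (a, b)) (var b))"

definition zeta_mat :: "nat \<Rightarrow> 'a::field \<Rightarrow> nat \<Rightarrow> 'a mat" where
  "zeta_mat n \<zeta> i = mat n n (\<lambda>(a, b). if a = b then (if a = i then \<zeta> else 1) else 0)"

text \<open>\<open>\<zeta>\<^sub>i\<^sup>r s\<^sub>i\<^sub>j \<zeta>\<^sub>i\<^sup>-\<^sup>r\<close>; the matrix of the transposition is \<open>swaprows_mat n i j\<close>.\<close>

definition refl_mat :: "nat \<Rightarrow> 'a::field \<Rightarrow> nat \<Rightarrow> nat \<Rightarrow> nat \<Rightarrow> 'a mat" where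
  "refl_mat n \<zeta> i j r =
     zeta_mat n \<zeta> i ^\<^sub>m r * swaprows_mat n i j * the (mat_inverse (zeta_mat n \<zeta> i ^\<^sub>m r))"

text \<open>The index \<open>i\<close> is the coordinate, \<open>r\<close> the exponent class: \<open>e_op l n \<zeta> i r\<close> projects onto the
  span of the monomials whose exponent of \<open>x\<^sub>i\<close> is congruent to \<open>-r\<close> modulo \<open>l\<close>.\<close>

definition e_op :: "nat \<Rightarrow> nat \<Rightarrow> 'a::field \<Rightarrow> nat \<Rightarrow> nat \<Rightarrow> 'a mpol \<Rightarrow> 'a mpol" where
  "e_op l n \<zeta> i r f = scale (1 / of_nat l)
     (\<Sum>t<l. scale (\<zeta> powi (- int (t * r))) (act n (zeta_mat n \<zeta> i ^\<^sub>m t) f))"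

definition dunkl ::
    "nat \<Rightarrow> nat \<Rightarrow> 'a::field \<Rightarrow> 'a \<Rightarrow> (int \<Rightarrow> 'a) \<Rightarrow> nat \<Rightarrow> 'a mpol \<Rightarrow> 'a mpol" where
  "dunkl l n \<zeta> c0 d i f =
     pderiv_var i f
     - scale c0 (\<Sum>j\<in>{0..<n} - {i}. \<Sum>r<l.
         exact_div (f - act n (refl_mat n \<zeta> i j r) f) (var i - scale (\<zeta> ^ r) (var j)))
     - exact_div (\<Sum>r<l. scale (d 0 - d (int r)) (e_op l n \<zeta> i r f)) (var i)"

text \<open>Elements of \<open>End(C[h])\<close> are represented by functions on the carrier that are
  extensional, i.e. \<open>undefined\<close> outside of \<open>poly_ring n\<close>.\<close>

inductive_set cherednik ::
    "nat \<Rightarrow> nat \<Rightarrow> complex \<Rightarrow> complex \<Rightarrow> (int \<Rightarrow> complex) \<Rightarrow> (complex mpol \<Rightarrow> complex mpol) set"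
  for l n \<zeta> c0 d where
  group: "w \<in> G_group l n \<Longrightarrow> restrict (act n w) (poly_ring n) \<in> cherednik l n \<zeta> c0 d"
| mult: "g \<in> poly_ring n \<Longrightarrow> (\<lambda>f\<in>poly_ring n. g * f) \<in> cherednik l n \<zeta> c0 d"
| dunkl: "i < n \<Longrightarrow> restrict (dunkl l n \<zeta> c0 d i) (poly_ring n) \<in> cherednik l n \<zeta> c0 d"
| plus: "A \<in> cherednik l n \<zeta> c0 d \<Longrightarrow> B \<in> cherednik l n \<zeta> c0 d \<Longrightarrow>
    (\<lambda>f\<in>poly_ring n. A f + B f) \<in> cherednik l n \<zeta> c0 d"
| scalar: "A \<in> cherednik l n \<zeta> c0 d \<Longrightarrow>
    (\<lambda>f\<in>poly_ring n. scale a (A f)) \<in> cherednik l n \<zeta> c0 d"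
| comp: "A \<in> cherednik l n \<zeta> c0 d \<Longrightarrow> B \<in> cherednik l n \<zeta> c0 d \<Longrightarrow>
    compose (poly_ring n) A B \<in> cherednik l n \<zeta> c0 d"

definition submodule_H ::
    "nat \<Rightarrow> nat \<Rightarrow> complex \<Rightarrow> complex \<Rightarrow> (int \<Rightarrow> complex) \<Rightarrow> complex mpol set \<Rightarrow> bool" where
  "submodule_H l n \<zeta> c0 d N \<longleftrightarrow> N \<subseteq> poly_ring n \<and> mpol.subspace N \<and>
     (\<forall>A\<in>cherednik l n \<zeta> c0 d. \<forall>f\<in>N. A f \<in> N)"

definition simple_submodule_H ::
    "nat \<Rightarrow> nat \<Rightarrow> complex \<Rightarrow> complex \<Rightarrow> (int \<Rightarrow> complex) \<Rightarrow> complex mpol set \<Rightarrow> bool" where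
  "simple_submodule_H l n \<zeta> c0 d N \<longleftrightarrow> submodule_H l n \<zeta> c0 d N \<and> N \<noteq> {0} \<and>
     (\<forall>M. submodule_H l n \<zeta> c0 d M \<and> M \<subseteq> N \<longrightarrow> M = {0} \<or> M = N)"

text \<open>The sum of a family of subspaces is the span of their union.\<close>

definition socle ::
    "nat \<Rightarrow> nat \<Rightarrow> complex \<Rightarrow> complex \<Rightarrow> (int \<Rightarrow> complex) \<Rightarrow> complex mpol set" where
  "socle l n \<zeta> c0 d = mpol.span (\<Union>{N. simple_submodule_H l n \<zeta> c0 d N})"

definition rearr :: "nat \<Rightarrow> (nat \<Rightarrow>\<^sub>0 nat) \<Rightarrow> nat \<Rightarrow> nat" where
  "rearr n \<mu> i = sort (map (Poly_Mapping.lookup \<mu>) [0..<n]) ! i"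

definition perm_length :: "nat \<Rightarrow> (nat \<Rightarrow> nat) \<Rightarrow> nat" where
  "perm_length n w = card {(a, b). a < b \<and> b < n \<and> w b < w a}"

definition w_perm :: "nat \<Rightarrow> (nat \<Rightarrow>\<^sub>0 nat) \<Rightarrow> nat \<Rightarrow> nat" where
  "w_perm n \<mu> = (ARG_MAX (perm_length n) w. w permutes {0..<n} \<and>
     (\<forall>i<n. Poly_Mapping.lookup \<mu> (inv_into UNIV w i) = rearr n \<mu> i))"

text \<open>With 0-based positions the range \<open>k \<le> i \<le> n\<close> becomes \<open>k - 1 \<le> i < n\<close>.\<close>

definition admissible :: "nat \<Rightarrow> nat \<Rightarrow> nat \<Rightarrow> (nat \<Rightarrow>\<^sub>0 nat) \<Rightarrow> bool" where
  "admissible n a k \<mu> \<longleftrightarrow> (\<forall>i. k - 1 \<le> i \<and> i < n \<longrightarrow>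
     rearr n \<mu> i \<ge> rearr n \<mu> (i - (k - 1)) + a \<and>
     (rearr n \<mu> i = rearr n \<mu> (i - (k - 1)) + a \<longrightarrow>
        inv_into UNIV (w_perm n \<mu>) i < inv_into UNIV (w_perm n \<mu>) (i - (k - 1))))"

definition z_op ::
    "nat \<Rightarrow> nat \<Rightarrow> 'a::field \<Rightarrow> 'a \<Rightarrow> (int \<Rightarrow> 'a) \<Rightarrow> nat \<Rightarrow> 'a mpol \<Rightarrow> 'a mpol" where
  "z_op l n \<zeta> c0 d i f = dunkl l n \<zeta> c0 d i (var i * f)
     + scale c0 (\<Sum>j<i. \<Sum>r<l. act n (refl_mat n \<zeta> i j r) f)"

definition ratfun_const :: "complex \<Rightarrow> complex poly fract" where
  "ratfun_const a = Fraction_Field.Fract [:a:] 1"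

definition ratfun_indet :: "complex poly fract" where
  "ratfun_indet = Fraction_Field.Fract [:0, 1:] 1"

text \<open>The 0-based value \<open>w\<^sub>\<mu>(i)\<close> below is the \<open>w\<^sub>\<mu>(i) - 1\<close> of the 1-based eigenvalue formula.\<close>

definition jack ::
    "nat \<Rightarrow> nat \<Rightarrow> complex \<Rightarrow> (int \<Rightarrow> complex) \<Rightarrow> (nat \<Rightarrow>\<^sub>0 nat) \<Rightarrow> complex poly fract mpol" where
  "jack l n \<zeta> d \<mu> = (let Z = ratfun_const \<zeta>; D = (\<lambda>i. ratfun_const (d i)) in
     THE f. f \<in> poly_ring n \<and> Poly_Mapping.lookup f \<mu> = 1 \<and>
       (\<forall>i<n. let m = Poly_Mapping.lookup \<mu> i in
          act n (zeta_mat n Z i) f = scale (Z powi (- int m)) f \<and>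
          z_op l n Z ratfun_indet D i f =
            scale (of_nat m + 1 - (D 0 - D (- int m - 1))
              - of_nat l * ratfun_indet * of_nat (w_perm n \<mu> i)) f))"

text \<open>The value at \<open>a\<close> of a rational function in lowest terms (0 if \<open>a\<close> is a pole).\<close>

definition ratfun_eval :: "complex \<Rightarrow> complex poly fract \<Rightarrow> complex" where
  "ratfun_eval a q = (case quot_of_fract q of (u, v) \<Rightarrow> poly u a / poly v a)"

lemma ratfun_eval_Fract:
  assumes "poly v a \<noteq> 0"
  shows "ratfun_eval a (Fraction_Field.Fract u v) = poly u a / poly v a"
proof -
  obtain s t where st: "quot_of_fract (Fraction_Field.Fract u v) = (s, t)"
    by (cases "quot_of_fract (Fraction_Field.Fract u v)")
  have v: "v \<noteq> 0" using assms by auto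
  have mem: "(s, t) \<in> normalized_fracts"
    using quot_of_fract_in_normalized_fracts[of "Fraction_Field.Fract u v"] st by simp
  then have t: "t \<noteq> 0" and cop: "coprime s t"
    by (auto simp: normalized_fracts_def)
  have "Fraction_Field.Fract s t = Fraction_Field.Fract u v"
    using quot_to_fract_quot_of_fract[of "Fraction_Field.Fract u v"] st
    by (simp add: quot_to_fract_def)
  then have eq: "s * v = u * t" using t v by (simp add: eq_fract)
  then have "t dvd s * v" by simp
  then have "t dvd v" using cop by (simp add: coprime_dvd_mult_right_iff coprime_commute)
  then have ta: "poly t a \<noteq> 0" using assms by (auto elim!: dvdE)
  have "poly s a * poly v a = poly u a * poly t a"
    using arg_cong[OF eq, of "\<lambda>p. poly p a"] by simp
  then show ?thesis using ta assms st
    by (simp add: ratfun_eval_def frac_eq_eq)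
qed

definition specialize :: "complex \<Rightarrow> complex poly fract mpol \<Rightarrow> complex mpol" where
  "specialize a f = Poly_Mapping.map (ratfun_eval a) f"

end

theory Submission
  imports Defs
begin

text \<open>
  On monomials the operators \<open>z\<^sub>i\<close> are triangular, so the weight of a joint eigenvector is read off
  from its leading exponent. Over the field of rational functions all weights are distinct, and the
  Jack polynomials are produced from 1 by the intertwiners \<open>\<Phi> = x\<^sub>n s\<^sub>n\<^sub>-\<^sub>1 \<dots> s\<^sub>1\<close> and
  \<open>s\<^sub>i + l c\<^sub>0 / (z\<^sub>i - z\<^sub>i\<^sub>+\<^sub>1)\<close>.

  At \<open>c\<^sub>0 = j / k\<close> the weight of an admissible exponent is still different from that of every other
  exponent, which excludes a pole of \<open>f\<^sub>\<mu>\<close> and makes the specialised \<open>f\<^sub>\<mu>\<close> the only eigenvector of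
  its weight. Hence an intertwiner either permutes the lines spanned by the \<open>f\<^sub>\<mu>\<close> or kills them: where
  the exchange of neighbours leaves the admissible set, the intertwiner vanishes because its
  coefficient is 1, and where lowering \<open>\<mu>\<close> violates a bound on \<open>\<mu>\<^sup>-\<close>, the eigenvalue of
  \<open>x\<^sub>n y\<^sub>n\<close> is zero. So the span of the \<open>f\<^sub>\<mu>\<close> is a submodule.

  Every nonzero submodule is an ideal and therefore meets this span; separating weights, it contains
  some \<open>f\<^sub>\<mu>\<close>, and invertible intertwiners then lead to all the others, because
  in terms of affine permutations any two of these exponents are connected by exchanges of
  neighbours that stay inside the set. So the span is the only simple submodule.
\<close>

text \<open>Weights separate at \<open>c0 = j / k\<close> for this reason. If two exponents agree in
  their residues modulo \<open>l\<close> and in all weights, coprimality of \<open>j\<close> and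
  \<open>k\<close> provides for each position an integer \<open>t\<close> such that the entries
  differ by \<open>l * j * t\<close> and the ranks by \<open>k * t\<close>; so a change of rank by
  \<open>k * t\<close> goes with a change of code by exactly \<open>n * l * j * t\<close>.
  Admissibility says that \<open>k - 1\<close> ranks already gain more than
  \<open>n * l * j\<close>, which leaves no room for a nontrivial rearrangement. The slack between
  \<open>k - 1\<close> and \<open>k\<close> tolerates one violated gap, so exponents just outside
  the admissible set are isolated too, and the image of an intertwiner there is a multiple of a
  single vector.

  The bounds come from \<open>y_n\<close>: lowering an entry \<open>p\<close> of rank
  \<open>m\<close> produces the factor \<open>p - (d 0 - d (- p)) - l * m * c0\<close>. If
  \<open>l\<close> divides \<open>p\<close>, the gaps themselves exclude a zero, which is why only
  the other \<open>p\<close> occur in the bounds. Likewise an exchange inside the set has the factor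
  1 or \<open>1 - e * e\<close>, and \<open>e = 1\<close> or \<open>e = - 1\<close> would contradict
  the gaps.\<close>

abbreviation lookup :: "('a \<Rightarrow>\<^sub>0 'b::zero) \<Rightarrow> 'a \<Rightarrow> 'b" where "lookup \<equiv> Poly_Mapping.lookup"
abbreviation keys :: "('a \<Rightarrow>\<^sub>0 'b::zero) \<Rightarrow> 'a set" where "keys \<equiv> Poly_Mapping.keys"
abbreviation pinv :: "(nat \<Rightarrow> nat) \<Rightarrow> nat \<Rightarrow> nat" where "pinv \<equiv> inv_into UNIV"

section \<open>Exponents and weights\<close>

text \<open>The order of the entries of \<open>\<mu>\<close> that defines \<open>w\<^sub>\<mu>\<close> is the order of their codes. The code of an
  entry determines its position modulo \<open>n\<close>, so that \<open>\<mu>\<close> becomes a set of \<open>n\<close> natural numbers with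
  distinct residues; the exchange of neighbours and the map \<open>\<mu> \<mapsto> (\<mu>\<^sub>2, \<dots>, \<mu>\<^sub>n, \<mu>\<^sub>1 + 1)\<close> become
  the generators of the affine symmetric group, and admissibility becomes a condition on the gaps
  of the sorted codes without the tie-breaking clause.\<close>

definition code :: "nat \<Rightarrow> (nat \<Rightarrow>\<^sub>0 nat) \<Rightarrow> nat \<Rightarrow> nat" where
  "code n \<mu> a = n * lookup \<mu> a + (n - 1 - a)"

text \<open>Extended by the identity outside \<open>{0..<n}\<close>, as \<open>permutes\<close>
  demands; it turns out to be \<open>w_perm\<close>.\<close>

definition rk :: "nat \<Rightarrow> (nat \<Rightarrow>\<^sub>0 nat) \<Rightarrow> nat \<Rightarrow> nat" where
  "rk n \<mu> a = (if a < n then card {b. b < n \<and> code n \<mu> b < code n \<mu> a} else a)"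

definition srt :: "nat \<Rightarrow> (nat \<Rightarrow>\<^sub>0 nat) \<Rightarrow> nat \<Rightarrow> nat" where
  "srt n \<mu> m = code n \<mu> (pinv (rk n \<mu>) m)"

text \<open>The operators \<open>z\<^sub>i\<close> are triangular with respect to this statistic.\<close>

definition energy :: "nat \<Rightarrow> (nat \<Rightarrow>\<^sub>0 nat) \<Rightarrow> nat" where
  "energy n \<mu> = (\<Sum>a<n. (code n \<mu> a)\<^sup>2)"

lemma code_div: "a < n \<Longrightarrow> code n \<mu> a div n = lookup \<mu> a"
proof -
  assume "a < n"
  then have "(n * lookup \<mu> a + r) div n = lookup \<mu> a" if "r < n" for r using that by simp
  from this[of "n - 1 - a"] show ?thesis unfolding code_def using \<open>a < n\<close> by linarith
qed

lemma code_mod: "a < n \<Longrightarrow> code n \<mu> a mod n = n - 1 - a"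
proof -
  assume "a < n"
  then have "(n * lookup \<mu> a + r) mod n = r" if "r < n" for r using that by simp
  from this[of "n - 1 - a"] show ?thesis unfolding code_def using \<open>a < n\<close> by linarith
qed

lemma code_eq_iff: "a < n \<Longrightarrow> b < n \<Longrightarrow> code n \<mu> a = code n \<mu> b \<longleftrightarrow> a = b"
  using code_mod[of a n \<mu>] code_mod[of b n \<mu>] by (metis Suc_pred' diff_diff_cancel diff_Suc_1 diff_Suc_eq_diff_pred gr_implies_not0 less_Suc_eq_le neq0_conv)

text \<open>Among equal entries the one further left has the greater code, just as the longest
  sorting permutation inverts every pair of equal entries.\<close>

lemma code_less_iff:
  assumes "a < n" "b < n"
  shows "code n \<mu> a < code n \<mu> b \<longleftrightarrow> lookup \<mu> a < lookup \<mu> b \<or> lookup \<mu> a = lookup \<mu> b \<and> b < a"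
proof -
  have *: "code n \<mu> x < code n \<mu> y" if "lookup \<mu> x < lookup \<mu> y" "x < n" "y < n" for x y
  proof -
    have "n * lookup \<mu> x + n \<le> n * lookup \<mu> y"
      using that by (metis Suc_leI add.commute mult_Suc_right mult_le_mono2)
    then show ?thesis using that by (auto simp: code_def)
  qed
  show ?thesis
    using *[of a b] *[of b a] assms
    by (cases "lookup \<mu> a" "lookup \<mu> b" rule: linorder_cases) (auto simp: code_def)
qed

lemma rk_less: "a < n \<Longrightarrow> rk n \<mu> a < n"
proof -
  assume a: "a < n"
  have "card {b. b < n \<and> code n \<mu> b < code n \<mu> a} < card {..<n}"
    by (rule psubset_card_mono) (use a in auto)
  then show ?thesis using a by (simp add: rk_def)
qed

lemma rk_less_iff:
  assumes "a < n" "b < n"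
  shows "rk n \<mu> a < rk n \<mu> b \<longleftrightarrow> code n \<mu> a < code n \<mu> b"
proof -
  have *: "rk n \<mu> x < rk n \<mu> y" if "code n \<mu> x < code n \<mu> y" "x < n" "y < n" for x y
  proof -
    have "card {b. b < n \<and> code n \<mu> b < code n \<mu> x} < card {b. b < n \<and> code n \<mu> b < code n \<mu> y}"
      by (rule psubset_card_mono) (use that in auto)
    then show ?thesis using that by (simp add: rk_def)
  qed
  show ?thesis
    using *[of a b] *[of b a] assms code_eq_iff[of a n b \<mu>]
    by (cases "code n \<mu> a" "code n \<mu> b" rule: linorder_cases) auto
qed

lemma rk_permutes: "rk n \<mu> permutes {0..<n}"
proof (rule bij_imp_permutes)
  have inj: "inj_on (rk n \<mu>) {0..<n}"
  proof (rule inj_onI)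
    fix a b assume "a \<in> {0..<n}" "b \<in> {0..<n}" "rk n \<mu> a = rk n \<mu> b"
    then have "\<not> code n \<mu> a < code n \<mu> b" "\<not> code n \<mu> b < code n \<mu> a" "a < n" "b < n"
      by (simp_all flip: rk_less_iff)
    then show "a = b" by (metis code_eq_iff linorder_neqE_nat)
  qed
  have "rk n \<mu> ` {0..<n} \<subseteq> {0..<n}" using rk_less by auto
  then show "bij_betw (rk n \<mu>) {0..<n} {0..<n}"
    using inj by (simp add: bij_betw_def endo_inj_surj)
qed (simp add: rk_def)

lemma rk_inv [simp]: "rk n \<mu> (pinv (rk n \<mu>) m) = m" "pinv (rk n \<mu>) (rk n \<mu> m) = m"
  using permutes_inverses[OF rk_permutes] by auto

lemma inv_rk_less [simp]: "pinv (rk n \<mu>) m < n \<longleftrightarrow> m < n"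
  using permutes_in_image[OF permutes_inv[OF rk_permutes[of n \<mu>]], of m] by simp

lemma srt_rk [simp]: "srt n \<mu> (rk n \<mu> a) = code n \<mu> a"
  by (simp add: srt_def)

lemma srt_less_iff: "x < n \<Longrightarrow> y < n \<Longrightarrow> srt n \<mu> x < srt n \<mu> y \<longleftrightarrow> x < y"
  using rk_less_iff[of "pinv (rk n \<mu>) x" n "pinv (rk n \<mu>) y" \<mu>] by (simp add: srt_def)

section \<open>The sorted rearrangement and the longest sorting permutation\<close>

lemma rearr_eq_inv:
  assumes "\<And>a b. a < b \<Longrightarrow> b < n \<Longrightarrow> lookup \<mu> (v a) \<le> lookup \<mu> (v b)"
    and v: "v permutes {0..<n}" and m: "m < n"
  shows "rearr n \<mu> m = lookup \<mu> (v m)"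
proof -
  have "sort (map (lookup \<mu>) [0..<n]) = map (lookup \<mu> \<circ> v) [0..<n]"
  proof (rule properties_for_sort)
    have "image_mset v (mset_set {0..<n}) = mset_set {0..<n}"
      using permutes_image[OF v] permutes_inj_on[OF v] by (simp add: image_mset_mset_set)
    then show "mset (map (lookup \<mu> \<circ> v) [0..<n]) = mset (map (lookup \<mu>) [0..<n])"
      by (simp flip: image_mset.compositionality[unfolded comp_def] add: image_mset.compositionality[symmetric])
    show "sorted (map (lookup \<mu> \<circ> v) [0..<n])"
      using assms(1) by (auto simp: sorted_iff_nth_mono_less)
  qed
  then show ?thesis using m by (simp add: rearr_def)
qed

lemma rearr_inv_rk:
  assumes "m < n" shows "rearr n \<mu> m = lookup \<mu> (pinv (rk n \<mu>) m)"
proof (rule rearr_eq_inv[OF _ permutes_inv[OF rk_permutes] assms])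
  fix a b assume "a < b" "b < n"
  then have "srt n \<mu> a < srt n \<mu> b" by (simp add: srt_less_iff)
  then show "lookup \<mu> (pinv (rk n \<mu>) a) \<le> lookup \<mu> (pinv (rk n \<mu>) b)"
    using \<open>a < b\<close> \<open>b < n\<close> by (auto simp: srt_def code_less_iff)
qed

lemma rearr_srt: "m < n \<Longrightarrow> rearr n \<mu> m = srt n \<mu> m div n"
  by (simp add: rearr_inv_rk srt_def code_div)

lemma rearr_rk: "a < n \<Longrightarrow> rearr n \<mu> (rk n \<mu> a) = lookup \<mu> a"
  by (simp add: rearr_inv_rk rk_less)

text \<open>A sorting permutation can only invert the pairs \<open>a < b\<close> with \<open>\<mu>\<^sub>b \<le> \<mu>\<^sub>a\<close>, and \<open>rk\<close> inverts
  all of them; the number of inversions determines it because a permutation is recovered from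
  its set of inversions.\<close>

lemma w_perm_rk: "w_perm n \<mu> = rk n \<mu>"
proof -
  let ?P = "\<lambda>w. w permutes {0..<n} \<and> (\<forall>i<n. lookup \<mu> (pinv w i) = rearr n \<mu> i)"
  define I where "I w = {(a, b). a < b \<and> b < n \<and> w b < (w a :: nat)}" for w
  define J where "J = {(a, b). a < b \<and> b < n \<and> lookup \<mu> b \<le> lookup \<mu> a}"
  have finJ: "finite J" by (rule finite_subset[of _ "{..<n} \<times> {..<n}"]) (auto simp: J_def)
  have rkP: "?P (rk n \<mu>)" by (simp add: rk_permutes rearr_inv_rk)
  have IJ: "I w \<subseteq> J" if w: "?P w" for w
  proof
    fix p assume "p \<in> I w"
    then obtain a b where p: "p = (a, b)" "a < b" "b < n" "w b < w a" by (auto simp: I_def)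
    have in_n: "w x < n" if "x < n" for x using w that permutes_in_image[of w "{0..<n}" x] by auto
    have mu: "lookup \<mu> x = rearr n \<mu> (w x)" if "x < n" for x
    proof -
      have "lookup \<mu> (pinv w (w x)) = rearr n \<mu> (w x)" using w in_n[OF that] by blast
      then show ?thesis using w permutes_inverses(2)[of w "{0..<n}" x] by simp
    qed
    have "srt n \<mu> (w b) < srt n \<mu> (w a)" using p in_n by (simp add: srt_less_iff)
    then have "lookup \<mu> b \<le> lookup \<mu> a" using p in_n
      by (simp add: mu rearr_srt div_le_mono)
    then show "p \<in> J" using p by (simp add: J_def)
  qed
  have "I (rk n \<mu>) = J"
    using IJ[OF rkP] by (auto simp: I_def J_def rk_less_iff code_less_iff)
  have len: "perm_length n w = card (I w)" for w by (simp add: perm_length_def I_def)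
  have "\<forall>w. ?P w \<longrightarrow> perm_length n w < Suc (card J)"
    using IJ finJ by (simp add: len card_mono less_Suc_eq_le)
  from arg_max_nat_lemma[of ?P, OF rkP this]
  have max: "?P (w_perm n \<mu>) \<and> (\<forall>w. ?P w \<longrightarrow> perm_length n w \<le> perm_length n (w_perm n \<mu>))"
    unfolding w_perm_def .
  then have w: "?P (w_perm n \<mu>)" by (rule conjunct1)
  have "card J \<le> card (I (w_perm n \<mu>))"
    using max[THEN conjunct2, rule_format, OF rkP] \<open>I (rk n \<mu>) = J\<close> by (simp add: len)
  then have IwJ: "I (w_perm n \<mu>) = J" using IJ[OF w] finJ by (simp add: card_seteq)
  let ?w = "w_perm n \<mu>"
  have perm: "?w permutes {0..<n}" using w by simp
  show ?thesis
  proof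
    fix a
    show "?w a = rk n \<mu> a"
    proof (cases "a < n")
      case True
      have wle: "?w x < n \<longleftrightarrow> x < n" for x using permutes_in_image[OF perm, of x] by auto
      have "?w b < ?w a \<longleftrightarrow> code n \<mu> b < code n \<mu> a" if "b < n" for b
      proof (cases a b rule: linorder_cases)
        case less
        then have "?w b < ?w a \<longleftrightarrow> (a, b) \<in> I ?w" using that by (simp add: I_def)
        then show ?thesis using less that True by (auto simp: IwJ J_def code_less_iff)
      next
        case greater
        have "?w b \<noteq> ?w a" using greater by (simp add: inj_eq[OF permutes_inj[OF perm]])
        then have "?w b < ?w a \<longleftrightarrow> (b, a) \<notin> I ?w" using that True greater by (auto simp: I_def)
        then show ?thesis using greater that True by (auto simp: IwJ J_def code_less_iff)
      qed simp
      \<comment> \<open>A value of a permutation is the number of values below it, and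
        \<open>?w\<close> orders every pair of positions as the codes do.\<close>
      then have "rk n \<mu> a = card {b. b < n \<and> ?w b < ?w a}"
        using True by (auto simp: rk_def intro!: arg_cong[where f = card])
      also have "{b. b < n \<and> ?w b < ?w a} = pinv ?w ` {..<?w a}"
      proof -
        have "b \<in> pinv ?w ` {..<?w a} \<longleftrightarrow> ?w b < ?w a" for b
          by (auto simp: permutes_inverses[OF perm] intro: image_eqI[of _ _ "?w b"])
        moreover have "b < n" if "?w b < ?w a" for b using that wle[of a] wle[of b] True by auto
        ultimately show ?thesis by blast
      qed
      also have "card \<dots> = ?w a"
        using permutes_inj_on[OF permutes_inv[OF perm]] by (simp add: card_image)
      finally show ?thesis by simp
    next
      case False
      then show ?thesis using permutes_not_in[OF perm, of a] by (simp add: rk_def)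
    qed
  qed
qed

section \<open>Admissibility as a gap condition, and uniqueness of gapped weights\<close>

definition gap_at :: "nat \<Rightarrow> nat \<Rightarrow> nat \<Rightarrow> (nat \<Rightarrow>\<^sub>0 nat) \<Rightarrow> nat \<Rightarrow> bool" where
  "gap_at n a k \<mu> x \<longleftrightarrow> (x + (k - 1) < n \<longrightarrow> srt n \<mu> x + n * a < srt n \<mu> (x + (k - 1)))"

text \<open>A difference of one between entries outweighs all positions, and for
  \<open>lookup \<mu> q = lookup \<mu> p + a\<close> the codes are compared by position, which is
  the tie clause. So both clauses merge into one strict inequality.\<close>

lemma admissible_iff_gap:
  "admissible n a k \<mu> \<longleftrightarrow> (\<forall>x. gap_at n a k \<mu> x)"
proof -
  have *: "(rearr n \<mu> y \<ge> rearr n \<mu> x + a \<and>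
     (rearr n \<mu> y = rearr n \<mu> x + a \<longrightarrow> pinv (w_perm n \<mu>) y < pinv (w_perm n \<mu>) x))
     \<longleftrightarrow> srt n \<mu> x + n * a < srt n \<mu> y" if "x < n" "y < n" for x y
  proof -
    define p q where "p = pinv (rk n \<mu>) x" and "q = pinv (rk n \<mu>) y"
    have pq: "p < n" "q < n" using that by (auto simp: p_def q_def)
    consider "lookup \<mu> p + a = lookup \<mu> q" | "lookup \<mu> p + a + 1 \<le> lookup \<mu> q"
      | "lookup \<mu> q + 1 \<le> lookup \<mu> p + a" by linarith
    then have "n * (lookup \<mu> p + a) + (n - 1 - p) < n * lookup \<mu> q + (n - 1 - q) \<longleftrightarrow>
      lookup \<mu> p + a \<le> lookup \<mu> q \<and> (lookup \<mu> q = lookup \<mu> p + a \<longrightarrow> q < p)"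
    proof cases
      case 1
      then show ?thesis using pq by (auto simp flip: 1)
    next
      case 2
      have "n * (lookup \<mu> p + a + 1) \<le> n * lookup \<mu> q" using 2 by (rule mult_le_mono2)
      then show ?thesis using pq 2 by (auto simp: algebra_simps)
    next
      case 3
      have "n * (lookup \<mu> q + 1) \<le> n * (lookup \<mu> p + a)" using 3 by (rule mult_le_mono2)
      then show ?thesis using pq 3 by (auto simp: algebra_simps)
    qed
    then show ?thesis using that
      by (simp add: w_perm_rk rearr_inv_rk srt_def code_def p_def[symmetric] q_def[symmetric] algebra_simps)
  qed
  show ?thesis
  proof
    assume L: "admissible n a k \<mu>"
    show "\<forall>x. gap_at n a k \<mu> x"
      unfolding gap_at_def
    proof (intro allI impI)
      fix x assume x: "x + (k - 1) < n"
      show "srt n \<mu> x + n * a < srt n \<mu> (x + (k - 1))"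
        using L[unfolded admissible_def, rule_format, of "x + (k - 1)"] *[of x "x + (k - 1)"] x by simp
    qed
  next
    assume R: "\<forall>x. gap_at n a k \<mu> x"
    show "admissible n a k \<mu>"
      unfolding admissible_def
    proof (intro allI impI, elim conjE)
      fix i assume i: "k - 1 \<le> i" "i < n"
      show "rearr n \<mu> (i - (k - 1)) + a \<le> rearr n \<mu> i \<and>
         (rearr n \<mu> i = rearr n \<mu> (i - (k - 1)) + a \<longrightarrow>
          pinv (w_perm n \<mu>) i < pinv (w_perm n \<mu>) (i - (k - 1)))"
        using *[of "i - (k - 1)" i] R[unfolded gap_at_def, rule_format, of "i - (k - 1)"] i by simp
    qed
  qed
qed

text \<open>The exceptional index \<open>x0\<close> covers the exponents that lose admissibility by one exchange of
  neighbours: they still have an isolated weight.\<close>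

locale gaps =
  fixes N :: "nat \<Rightarrow> int" and n k x0 :: nat and c :: int
  assumes mono: "\<And>x y. x < y \<Longrightarrow> y < n \<Longrightarrow> N x < N y"
    and gap: "\<And>x. x + (k - 1) < n \<Longrightarrow> x \<noteq> x0 \<Longrightarrow> N x + c < N (x + (k - 1))"
    and k2: "2 \<le> k"
begin

text \<open>The window of length \<open>k\<close> contains the windows of length
  \<open>k - 1\<close> at \<open>y\<close> and at \<open>y + 1\<close>. At most one of them is
  exceptional, and monotonicity covers the index left over.\<close>

lemma step: "y + k < n \<Longrightarrow> N y + c < N (y + k)"
proof (cases "y = x0")
  case True
  assume "y + k < n"
  then have "N (y + 1) + c < N (y + 1 + (k - 1))" using k2 True by (intro gap) auto
  moreover have "N y < N (y + 1)" using k2 \<open>y + k < n\<close> by (intro mono) auto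
  ultimately show ?thesis using k2 by simp
next
  case False
  assume "y + k < n"
  then have "N y + c < N (y + (k - 1))" using False k2 by (intro gap) auto
  moreover have "N (y + (k - 1)) < N (y + k)" using k2 \<open>y + k < n\<close> by (intro mono) auto
  ultimately show ?thesis by simp
qed

lemma steps: "y + v * k < n \<Longrightarrow> N y + int v * c \<le> N (y + v * k)"
proof (induction v)
  case (Suc v)
  then have "N (y + v * k) + c < N (y + v * k + k)" by (intro step) simp
  with Suc show ?case by (simp add: algebra_simps)
qed simp

text \<open>One of the \<open>v\<close> windows is shortened from \<open>k\<close> to
  \<open>k - 1\<close>: the first one if \<open>x\<close> is not exceptional, otherwise the last
  one, whose start \<open>x + (v - 1) * k\<close> differs from \<open>x0\<close> because
  \<open>v\<close> is at least 2.\<close>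

lemma chain:
  assumes "x + v * k - 1 < n" "1 \<le> v" "2 \<le> v \<or> x \<noteq> x0"
  shows "N x + int v * c < N (x + v * k - 1)"
proof (cases "x = x0")
  case False
  have *: "x + (k - 1) + (v - 1) * k = x + v * k - 1"
    using assms(2) k2 by (cases v) auto
  have "N x + c < N (x + (k - 1))"
    using False assms * by (intro gap) auto
  moreover have "N (x + (k - 1)) + int (v - 1) * c \<le> N (x + (k - 1) + (v - 1) * k)"
    using assms * by (intro steps) auto
  moreover have "int v * c = c + int (v - 1) * c" using assms(2) by (simp add: of_nat_diff algebra_simps)
  ultimately show ?thesis unfolding * by linarith
next
  case True
  then have "2 \<le> v" using assms by simp
  have *: "x + (v - 1) * k + (k - 1) = x + v * k - 1"
    using assms(2) k2 by (cases v) auto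
  have "N (x + (v - 1) * k) + c < N (x + (v - 1) * k + (k - 1))"
    using True assms * \<open>2 \<le> v\<close> k2 by (intro gap) auto
  moreover have "N x + int (v - 1) * c \<le> N (x + (v - 1) * k)"
    using assms * k2 by (intro steps) auto
  moreover have "int v * c = c + int (v - 1) * c" using assms(2) by (simp add: of_nat_diff algebra_simps)
  ultimately show ?thesis unfolding * by linarith
qed

text \<open>At the largest index that \<open>\<pi>\<close> raises and at the smallest one that it lowers, the chain of
  gaps contradicts the monotonicity of \<open>M\<close> unless it runs into the exceptional index \<open>x0\<close>; this
  can not happen at both ends.\<close>

lemma permutation_id:
  assumes \<pi>: "\<pi> permutes {0..<n}"
    and M: "\<And>x y. x < y \<Longrightarrow> y < n \<Longrightarrow> M x < M y"
    and rel: "\<And>m. m < n \<Longrightarrow> \<exists>t. int (\<pi> m) = int m + int k * t \<and> N (\<pi> m) = M m + c * t"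
    and m: "m < n"
  shows "\<pi> m = m"
proof -
  have pin: "\<pi> x < n \<longleftrightarrow> x < n" for x using permutes_in_image[OF \<pi>, of x] by auto
  have pinj: "\<pi> x = \<pi> y \<Longrightarrow> x = y" for x y using permutes_inj[OF \<pi>] by (auto dest: injD)
  \<comment> \<open>Since \<open>M\<close> increases, \<open>N (\<pi> x)\<close> exceeds
    \<open>N (\<pi> (Suc x))\<close> by less than \<open>v * c\<close>, although the indices are
    \<open>v * k - 1\<close> apart. By \<open>chain\<close> this happens only for
    \<open>v = 1\<close> and a window that starts at \<open>x0\<close>.\<close>
  have descent: "\<pi> (Suc x) = x0 \<and> \<pi> x = x0 + k - 1 \<and> (\<pi> x = x \<or> \<pi> (Suc x) = Suc x)"
    if x: "Suc x < n" and le: "x \<le> \<pi> x" "\<pi> (Suc x) \<le> Suc x" and ne: "\<pi> x \<noteq> x \<or> \<pi> (Suc x) \<noteq> Suc x" for x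
  proof -
    obtain t where t: "int (\<pi> x) = int x + int k * t" "N (\<pi> x) = M x + c * t" using rel[of x] x by auto
    obtain s where s: "int (\<pi> (Suc x)) = int (Suc x) + int k * s" "N (\<pi> (Suc x)) = M (Suc x) + c * s"
      using rel[of "Suc x"] x by auto
    have "0 \<le> int k * t" using t le by linarith
    then have t0: "0 \<le> t" using k2 by (simp add: zero_le_mult_iff)
    have "int k * s \<le> 0" using s le by linarith
    then have s0: "s \<le> 0" using k2 by (simp add: mult_le_0_iff)
    define v where "v = nat (t - s)"
    have v: "int v = t - s" using t0 s0 by (simp add: v_def)
    have v1: "1 \<le> v"
    proof (rule ccontr)
      assume "\<not> 1 \<le> v"
      then have "t = 0" "s = 0" using v t0 s0 by auto
      then show False using ne t s by simp
    qed
    have pos: "int (\<pi> x) = int (\<pi> (Suc x)) + int v * int k - 1" 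
    proof -
      have "t = s + int v" using v by simp
      then show ?thesis using t(1) s(1) by (simp add: algebra_simps)
    qed
    have pos': "\<pi> x = \<pi> (Suc x) + v * k - 1"
    proof -
      have "1 \<le> v * k" using v1 k2 by (simp add: Suc_le_eq)
      then show ?thesis using pos by (simp add: of_nat_diff flip: of_nat_mult of_nat_add)
    qed
    have "M x < M (Suc x)" using M x by simp
    then have "N (\<pi> x) < N (\<pi> (Suc x)) + int v * c" using t(2) s(2) unfolding v by (simp add: algebra_simps)
    then have "\<not> (2 \<le> v \<or> \<pi> (Suc x) \<noteq> x0)"
      using chain[of "\<pi> (Suc x)" v] pos' v1 pin[of x] x by auto
    then have "v = 1" "\<pi> (Suc x) = x0" using v1 by auto
    moreover have "t = 0 \<or> s = 0" using v \<open>v = 1\<close> t0 s0 by auto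
    ultimately show ?thesis using pos' t s by auto
  qed
  have up: "\<exists>x. Suc x < n \<and> \<pi> x = x0 + k - 1 \<and> \<pi> (Suc x) = x0 \<and> \<pi> (Suc x) = Suc x"
    if "y < n" "y < \<pi> y" for y
  proof -
    define x where "x = Max {y. y < n \<and> y < \<pi> y}"
    have "x \<in> {y. y < n \<and> y < \<pi> y}" unfolding x_def by (rule Max_in) (use that in auto)
    then have x: "x < n" "x < \<pi> x" by auto
    then have "Suc x < n" using pin[of x] by simp
    have "\<not> Suc x < \<pi> (Suc x)"
    proof
      assume "Suc x < \<pi> (Suc x)"
      then have "Suc x \<le> x" unfolding x_def using \<open>Suc x < n\<close>
        by (intro Max_ge) (auto simp: x_def)
      then show False by simp
    qed
    then show ?thesis using descent[of x] x \<open>Suc x < n\<close> by auto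
  qed
  have down: "\<exists>x. Suc x < n \<and> \<pi> x = x0 + k - 1 \<and> \<pi> (Suc x) = x0 \<and> \<pi> x = x"
    if "y < n" "\<pi> y < y" for y
  proof -
    define x where "x = (LEAST y. y < n \<and> \<pi> y < y)"
    have x: "x < n" "\<pi> x < x" using LeastI[of "\<lambda>y. y < n \<and> \<pi> y < y" y] that by (auto simp: x_def)
    then obtain z where z: "x = Suc z" by (cases x) auto
    have "\<not> (z < n \<and> \<pi> z < z)" using not_less_Least[of z "\<lambda>y. y < n \<and> \<pi> y < y"] z by (auto simp: x_def)
    then show ?thesis using descent[of z] x z by (auto intro!: exI[of _ z])
  qed
  \<comment> \<open>A permutation preserves the sum of the indices, so it cannot only raise or only
    lower.\<close>
  have *: "(\<exists>y<n. y < \<pi> y) \<longleftrightarrow> (\<exists>y<n. \<pi> y < y)"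
  proof -
    have sum: "sum \<pi> {0..<n} = sum id {0..<n}"
      using sum.permute[OF \<pi>, of id] by (simp add: comp_def id_def)
    show ?thesis
    proof
      assume "\<exists>y<n. y < \<pi> y"
      then obtain y where y: "y < n" "y < \<pi> y" by auto
      show "\<exists>y<n. \<pi> y < y"
      proof (rule ccontr)
        assume "\<not> ?thesis"
        then have "sum id {0..<n} < sum \<pi> {0..<n}"
          using y by (intro sum_strict_mono_ex1) (auto simp: not_less, metis not_le)
        then show False using sum by simp
      qed
    next
      assume "\<exists>y<n. \<pi> y < y"
      then obtain y where y: "y < n" "\<pi> y < y" by auto
      show "\<exists>y<n. y < \<pi> y"
      proof (rule ccontr)
        assume "\<not> ?thesis"
        then have "sum \<pi> {0..<n} < sum id {0..<n}"
          using y by (intro sum_strict_mono_ex1) (auto simp: not_less, metis not_le)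
        then show False using sum by simp
      qed
    qed
  qed
  show ?thesis
  proof (rule ccontr)
    assume "\<pi> m \<noteq> m"
    then obtain y z where "y < n" "y < \<pi> y" "z < n" "\<pi> z < z"
      using * m by (metis linorder_neqE_nat)
    then obtain u w where "\<pi> u = x0 + k - 1" "\<pi> (Suc u) = x0" "\<pi> (Suc u) = Suc u"
      "\<pi> w = x0 + k - 1" "\<pi> (Suc w) = x0" "\<pi> w = w"
      using up[of y] down[of z] by metis
    \<comment> \<open>Both ends yield the same pair of neighbours, now fixed by
      \<open>\<pi>\<close>, which puts \<open>x0 + k - 1\<close> directly before
      \<open>x0\<close>.\<close>
    then have "u = w" "Suc u = x0" "u = x0 + k - 1" using pinj by metis+
    then show False using k2 by simp
  qed
qed

end

lemma exponents_eqI: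
  "\<mu> \<in> exponents n \<Longrightarrow> \<nu> \<in> exponents n \<Longrightarrow> (\<And>i. i < n \<Longrightarrow> lookup \<mu> i = lookup \<nu> i) \<Longrightarrow> \<mu> = \<nu>"
proof (rule poly_mapping_eqI)
  fix i assume A: "\<mu> \<in> exponents n" "\<nu> \<in> exponents n" "\<And>i. i < n \<Longrightarrow> lookup \<mu> i = lookup \<nu> i"
  show "lookup \<mu> i = lookup \<nu> i"
  proof (cases "i < n")
    case False
    then have "i \<notin> keys \<mu>" "i \<notin> keys \<nu>" using A by (auto simp: exponents_def)
    then show ?thesis by (simp add: in_keys_iff)
  qed (use A in auto)
qed

text \<open>Gaps are asked of \<open>\<mu>\<close> alone; the competitor \<open>\<nu>\<close> only
  contributes the increasing sequence \<open>M\<close> of its sorted codes. The permutation shown to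
  be trivial compares the two rankings.\<close>

lemma gapped_weight_unique:
  assumes "\<mu> \<in> exponents n" "\<nu> \<in> exponents n" "2 \<le> k"
    and gap: "\<And>x. x \<noteq> x0 \<Longrightarrow> gap_at n L k \<mu> x"
    and rel: "\<And>i. i < n \<Longrightarrow> \<exists>t. int (lookup \<mu> i) = int (lookup \<nu> i) + int L * t \<and>
       int (rk n \<mu> i) = int (rk n \<nu> i) + int k * t"
  shows "\<mu> = \<nu>"
proof -
  interpret gaps "\<lambda>x. int (srt n \<mu> x)" n k x0 "int (n * L)"
    using gap assms(3) by unfold_locales (auto simp: srt_less_iff gap_at_def simp flip: of_nat_add of_nat_mult)
  define \<pi> where "\<pi> = rk n \<mu> \<circ> pinv (rk n \<nu>)"
  have code: "int (code n \<mu> i) = int (code n \<nu> i) + int (n * L) * t"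
    if "int (lookup \<mu> i) = int (lookup \<nu> i) + int L * t" for i t
    using that by (simp add: code_def algebra_simps)
  have "\<pi> m = m" if "m < n" for m
  proof (rule permutation_id[where M = "\<lambda>x. int (srt n \<nu> x)", OF _ _ _ that])
    show "\<pi> permutes {0..<n}"
      unfolding \<pi>_def by (intro permutes_compose permutes_inv rk_permutes)
    fix m assume "m < n"
    then obtain t where "int (lookup \<mu> (pinv (rk n \<nu>) m)) = int (lookup \<nu> (pinv (rk n \<nu>) m)) + int L * t"
       "int (\<pi> m) = int m + int k * t"
      using rel[of "pinv (rk n \<nu>) m"] by (auto simp: \<pi>_def)
    then show "\<exists>t. int (\<pi> m) = int m + int k * t \<and> int (srt n \<mu> (\<pi> m)) = int (srt n \<nu> m) + int (n * L) * t"
      using code[of "pinv (rk n \<nu>) m" t] by (auto simp: \<pi>_def srt_def intro!: exI[of _ t])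
  qed (simp add: srt_less_iff)
  then have "rk n \<mu> i = rk n \<nu> i" if "i < n" for i
    using rk_less[OF that, of \<nu>] by (metis \<pi>_def comp_apply rk_inv(2))
  then have "lookup \<mu> i = lookup \<nu> i" if "i < n" for i
    using rel[OF that] that assms(3) by auto
  then show ?thesis using assms by (intro exponents_eqI) auto
qed

section \<open>Linear operators on polynomials\<close>

abbreviation eps :: "nat \<Rightarrow> (nat \<Rightarrow>\<^sub>0 nat)" where "eps i \<equiv> Poly_Mapping.single i (Suc 0)"

definition xmon :: "(nat \<Rightarrow>\<^sub>0 nat) \<Rightarrow> 'a::comm_ring_1 mpol" where
  "xmon m = Poly_Mapping.single m 1"

lemma lookup_scale [simp]: "lookup (scale a f) m = a * lookup f (m :: nat \<Rightarrow>\<^sub>0 nat)"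
  unfolding scale_def const_def mult_map_scale_conv_mult[symmetric]
  by (auto simp: Poly_Mapping.map.rep_eq when_def)

lemma lookup_xmon: "lookup (xmon m) m' = (if m = m' then 1 else 0)"
  by (simp add: xmon_def lookup_single when_def)

lemma keys_xmon [simp]: "keys (xmon m :: 'a::comm_ring_1 mpol) = {m}"
  by (simp add: xmon_def)

lemma scale_linear:
  fixes f g :: "'a::comm_ring_1 mpol"
  shows "scale a (f + g) = scale a f + scale a g" "scale a (f - g) = scale a f - scale a g"
    "scale a (- f) = - scale a f" "scale a (scale b f) = scale (a * b) f"
    "scale (a + b) f = scale a f + scale b f" "scale (a - b) f = scale a f - scale b f"
    "scale 0 f = 0" "scale 1 f = f" "scale a 0 = 0" "scale a (sum F S) = (\<Sum>x\<in>S. scale a (F x))"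
  by (rule poly_mapping_eqI; simp add: lookup_add lookup_minus lookup_sum algebra_simps sum_distrib_left)+

lemma scale_times:
  fixes f g :: "'a::comm_ring_1 mpol"
  shows "g * scale a f = scale a (g * f)" "scale a f * g = scale a (f * g)"
  by (simp_all add: scale_def mult.left_commute mult.assoc)

lemmas scale_algebra = scale_linear scale_times

definition lin :: "((nat \<Rightarrow>\<^sub>0 nat) \<Rightarrow> 'a mpol) \<Rightarrow> 'a::comm_ring_1 mpol \<Rightarrow> 'a mpol" where
  "lin g f = (\<Sum>m\<in>keys f. scale (lookup f m) (g m))"

lemma lin_superset:
  "finite S \<Longrightarrow> keys f \<subseteq> S \<Longrightarrow> lin g f = (\<Sum>m\<in>S. scale (lookup f m) (g m))"
  unfolding lin_def by (rule sum.mono_neutral_left) (auto simp: in_keys_iff scale_algebra)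

definition linop :: "('a::comm_ring_1 mpol \<Rightarrow> 'a mpol) \<Rightarrow> bool" where
  "linop A \<longleftrightarrow> (\<forall>f g. A (f + g) = A f + A g) \<and> (\<forall>a f. A (scale a f) = scale a (A f))"

lemma linopD:
  assumes "linop A"
  shows "A (f + g) = A f + A g" "A (scale a f) = scale a (A f)" "A 0 = 0" "A (- f) = - A f"
    "A (f - g) = A f - A g" "A (sum F S) = (\<Sum>x\<in>S. A (F x))"
proof -
  show add: "A (f + g) = A f + A g" for f g using assms by (simp add: linop_def)
  show sc: "A (scale a f) = scale a (A f)" for a f using assms by (simp add: linop_def)
  show 0: "A 0 = 0" using sc[of 0 0] by (simp add: scale_algebra)
  show minus: "A (- f) = - A f" for f using add[of f "- f"] 0 by (simp add: eq_neg_iff_add_eq_0 add.commute)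
  show "A (f - g) = A f - A g" using add[of f "- g"] minus[of g] by simp
  show "A (sum F S) = (\<Sum>x\<in>S. A (F x))"
    by (induction S rule: infinite_finite_induct) (simp_all add: add 0)
qed

lemma linop_lin: "linop (lin g)"
  unfolding linop_def
proof (intro conjI allI)
  fix f h
  show "lin g (f + h) = lin g f + lin g h"
    using keys_add[of f h] lin_superset[of "keys f \<union> keys h" "f + h" g]
      lin_superset[of "keys f \<union> keys h" f g] lin_superset[of "keys f \<union> keys h" h g]
    by (simp add: lookup_add scale_algebra sum.distrib)
next
  fix a and f :: "'a mpol"
  have "keys (scale a f) \<subseteq> keys f" by (auto simp: in_keys_iff)
  then show "lin g (scale a f) = scale a (lin g f)"
    using lin_superset[of "keys f" "scale a f" g] by (simp add: lin_def scale_algebra)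
qed

lemma linop_times: "linop (\<lambda>f. g * f)"
  by (simp add: linop_def scale_algebra distrib_left)

lemma linop_combine:
  assumes "linop A" "linop B"
  shows "linop (\<lambda>f. A f + B f)" "linop (\<lambda>f. A f - B f)" "linop (\<lambda>f. A (B f))"
  using assms by (simp_all add: linop_def scale_algebra algebra_simps)

lemma linop_scale: "linop A \<Longrightarrow> linop (\<lambda>f. scale a (A f))"
  by (simp add: linop_def scale_algebra mult.commute)

lemma linop_id: "linop (\<lambda>f. f)" by (simp add: linop_def)

lemma linop_sum: "(\<And>x. x \<in> S \<Longrightarrow> linop (F x)) \<Longrightarrow> linop (\<lambda>f. \<Sum>x\<in>S. F x f)"
  by (simp add: linop_def sum.distrib scale_algebra)

lemma lin_xmon [simp]: "lin g (xmon m) = g m"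
  by (simp add: lin_def lookup_xmon scale_algebra)

lemma xmon_expand: "f = (\<Sum>m\<in>keys f. scale (lookup f m) (xmon m))"
proof (rule poly_mapping_eqI)
  fix m
  have "lookup (\<Sum>m\<in>keys f. scale (lookup f m) (xmon m)) m =
      (\<Sum>m'\<in>keys f. if m' = m then lookup f m' else 0)"
    by (simp add: lookup_sum lookup_xmon if_distrib cong: if_cong)
  also have "\<dots> = lookup f m" by (simp add: in_keys_iff)
  finally show "lookup f m = lookup (\<Sum>m\<in>keys f. scale (lookup f m) (xmon m)) m" by simp
qed

text \<open>Agreement is asked only on the monomials of \<open>f\<close> itself. Thus operators that
  coincide merely on one residue class of exponents can be compared on an eigenvector.\<close>

lemma linop_ext:
  assumes "linop A" "linop B" "\<And>m. m \<in> keys f \<Longrightarrow> A (xmon m) = B (xmon m)"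
  shows "A f = B f"
proof -
  have *: "C f = (\<Sum>m\<in>keys f. scale (lookup f m) (C (xmon m)))" if "linop C" for C
    by (subst xmon_expand[of f]) (simp add: linopD[OF that])
  show ?thesis using *[OF assms(1)] *[OF assms(2)] assms(3) by simp
qed

lemma linop_commute:
  "linop A \<Longrightarrow> linop B \<Longrightarrow> (\<And>m. m \<in> keys f \<Longrightarrow> A (B (xmon m)) = B (A (xmon m))) \<Longrightarrow> A (B f) = B (A f)"
  using linop_ext[OF linop_combine(3)[of A B] linop_combine(3)[of B A], of f] by simp

lemma lookup_lin: "lookup (lin g f) m = (\<Sum>m'\<in>keys f. lookup f m' * lookup (g m') m)"
  by (simp add: lin_def lookup_sum)

lemma xmon_mult: "xmon m * xmon m' = (xmon (m + m') :: 'a::comm_ring_1 mpol)"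
  by (simp add: xmon_def mult_single)

lemma var_xmon: "var i = (xmon (eps i) :: 'a::comm_ring_1 mpol)"
  by (simp add: var_def xmon_def)

lemma var_mult_xmon: "var i * xmon m = (xmon (m + eps i) :: 'a::comm_ring_1 mpol)"
  by (simp add: var_xmon xmon_mult add.commute)

lemma poly_ring_xmon [simp]: "xmon m \<in> poly_ring n \<longleftrightarrow> m \<in> exponents n"
  by (simp add: poly_ring_def)

lemma poly_ring_closed:
  fixes f g :: "'a::comm_ring_1 mpol" and F :: "'b \<Rightarrow> 'a mpol"
  shows "0 \<in> poly_ring n"
    "f \<in> poly_ring n \<Longrightarrow> g \<in> poly_ring n \<Longrightarrow> f + g \<in> poly_ring n"
    "f \<in> poly_ring n \<Longrightarrow> g \<in> poly_ring n \<Longrightarrow> f - g \<in> poly_ring n"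
    "f \<in> poly_ring n \<Longrightarrow> - f \<in> poly_ring n"
    "f \<in> poly_ring n \<Longrightarrow> scale a f \<in> poly_ring n"
    "(\<And>x. x \<in> S \<Longrightarrow> F x \<in> poly_ring n) \<Longrightarrow> sum F S \<in> poly_ring n"
    "f \<in> poly_ring n \<Longrightarrow> g \<in> poly_ring n \<Longrightarrow> f * g \<in> poly_ring n"
proof -
  show 0: "0 \<in> poly_ring n" by (simp add: poly_ring_def)
  show add: "f + g \<in> poly_ring n" if "f \<in> poly_ring n" "g \<in> poly_ring n" for f g :: "'a mpol"
    using that keys_add[of f g] by (auto simp: poly_ring_def)
  show "f \<in> poly_ring n \<Longrightarrow> g \<in> poly_ring n \<Longrightarrow> f - g \<in> poly_ring n"
    by (auto simp: poly_ring_def subset_iff in_keys_iff lookup_minus) (metis diff_zero)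
  show "f \<in> poly_ring n \<Longrightarrow> - f \<in> poly_ring n"
    by (auto simp: poly_ring_def subset_iff in_keys_iff)
  show "f \<in> poly_ring n \<Longrightarrow> scale a f \<in> poly_ring n"
    by (auto simp: poly_ring_def subset_iff in_keys_iff) (metis mult_zero_right)
  show "sum F S \<in> poly_ring n" if "\<And>x. x \<in> S \<Longrightarrow> F x \<in> poly_ring n"
    using that
  proof (induction S rule: infinite_finite_induct)
    case (insert x S)
    then show ?case using add[of "F x" "sum F S"] by simp
  qed (simp_all add: 0)
  show "f \<in> poly_ring n \<Longrightarrow> g \<in> poly_ring n \<Longrightarrow> f * g \<in> poly_ring n"
    using keys_mult[of f g] keys_add by (fastforce simp: poly_ring_def exponents_def)
qed

lemma var_in_poly_ring: "i < n \<Longrightarrow> (var i :: 'a::comm_ring_1 mpol) \<in> poly_ring n"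
  by (simp add: var_xmon exponents_def)

lemma lin_in_poly_ring:
  "f \<in> poly_ring n \<Longrightarrow> (\<And>m. m \<in> exponents n \<Longrightarrow> g m \<in> poly_ring n) \<Longrightarrow> lin g f \<in> poly_ring n"
  unfolding lin_def by (intro poly_ring_closed) (auto simp: poly_ring_def)

section \<open>Permutations of the variables, and ladders of monomials\<close>

definition pexp :: "(nat \<Rightarrow> nat) \<Rightarrow> (nat \<Rightarrow>\<^sub>0 nat) \<Rightarrow> (nat \<Rightarrow>\<^sub>0 nat)" where
  "pexp \<pi> \<mu> = Poly_Mapping.map_key (pinv \<pi>) \<mu>"

lemma lookup_pexp: "bij \<pi> \<Longrightarrow> lookup (pexp \<pi> \<mu>) a = lookup \<mu> (pinv \<pi> a)"
  by (simp add: pexp_def Poly_Mapping.map_key.rep_eq bij_imp_bij_inv bij_is_inj)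

lemma lookup_pexp' [simp]: "bij \<pi> \<Longrightarrow> lookup (pexp \<pi> \<mu>) (\<pi> a) = lookup \<mu> a"
  by (simp add: lookup_pexp bij_is_inj)

lemma pexp_eqI: "bij \<pi> \<Longrightarrow> (\<And>a. lookup \<nu> (\<pi> a) = lookup \<mu> a) \<Longrightarrow> pexp \<pi> \<mu> = \<nu>"
  by (rule poly_mapping_eqI) (metis bij_pointE lookup_pexp')

lemma pexp_comp: "bij \<pi> \<Longrightarrow> bij \<sigma> \<Longrightarrow> pexp \<pi> (pexp \<sigma> \<mu>) = pexp (\<pi> \<circ> \<sigma>) \<mu>"
  by (rule pexp_eqI[symmetric]) (auto intro: bij_comp)

lemma pexp_id [simp]: "pexp id \<mu> = \<mu>" "pexp (\<lambda>x. x) \<mu> = \<mu>"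
  by (auto intro: pexp_eqI simp flip: id_def)

lemma pexp_exponents:
  assumes "\<pi> permutes {0..<n}" shows "pexp \<pi> \<mu> \<in> exponents n \<longleftrightarrow> \<mu> \<in> exponents n"
proof -
  have b: "bij \<pi>" using assms by (rule permutes_bij)
  have *: "pinv \<pi> a < n \<longleftrightarrow> a < n" for a
    using permutes_in_image[OF permutes_inv[OF assms], of a] by simp
  have "pexp \<pi> \<mu> \<in> exponents n \<longleftrightarrow> (\<forall>a. lookup \<mu> (pinv \<pi> a) \<noteq> 0 \<longrightarrow> a < n)"
    by (auto simp: exponents_def subset_iff in_keys_iff lookup_pexp[OF b])
  also have "\<dots> \<longleftrightarrow> (\<forall>a. lookup \<mu> a \<noteq> 0 \<longrightarrow> a < n)"
    by (metis * b bij_inv_eq_iff)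
  finally show ?thesis by (auto simp: exponents_def subset_iff in_keys_iff)
qed

definition perm :: "(nat \<Rightarrow> nat) \<Rightarrow> 'a::comm_ring_1 mpol \<Rightarrow> 'a mpol" where
  "perm \<pi> = lin (\<lambda>\<mu>. xmon (pexp \<pi> \<mu>))"

lemma perm_xmon [simp]: "perm \<pi> (xmon \<mu>) = xmon (pexp \<pi> \<mu>)" by (simp add: perm_def)

lemma linop_perm: "linop (perm \<pi>)" by (simp add: perm_def linop_lin)

lemma perm_comp: "bij \<pi> \<Longrightarrow> bij \<sigma> \<Longrightarrow> perm \<pi> (perm \<sigma> f) = perm (\<pi> \<circ> \<sigma>) f"
  by (rule linop_ext[OF linop_combine(3)[OF linop_perm linop_perm] linop_perm]) (simp add: pexp_comp)

lemma perm_id [simp]: "perm id f = f"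
  by (rule linop_ext[OF linop_perm linop_id]) simp

lemma lookup_perm:
  assumes "bij \<pi>" shows "lookup (perm \<pi> f) (pexp \<pi> m) = lookup f m"
proof -
  have "pexp \<pi> m' = pexp \<pi> m \<longleftrightarrow> m' = m" for m'
    using assms by (metis lookup_pexp' poly_mapping_eqI)
  then have "lookup (perm \<pi> f) (pexp \<pi> m) = (\<Sum>m'\<in>keys f. if m' = m then lookup f m' else 0)"
    by (simp add: perm_def lookup_lin lookup_xmon if_distrib cong: if_cong)
  then show ?thesis by (simp add: in_keys_iff)
qed

lemma keys_perm: "bij \<pi> \<Longrightarrow> keys (perm \<pi> f) = pexp \<pi> ` keys f"
proof -
  assume b: "bij \<pi>"
  have inv: "pexp \<pi> (pexp (pinv \<pi>) m) = m" for m
    using b by (simp add: pexp_comp bij_imp_bij_inv surj_iff[THEN iffD1] bij_is_surj)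
  have "m \<in> keys (perm \<pi> f) \<longleftrightarrow> pexp (pinv \<pi>) m \<in> keys f" for m
    using lookup_perm[OF b, of f "pexp (pinv \<pi>) m"] by (simp add: inv in_keys_iff)
  moreover have "m \<in> pexp \<pi> ` keys f \<longleftrightarrow> pexp (pinv \<pi>) m \<in> keys f" for m
  proof
    assume "pexp (pinv \<pi>) m \<in> keys f" then show "m \<in> pexp \<pi> ` keys f" using inv by (metis imageI)
  next
    assume "m \<in> pexp \<pi> ` keys f"
    then obtain m' where "m = pexp \<pi> m'" "m' \<in> keys f" by auto
    then show "pexp (pinv \<pi>) m \<in> keys f"
      using b by (simp add: pexp_comp bij_imp_bij_inv inj_iff[THEN iffD1] bij_is_inj)
  qed
  ultimately show ?thesis by blast
qed

lemma perm_in_poly_ring: "\<pi> permutes {0..<n} \<Longrightarrow> f \<in> poly_ring n \<Longrightarrow> perm \<pi> f \<in> poly_ring n"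
  unfolding perm_def by (rule lin_in_poly_ring) (simp_all add: pexp_exponents)

lemma perm_mult_var: "bij \<pi> \<Longrightarrow> perm \<pi> (var i * f) = var (\<pi> i) * perm \<pi> f"
proof (rule linop_ext[OF linop_combine(3)[OF linop_perm linop_times] linop_combine(3)[OF linop_times linop_perm]])
  fix m assume "bij \<pi>"
  then have "pexp \<pi> (m + eps i) = pexp \<pi> m + eps (\<pi> i)"
    by (intro pexp_eqI) (auto simp: lookup_add lookup_single when_def bij_is_inj inj_eq)
  then show "perm \<pi> (var i * xmon m) = var (\<pi> i) * perm \<pi> (xmon m)" by (simp add: var_mult_xmon)
qed

definition repl :: "(nat \<Rightarrow>\<^sub>0 nat) \<Rightarrow> nat \<Rightarrow> nat \<Rightarrow> nat \<Rightarrow> nat \<Rightarrow> (nat \<Rightarrow>\<^sub>0 nat)" where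
  "repl \<mu> i a j b = Poly_Mapping.update i a (Poly_Mapping.update j b \<mu>)"

lemma lookup_repl: "lookup (repl \<mu> i a j b) h = (if h = i then a else if h = j then b else lookup \<mu> h)"
  by (simp add: repl_def lookup_update)

lemma repl_commute: "i \<noteq> j \<Longrightarrow> repl \<mu> i a j b = repl \<mu> j b i a"
  by (rule poly_mapping_eqI) (auto simp: lookup_repl)

lemma repl_self [simp]: "repl \<mu> i (lookup \<mu> i) j (lookup \<mu> j) = \<mu>"
  by (rule poly_mapping_eqI) (auto simp: lookup_repl)

lemma repl_exponents: "\<mu> \<in> exponents n \<Longrightarrow> i < n \<Longrightarrow> j < n \<Longrightarrow> repl \<mu> i a j b \<in> exponents n"
  by (auto simp: exponents_def subset_iff in_keys_iff lookup_repl split: if_splits)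

lemma repl_swap: "i \<noteq> j \<Longrightarrow> repl \<mu> i (lookup \<mu> j) j (lookup \<mu> i) = pexp (transpose i j) \<mu>"
  by (rule pexp_eqI[symmetric]) (auto simp: lookup_repl transpose_def)

lemma pexp_repl: "bij \<pi> \<Longrightarrow> pexp \<pi> (repl \<mu> i a j b) = repl (pexp \<pi> \<mu>) (\<pi> i) a (\<pi> j) b"
  by (rule pexp_eqI) (auto simp: lookup_repl bij_is_inj inj_eq)

lemma repl_add_single:
  "i \<noteq> j \<Longrightarrow> repl \<mu> i a j b + eps j = repl (\<mu> + eps j) i a j (Suc b)"
  "i \<noteq> j \<Longrightarrow> repl \<mu> i a j b + eps i = repl (\<mu> + eps i) i (Suc a) j b"
  "h \<noteq> i \<Longrightarrow> h \<noteq> j \<Longrightarrow> repl \<mu> i a j b + eps h = repl (\<mu> + eps h) i a j b"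
  by (rule poly_mapping_eqI, auto simp: lookup_repl lookup_add lookup_single when_def)+

text \<open>\<open>ladder l A i j \<mu>\<close> is what the divided difference of the Dunkl operator produces from
  \<open>x\<^sup>\<mu>\<close>, after averaging over the \<open>l\<close> reflections that exchange \<open>x\<^sub>i\<close> and \<open>x\<^sub>j\<close>. The number \<open>A\<close>
  is the exponent of \<open>x\<^sub>i\<close> that is compared with the exponent of \<open>x\<^sub>j\<close>: it is \<open>\<mu>\<^sub>i\<close> for
  \<open>x\<^sub>i y\<^sub>i\<close> and \<open>\<mu>\<^sub>i + 1\<close> for \<open>y\<^sub>i x\<^sub>i\<close>.\<close>

definition ladder :: "nat \<Rightarrow> nat \<Rightarrow> nat \<Rightarrow> nat \<Rightarrow> (nat \<Rightarrow>\<^sub>0 nat) \<Rightarrow> 'a::comm_ring_1 mpol" where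
  "ladder l A i j \<mu> = (if lookup \<mu> j < A
    then \<Sum>u\<in>{u. l * u < A - lookup \<mu> j}. xmon (repl \<mu> i (lookup \<mu> i - l * u) j (lookup \<mu> j + l * u))
    else - (\<Sum>u\<in>{u. 1 \<le> u \<and> l * u \<le> lookup \<mu> j - A}.
              xmon (repl \<mu> i (lookup \<mu> i + l * u) j (lookup \<mu> j - l * u))))"

lemma perm_ladder: "bij \<pi> \<Longrightarrow> perm \<pi> (ladder l A i j \<mu>) = ladder l A (\<pi> i) (\<pi> j) (pexp \<pi> \<mu>)"
  by (simp add: ladder_def linopD[OF linop_perm] pexp_repl)

lemma ladder_mult_target:
  assumes "i \<noteq> j"
  shows "var j * ladder l A i j \<mu> = (ladder l (Suc A) i j (\<mu> + eps j) :: 'a::comm_ring_1 mpol)"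
proof -
  have "var j * xmon (repl \<mu> i (lookup \<mu> i + l * u) j (lookup \<mu> j - l * u)) =
      (xmon (repl (\<mu> + eps j) i (lookup \<mu> i + l * u) j (Suc (lookup \<mu> j) - l * u)) :: 'a mpol)"
    if "l * u \<le> lookup \<mu> j - A" for u
    using that by (simp add: var_mult_xmon repl_add_single(1)[OF assms] Suc_diff_le)
  then show ?thesis
    using assms by (auto simp: ladder_def sum_distrib_left var_mult_xmon repl_add_single lookup_add lookup_single
        intro!: sum.cong)
qed

text \<open>The bound on \<open>A\<close> ensures \<open>l * u \<le> lookup \<mu> i\<close> for
  every rung of the positive branch, so that the truncated subtraction is a true one.\<close>

lemma ladder_mult_source:
  assumes "i \<noteq> j" "A \<le> Suc (lookup \<mu> i)"
  shows "var i * ladder l A i j \<mu> = (ladder l A i j (\<mu> + eps i) :: 'a::comm_ring_1 mpol)"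
proof -
  have "var i * xmon (repl \<mu> i (lookup \<mu> i - l * u) j (lookup \<mu> j + l * u)) =
      (xmon (repl (\<mu> + eps i) i (Suc (lookup \<mu> i) - l * u) j (lookup \<mu> j + l * u)) :: 'a mpol)"
    if "l * u < A - lookup \<mu> j" for u
    using that assms(2) by (simp add: var_mult_xmon repl_add_single(2)[OF assms(1)] Suc_diff_le)
  then show ?thesis
    using assms by (auto simp: ladder_def sum_distrib_left var_mult_xmon repl_add_single lookup_add lookup_single
        intro!: sum.cong)
qed

lemma ladder_mult_other:
  assumes "h \<noteq> i" "h \<noteq> j"
  shows "var h * ladder l A i j \<mu> = (ladder l A i j (\<mu> + eps h) :: 'a::comm_ring_1 mpol)"
  using assms by (auto simp: ladder_def sum_distrib_left var_mult_xmon repl_add_single lookup_add lookup_single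
        intro!: sum.cong)

lemma finite_mult_le: "1 \<le> l \<Longrightarrow> finite {u::nat. P u \<and> l * u \<le> a}"
proof (rule finite_subset[of _ "{..a}"])
  assume l: "1 \<le> l"
  have "u \<le> a" if "l * u \<le> a" for u using mult_le_mono1[OF l, of u] that by linarith
  then show "{u. P u \<and> l * u \<le> a} \<subseteq> {..a}" by auto
qed simp

section \<open>Triangularity\<close>

lemma of_nat_times_scale: "of_nat c * f = scale (of_nat c) (f :: 'a::comm_ring_1 mpol)"
  by (induction c) (simp_all add: scale_algebra distrib_right)

text \<open>Raising the threshold by one adds, or no longer subtracts, the single rung where the two
  exponents have traded places. Averaged reflections produce the same term, so the reflection sum in
  \<open>z_i\<close> just lowers the threshold for \<open>j < i\<close>.\<close>

lemma ladder_Suc: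
  assumes l: "1 \<le> l" and ij: "i \<noteq> j"
  shows "ladder l (Suc (lookup \<mu> i)) i j \<mu> = ladder l (lookup \<mu> i) i j \<mu> +
    (if lookup \<mu> i mod l = lookup \<mu> j mod l then xmon (pexp (transpose i j) \<mu>) else 0 :: 'a::comm_ring_1 mpol)"
proof -
  let ?a = "lookup \<mu> i" and ?b = "lookup \<mu> j"
  have one: "{u. l * u = d} = (if d mod l = 0 then {d div l} else {})" for d :: nat
    using l by (auto simp: mod_eq_0_iff_dvd)
  consider "?b < ?a" | "?a = ?b" | "?a < ?b" by linarith
  then show ?thesis
  proof cases
    case 1
    let ?f = "\<lambda>u. xmon (repl \<mu> i (?a - l * u) j (?b + l * u)) :: 'a mpol"
    have "{u. l * u < Suc ?a - ?b} = {u. l * u < ?a - ?b} \<union> {u. l * u = ?a - ?b}" using 1 by auto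
    moreover have "finite {u. l * u < ?a - ?b}"
      by (rule finite_subset[OF _ finite_mult_le[OF l, of "\<lambda>_. True" "?a - ?b"]]) auto
    ultimately have "sum ?f {u. l * u < Suc ?a - ?b} = sum ?f {u. l * u < ?a - ?b} + sum ?f {u. l * u = ?a - ?b}"
      by (simp only:) (rule sum.union_disjoint, auto simp: one)
    then have "ladder l (Suc ?a) i j \<mu> = ladder l ?a i j \<mu> + sum ?f {u. l * u = ?a - ?b}"
      using 1 by (simp add: ladder_def)
    also have "sum ?f {u. l * u = ?a - ?b} = (if ?a mod l = ?b mod l then xmon (pexp (transpose i j) \<mu>) else 0)"
    proof (cases "(?a - ?b) mod l = 0")
      case True
      then have "l * ((?a - ?b) div l) = ?a - ?b" by (simp add: mod_eq_0_iff_dvd)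
      moreover have "?a mod l = ?b mod l" using True 1 by (simp add: mod_eq_dvd_iff_nat mod_eq_0_iff_dvd)
      ultimately show ?thesis using True 1 by (simp add: one repl_swap[OF ij])
    next
      case False
      then show ?thesis using 1 by (simp add: one mod_eq_dvd_iff_nat mod_eq_0_iff_dvd)
    qed
    finally show ?thesis .
  next
    case 2
    then have "{u. l * u < Suc ?a - ?b} = {0}" using l by auto
    then have R: "ladder l (Suc ?a) i j \<mu> = (xmon \<mu> :: 'a mpol)"
      using 2 repl_self[of \<mu> i j] by (simp add: ladder_def del: repl_self)
    have e: "{u. 1 \<le> u \<and> l * u \<le> ?b - ?a} = {}" using 2 l by auto
    have "ladder l ?a i j \<mu> = (0 :: 'a mpol)" unfolding ladder_def e using 2 by simp
    then show ?thesis using 2 R repl_swap[OF ij, of \<mu>] repl_self[of \<mu> i j] by (simp del: repl_self)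
  next
    case 3
    let ?f = "\<lambda>u. xmon (repl \<mu> i (?a + l * u) j (?b - l * u)) :: 'a mpol"
    have "{u. 1 \<le> u \<and> l * u \<le> ?b - ?a} = {u. 1 \<le> u \<and> l * u \<le> ?b - Suc ?a} \<union> {u. l * u = ?b - ?a}"
      using 3 by (auto simp: Suc_le_eq intro: gr0I)
    moreover have "finite {u. 1 \<le> u \<and> l * u \<le> ?b - Suc ?a}" by (rule finite_mult_le[OF l])
    ultimately have "sum ?f {u. 1 \<le> u \<and> l * u \<le> ?b - ?a} =
        sum ?f {u. 1 \<le> u \<and> l * u \<le> ?b - Suc ?a} + sum ?f {u. l * u = ?b - ?a}"
      using 3 by (simp only:) (rule sum.union_disjoint, auto simp: one)
    then have "ladder l (Suc ?a) i j \<mu> = ladder l ?a i j \<mu> + sum ?f {u. l * u = ?b - ?a}"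
      using 3 by (simp add: ladder_def)
    also have "sum ?f {u. l * u = ?b - ?a} = (if ?a mod l = ?b mod l then xmon (pexp (transpose i j) \<mu>) else 0)"
    proof (cases "(?b - ?a) mod l = 0")
      case True
      then have "l * ((?b - ?a) div l) = ?b - ?a" by (simp add: mod_eq_0_iff_dvd)
      moreover have "?b mod l = ?a mod l" using True 3 by (simp add: mod_eq_dvd_iff_nat mod_eq_0_iff_dvd)
      ultimately show ?thesis using True 3 by (simp add: one repl_swap[OF ij])
    next
      case False
      then have "?b mod l \<noteq> ?a mod l" using 3 by (simp add: mod_eq_dvd_iff_nat mod_eq_0_iff_dvd)
      then show ?thesis using False by (simp add: one)
    qed
    finally show ?thesis .
  qed
qed

text \<open>Two codes of fixed sum come closer together, and the sum of squares loses
  \<open>2 * (n * s) * e\<close>, where \<open>e\<close> is the surplus of their distance over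
  \<open>n * s\<close>.\<close>

lemma energy_repl:
  assumes n: "i < n" "j < n" "i \<noteq> j" and s: "0 < s" and less: "code n \<mu> j + n * s < code n \<mu> i"
  shows "energy n (repl \<mu> i (lookup \<mu> i - s) j (lookup \<mu> j + s)) < energy n \<mu>"
proof -
  let ?\<nu> = "repl \<mu> i (lookup \<mu> i - s) j (lookup \<mu> j + s)"
  have "n * s < n * Suc (lookup \<mu> i)" using less n by (auto simp: code_def)
  then have "s \<le> lookup \<mu> i" by (metis less_Suc_eq_le mult_less_cancel1)
  then obtain r where r: "lookup \<mu> i = r + s" by (metis le_add_diff_inverse2)
  have "n * r + q + n * s = n * (r + s) + q" for q by (simp add: algebra_simps)
  from this[of "n - 1 - i"] have ci: "code n ?\<nu> i + n * s = code n \<mu> i"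
    by (simp add: code_def lookup_repl r)
  have cj: "code n ?\<nu> j = code n \<mu> j + n * s" using n by (simp add: code_def lookup_repl algebra_simps)
  have split: "sum f {..<n} = f i + (f j + sum f ({..<n} - {i} - {j}))" for f :: "nat \<Rightarrow> nat"
  proof -
    have "sum f {..<n} = f i + sum f ({..<n} - {i})" using n by (intro sum.remove) auto
    moreover have "sum f ({..<n} - {i}) = f j + sum f ({..<n} - {i} - {j})" using n by (intro sum.remove) auto
    ultimately show ?thesis by simp
  qed
  have rest: "(\<Sum>a\<in>{..<n} - {i} - {j}. (code n ?\<nu> a)\<^sup>2) = (\<Sum>a\<in>{..<n} - {i} - {j}. (code n \<mu> a)\<^sup>2)"
    by (intro sum.cong) (auto simp: code_def lookup_repl)
  obtain e where e: "code n \<mu> i = code n \<mu> j + n * s + e" "0 < e"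
    using less by (metis less_imp_add_positive)
  then have "code n ?\<nu> i = code n \<mu> j + e" using ci by simp
  moreover have "0 < n * s * e" using n s e by simp
  ultimately show ?thesis
    unfolding energy_def split[of "\<lambda>a. (code n ?\<nu> a)\<^sup>2"] split[of "\<lambda>a. (code n \<mu> a)\<^sup>2"] rest cj e(1)
    by (simp add: power2_eq_square algebra_simps)
qed

definition below :: "nat \<Rightarrow> nat \<Rightarrow> (nat \<Rightarrow>\<^sub>0 nat) \<Rightarrow> (nat \<Rightarrow>\<^sub>0 nat) set" where
  "below l n \<mu> = {\<nu> \<in> exponents n. energy n \<nu> < energy n \<mu> \<and> (\<forall>a. lookup \<nu> a mod l = lookup \<mu> a mod l)}"

text \<open>With this \<open>A\<close>, the test \<open>lookup \<mu> j < A\<close> is the comparison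
  of codes, ties included. So the rung \<open>u = 0\<close> occurs exactly for the entries ranked
  below \<open>i\<close>, and every other rung brings two codes closer.\<close>

lemma keys_ladder:
  assumes \<mu>: "\<mu> \<in> exponents n" and n: "i < n" "j < n" "i \<noteq> j" and l: "1 \<le> l"
    and A: "A = (if j < i then lookup \<mu> i else Suc (lookup \<mu> i))"
  shows "keys (ladder l A i j \<mu> - (if code n \<mu> j < code n \<mu> i then xmon \<mu> else 0 :: 'a::comm_ring_1 mpol)) \<subseteq> below l n \<mu>"
proof -
  have iff: "code n \<mu> j < code n \<mu> i \<longleftrightarrow> lookup \<mu> j < A"
    using n by (auto simp: A code_less_iff)
  show ?thesis
  proof (cases "lookup \<mu> j < A")
    case True
    let ?f = "\<lambda>u. xmon (repl \<mu> i (lookup \<mu> i - l * u) j (lookup \<mu> j + l * u)) :: 'a mpol"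
    let ?S = "{u. 1 \<le> u \<and> l * u \<le> A - lookup \<mu> j - 1}"
    have "{u. l * u < A - lookup \<mu> j} = insert 0 ?S" using True by (auto simp: Suc_le_eq)
    then have "ladder l A i j \<mu> = xmon \<mu> + sum ?f ?S"
      using True finite_mult_le[OF l, of "\<lambda>u. 1 \<le> u" "A - lookup \<mu> j - 1"] by (simp add: ladder_def)
    moreover have "keys (?f u) \<subseteq> below l n \<mu>" if u: "u \<in> ?S" for u
    proof -
      have "lookup \<mu> j + l * u + (if j < i then 1 else 0) \<le> lookup \<mu> i" using u True by (auto simp: A)
      from mult_le_mono2[OF this, of n]
      have "code n \<mu> j + n * (l * u) < code n \<mu> i" using n
        by (auto simp: code_def algebra_simps split: if_splits)
      then have "energy n (repl \<mu> i (lookup \<mu> i - l * u) j (lookup \<mu> j + l * u)) < energy n \<mu>"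
        using energy_repl[OF n, of "l * u" \<mu>] u l by simp
      moreover have "(lookup \<mu> i - l * u) mod l = lookup \<mu> i mod l"
      proof -
        have "lookup \<mu> i = (lookup \<mu> i - l * u) + l * u" using u True by (auto simp: A split: if_splits)
        then show ?thesis by (metis mod_mult_self2)
      qed
      ultimately show ?thesis using \<mu> n by (auto simp: below_def lookup_repl repl_exponents)
    qed
    ultimately show ?thesis using iff True keys_sum[of ?f ?S] by fastforce
  next
    case False
    let ?f = "\<lambda>u. xmon (repl \<mu> i (lookup \<mu> i + l * u) j (lookup \<mu> j - l * u)) :: 'a mpol"
    let ?S = "{u. 1 \<le> u \<and> l * u \<le> lookup \<mu> j - A}"
    have "ladder l A i j \<mu> = - sum ?f ?S" using False by (simp add: ladder_def)
    moreover have "keys (?f u) \<subseteq> below l n \<mu>" if u: "u \<in> ?S" for u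
    proof -
      have "lookup \<mu> i + l * u + (if j < i then 0 else 1) \<le> lookup \<mu> j" using u False by (auto simp: A)
      from mult_le_mono2[OF this, of n]
      have "code n \<mu> i + n * (l * u) < code n \<mu> j" using n
        by (auto simp: code_def algebra_simps split: if_splits)
      then have "energy n (repl \<mu> j (lookup \<mu> j - l * u) i (lookup \<mu> i + l * u)) < energy n \<mu>"
        using energy_repl[of j n i "l * u" \<mu>] n u l by simp
      moreover have "(lookup \<mu> j - l * u) mod l = lookup \<mu> j mod l"
      proof -
        have "lookup \<mu> j = (lookup \<mu> j - l * u) + l * u" using u False by auto
        then show ?thesis by (metis mod_mult_self2)
      qed
      ultimately show ?thesis using \<mu> n by (auto simp: below_def lookup_repl repl_exponents repl_commute[OF n(3)])
    qed
    ultimately show ?thesis using iff False keys_sum[of ?f ?S] by fastforce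
  qed
qed

text \<open>\<open>Z i\<close> is \<open>z\<^sub>i\<close> in closed form, and \<open>dd\<close> stands for \<open>p \<mapsto> d\<^sub>0 - d\<^sub>-\<^sub>p\<close>.\<close>

locale z_operators =
  fixes l n :: nat and c0 :: "'a::idom" and dd :: "nat \<Rightarrow> 'a"
  assumes l: "1 \<le> l" and dd: "\<And>a b. a mod l = b mod l \<Longrightarrow> dd a = dd b"
begin

definition cmp :: "nat \<Rightarrow> nat \<Rightarrow> (nat \<Rightarrow>\<^sub>0 nat) \<Rightarrow> nat" where
  "cmp i j \<mu> = (if j < i then lookup \<mu> i else Suc (lookup \<mu> i))"

definition zmon :: "nat \<Rightarrow> (nat \<Rightarrow>\<^sub>0 nat) \<Rightarrow> 'a mpol" where
  "zmon i \<mu> = scale (of_nat (Suc (lookup \<mu> i)) - dd (Suc (lookup \<mu> i))) (xmon \<mu>)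
     - scale (of_nat l * c0) (\<Sum>j\<in>{0..<n} - {i}. ladder l (cmp i j \<mu>) i j \<mu>)"

definition Z :: "nat \<Rightarrow> 'a mpol \<Rightarrow> 'a mpol" where "Z i = lin (zmon i)"

definition wt :: "nat \<Rightarrow> (nat \<Rightarrow>\<^sub>0 nat) \<Rightarrow> 'a" where
  "wt i \<mu> = of_nat (Suc (lookup \<mu> i)) - dd (Suc (lookup \<mu> i)) - of_nat l * c0 * of_nat (rk n \<mu> i)"

lemma linop_Z: "linop (Z i)" by (simp add: Z_def linop_lin)

lemma Z_xmon [simp]: "Z i (xmon \<mu>) = zmon i \<mu>" by (simp add: Z_def)

text \<open>Each \<open>j\<close> with a smaller code contributes one diagonal rung; counting them
  gives the rank in \<open>wt\<close>.\<close>

lemma zmon_triangular: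
  assumes \<mu>: "\<mu> \<in> exponents n" and i: "i < n"
  shows "keys (zmon i \<mu> - scale (wt i \<mu>) (xmon \<mu>)) \<subseteq> below l n \<mu>"
proof -
  let ?b = "\<lambda>j. if code n \<mu> j < code n \<mu> i then xmon \<mu> else 0 :: 'a mpol"
  let ?J = "{0..<n} - {i}"
  let ?t = "\<lambda>j. ladder l (cmp i j \<mu>) i j \<mu> - ?b j"
  have "sum ?b ?J = scale (of_nat (rk n \<mu> i)) (xmon \<mu>)"
  proof -
    have "sum ?b ?J = (\<Sum>j\<in>{j. j < n \<and> code n \<mu> j < code n \<mu> i}. xmon \<mu>)"
      by (rule sum.mono_neutral_cong_right) auto
    then show ?thesis using i by (simp add: rk_def of_nat_times_scale)
  qed
  then have "zmon i \<mu> - scale (wt i \<mu>) (xmon \<mu>) = - scale (of_nat l * c0) (sum ?t ?J)"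
    by (simp add: zmon_def wt_def sum_subtractf scale_algebra algebra_simps del: of_nat_Suc)
  then have "keys (zmon i \<mu> - scale (wt i \<mu>) (xmon \<mu>)) \<subseteq> keys (sum ?t ?J)"
    by (auto simp: in_keys_iff)
  also have "\<dots> \<subseteq> (\<Union>j\<in>?J. keys (?t j))" by (rule keys_sum)
  also have "\<dots> \<subseteq> below l n \<mu>"
    by (intro UN_least keys_ladder[OF \<mu> i _ _ l]) (auto simp: cmp_def)
  finally show ?thesis .
qed

lemma zmon_lookup:
  assumes "\<mu> \<in> exponents n" "i < n" "\<nu> \<notin> below l n \<mu>"
  shows "lookup (zmon i \<mu>) \<nu> = (if \<nu> = \<mu> then wt i \<mu> else 0)"
proof -
  have "lookup (zmon i \<mu> - scale (wt i \<mu>) (xmon \<mu>)) \<nu> = 0"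
    using zmon_triangular[OF assms(1,2)] assms(3) by (metis in_keys_iff subset_iff)
  then show ?thesis by (auto simp: lookup_minus lookup_xmon split: if_splits)
qed

text \<open>Maximal energy suffices and need not be attained only once: \<open>below\<close> is
  strict, so distinct exponents of equal energy do not feed into each other.\<close>

lemma leading_weight:
  assumes f: "f \<in> poly_ring n" and i: "i < n" and eig: "Z i f = scale a f"
    and \<nu>: "\<nu> \<in> keys f" "\<And>\<rho>. \<rho> \<in> keys f \<Longrightarrow> energy n \<rho> \<le> energy n \<nu>"
  shows "wt i \<nu> = a"
proof -
  have exp: "\<rho> \<in> exponents n" if "\<rho> \<in> keys f" for \<rho> using f that by (auto simp: poly_ring_def)
  have "lookup (Z i f) \<nu> = (\<Sum>\<rho>\<in>keys f. if \<rho> = \<nu> then lookup f \<nu> * wt i \<nu> else 0)"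
    unfolding Z_def lookup_lin
  proof (rule sum.cong)
    fix \<rho> assume "\<rho> \<in> keys f"
    then have "\<nu> \<notin> below l n \<rho>" using \<nu>(2)[of \<rho>] by (auto simp: below_def)
    then show "lookup f \<rho> * lookup (zmon i \<rho>) \<nu> = (if \<rho> = \<nu> then lookup f \<nu> * wt i \<nu> else 0)"
      using zmon_lookup[OF exp i, of \<rho> \<nu>] \<open>\<rho> \<in> keys f\<close> by auto
  qed simp
  also have "\<dots> = lookup f \<nu> * wt i \<nu>" using \<nu>(1) by simp
  finally have "lookup f \<nu> * wt i \<nu> = lookup f \<nu> * a"
    unfolding eig by (simp only: lookup_scale mult.commute)
  moreover have "lookup f \<nu> \<noteq> 0" using \<nu>(1) by (simp add: in_keys_iff)
  ultimately show ?thesis using mult_left_cancel by blast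
qed

lemma leading_exponent:
  assumes "f \<noteq> (0 :: 'a mpol)"
  obtains \<nu> where "\<nu> \<in> keys f" "\<And>\<rho>. \<rho> \<in> keys f \<Longrightarrow> energy n \<rho> \<le> energy n \<nu>"
proof -
  have ne: "keys f \<noteq> {}" using assms by (metis keys_eq_empty)
  then have "Max (energy n ` keys f) \<in> energy n ` keys f" by (intro Max_in) auto
  then obtain \<nu> where "\<nu> \<in> keys f" "energy n \<nu> = Max (energy n ` keys f)" by (metis imageE)
  then show ?thesis using that[of \<nu>] by simp
qed

end

section \<open>Intertwiners\<close>

lemma lookup_pexp_transpose [simp]: "lookup (pexp (transpose a b) \<mu>) x = lookup \<mu> (transpose a b x)"
  by (simp add: lookup_pexp)

lemma pexp_transpose_twice [simp]: "pexp (transpose a b) (pexp (transpose a b) \<mu>) = \<mu>"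
  by (rule poly_mapping_eqI) simp

lemma perm_transpose_twice [simp]: "perm (transpose a b) (perm (transpose a b) f) = f"
  by (simp add: perm_comp)

lemma transpose_permutes: "(a :: nat) < n \<Longrightarrow> b < n \<Longrightarrow> transpose a b permutes {0..<n}"
  by (rule permutes_swap_id) auto

lemma rk_cong_bij:
  assumes \<pi>: "\<pi> permutes {0..<n}" and a: "a < n"
    and code: "\<And>a b. a < n \<Longrightarrow> b < n \<Longrightarrow> code n \<nu> (\<pi> a) < code n \<nu> (\<pi> b) \<longleftrightarrow> code n \<mu> a < code n \<mu> b"
  shows "rk n \<nu> (\<pi> a) = rk n \<mu> a"
proof -
  have in_n: "\<pi> x < n \<longleftrightarrow> x < n" for x using permutes_in_image[OF \<pi>, of x] by simp
  have "{b. b < n \<and> code n \<nu> b < code n \<nu> (\<pi> a)} = \<pi> ` {b. b < n \<and> code n \<mu> b < code n \<mu> a}"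
  proof (intro Set.set_eqI iffI)
    fix b assume b: "b \<in> {b. b < n \<and> code n \<nu> b < code n \<nu> (\<pi> a)}"
    obtain c where c: "b = \<pi> c" using permutes_surj[OF \<pi>] by (metis surjD)
    then show "b \<in> \<pi> ` {b. b < n \<and> code n \<mu> b < code n \<mu> a}" using b in_n[of c] code[of c a] a by auto
  qed (use in_n code a in auto)
  then have "card {b. b < n \<and> code n \<nu> b < code n \<nu> (\<pi> a)} = card {b. b < n \<and> code n \<mu> b < code n \<mu> a}"
    using permutes_inj_on[OF \<pi>] by (simp add: card_image)
  then show ?thesis using a in_n by (simp add: rk_def)
qed

text \<open>For equal entries this would fail: the exchange fixes the exponent, while the two ranks
  differ.\<close>

lemma rk_swap:
  assumes i: "Suc i < n" and ne: "lookup \<mu> i \<noteq> lookup \<mu> (Suc i)" and a: "a < n"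
  shows "rk n (pexp (transpose i (Suc i)) \<mu>) a = rk n \<mu> (transpose i (Suc i) a)"
proof -
  let ?s = "transpose i (Suc i)"
  have perm: "?s permutes {0..<n}" using i by (intro transpose_permutes) auto
  have in_n: "?s x < n \<longleftrightarrow> x < n" for x using permutes_in_image[OF perm, of x] by simp
  have "rk n (pexp ?s \<mu>) (?s (?s a)) = rk n \<mu> (?s a)"
  proof (rule rk_cong_bij[OF perm])
    show "?s a < n" using a in_n by simp
    fix a b assume ab: "a < n" "b < n"
    have "lookup \<mu> a = lookup \<mu> b \<Longrightarrow> ?s b < ?s a \<longleftrightarrow> b < a"
      using ne by (auto simp: transpose_def)
    then show "code n (pexp ?s \<mu>) (?s a) < code n (pexp ?s \<mu>) (?s b) \<longleftrightarrow> code n \<mu> a < code n \<mu> b"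
      using ab in_n by (auto simp: code_less_iff)
  qed
  then show ?thesis by simp
qed

definition cyc :: "nat \<Rightarrow> nat \<Rightarrow> nat" where
  "cyc n a = (if a < n then (if a = 0 then n - 1 else a - 1) else a)"

lemma cyc_permutes: "cyc n permutes {0..<n}"
proof (rule bij_imp_permutes)
  have "inj_on (cyc n) {0..<n}" by (rule inj_onI) (auto simp: cyc_def split: if_splits)
  moreover have "cyc n ` {0..<n} \<subseteq> {0..<n}" by (auto simp: cyc_def)
  ultimately show "bij_betw (cyc n) {0..<n} {0..<n}" by (simp add: bij_betw_def endo_inj_surj)
qed (simp add: cyc_def)

lemma bij_cyc [simp]: "bij (cyc n)" by (rule permutes_bij[OF cyc_permutes])

definition shift :: "nat \<Rightarrow> (nat \<Rightarrow>\<^sub>0 nat) \<Rightarrow> (nat \<Rightarrow>\<^sub>0 nat)" where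
  "shift n \<mu> = pexp (cyc n) \<mu> + eps (n - 1)"

lemma lookup_shift:
  assumes "a < n"
  shows "lookup (shift n \<mu>) (cyc n a) = (if a = 0 then Suc (lookup \<mu> 0) else lookup \<mu> a)"
  using assms by (simp add: shift_def lookup_add lookup_single when_def) (auto simp: cyc_def)

lemma lookup_shift_Suc: "Suc a < n \<Longrightarrow> lookup (shift n \<mu>) a = lookup \<mu> (Suc a)"
  using lookup_shift[of "Suc a" n \<mu>] by (simp add: cyc_def)

lemma lookup_shift_last: "0 < n \<Longrightarrow> lookup (shift n \<mu>) (n - 1) = Suc (lookup \<mu> 0)"
  using lookup_shift[of 0 n \<mu>] by (simp add: cyc_def)

lemma shift_exponents: "0 < n \<Longrightarrow> \<mu> \<in> exponents n \<Longrightarrow> shift n \<mu> \<in> exponents n"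
proof -
  assume "0 < n" "\<mu> \<in> exponents n"
  then have "keys (pexp (cyc n) \<mu>) \<subseteq> {0..<n}" "n - 1 \<in> {0..<n}"
    using pexp_exponents[OF cyc_permutes, of n \<mu>] by (simp_all add: exponents_def)
  moreover have "keys (shift n \<mu>) \<subseteq> keys (pexp (cyc n) \<mu>) \<union> {n - 1}"
    using keys_add[of "pexp (cyc n) \<mu>" "eps (n - 1)"] by (simp add: shift_def)
  ultimately show ?thesis unfolding exponents_def by blast
qed

text \<open>Passing from the first to the last position costs \<open>n - 1\<close> and the raised
  entry gains \<open>n\<close>; all other entries move one place to the left. Hence every code grows
  by exactly one, and order and gaps persist.\<close>

lemma code_shift: "a < n \<Longrightarrow> code n (shift n \<mu>) (cyc n a) = Suc (code n \<mu> a)"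
  by (cases a) (simp_all add: code_def lookup_shift, simp_all add: cyc_def)

lemma rk_shift: "a < n \<Longrightarrow> rk n (shift n \<mu>) (cyc n a) = rk n \<mu> a"
  by (rule rk_cong_bij[OF cyc_permutes]) (simp_all add: code_shift)

lemma energy_shift: "0 < n \<Longrightarrow> energy n \<mu> < energy n (shift n \<mu>)"
proof -
  assume n: "0 < n"
  have "energy n (shift n \<mu>) = (\<Sum>a\<in>{0..<n}. (code n (shift n \<mu>) (cyc n a))\<^sup>2)"
    unfolding energy_def atLeast0LessThan[symmetric]
    by (subst sum.permute[OF cyc_permutes]) simp
  also have "\<dots> = (\<Sum>a\<in>{0..<n}. (Suc (code n \<mu> a))\<^sup>2)" by (intro sum.cong) (auto simp: code_shift)
  also have "\<dots> > energy n \<mu>"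
    unfolding energy_def atLeast0LessThan[symmetric] using n by (intro sum_strict_mono) (auto simp: power_strict_mono)
  finally show ?thesis .
qed

lemma shift_surj:
  assumes \<mu>: "\<mu> \<in> exponents n" and n: "0 < n" and pos: "0 < lookup \<mu> (n - 1)"
  obtains \<nu> where "\<nu> \<in> exponents n" "\<mu> = shift n \<nu>"
proof
  let ?\<nu> = "pexp (pinv (cyc n)) (\<mu> - eps (n - 1))"
  have "\<mu> - eps (n - 1) \<in> exponents n"
    using \<mu> by (auto simp: exponents_def subset_iff in_keys_iff lookup_minus)
  then show "?\<nu> \<in> exponents n" by (simp add: pexp_exponents[OF permutes_inv[OF cyc_permutes]])
  have "pexp (cyc n) ?\<nu> = \<mu> - eps (n - 1)"
    by (simp add: pexp_comp bij_imp_bij_inv surj_iff[THEN iffD1] bij_is_surj)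
  then show "\<mu> = shift n ?\<nu>" using pos
    by (auto intro!: poly_mapping_eqI simp: shift_def lookup_add lookup_minus lookup_single when_def)
qed

text \<open>\<open>\<Phi> = x\<^sub>n s\<^sub>n\<^sub>-\<^sub>1 \<dots> s\<^sub>1\<close>.\<close>

definition Phi :: "nat \<Rightarrow> 'a::comm_ring_1 mpol \<Rightarrow> 'a mpol" where
  "Phi n f = var (n - 1) * perm (cyc n) f"

lemma linop_Phi: "linop (Phi n)"
proof -
  have eq: "Phi n = (\<lambda>f. var (n - 1) * perm (cyc n) f)" by (rule ext) (simp add: Phi_def)
  show ?thesis unfolding eq by (rule linop_combine(3)[OF linop_times linop_perm])
qed

lemma Phi_xmon [simp]: "Phi n (xmon \<mu>) = xmon (shift n \<mu>)"
  by (simp add: Phi_def var_mult_xmon shift_def)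

lemma inj_shift: "shift n \<mu> = shift n \<nu> \<Longrightarrow> \<mu> = \<nu>"
proof (rule poly_mapping_eqI)
  fix a assume "shift n \<mu> = shift n \<nu>"
  then have "lookup (pexp (cyc n) \<mu>) (cyc n a) = lookup (pexp (cyc n) \<nu>) (cyc n a)" by (simp add: shift_def)
  then show "lookup \<mu> a = lookup \<nu> a" by simp
qed

lemma lookup_Phi: "lookup (Phi n f) (shift n m) = lookup f m"
proof -
  have iff: "shift n m' = shift n m \<longleftrightarrow> m' = m" for m' using inj_shift by blast
  have "Phi n f = lin (\<lambda>m. xmon (shift n m)) f"
    by (rule linop_ext[OF linop_Phi linop_lin]) simp
  then have "lookup (Phi n f) (shift n m) = (\<Sum>m'\<in>keys f. if m' = m then lookup f m' else 0)"
    by (simp add: lookup_lin lookup_xmon iff if_distrib cong: if_cong)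
  then show ?thesis by (simp add: in_keys_iff)
qed

lemma keys_Phi: "keys (Phi n f) \<subseteq> shift n ` keys f"
proof -
  have "Phi n f = lin (\<lambda>m. xmon (shift n m)) f"
    by (rule linop_ext[OF linop_Phi linop_lin]) simp
  then have "keys (Phi n f) \<subseteq> (\<Union>m\<in>keys f. keys (scale (lookup f m) (xmon (shift n m))))"
    unfolding lin_def using keys_sum by metis
  also have "\<dots> \<subseteq> shift n ` keys f" by (auto simp: in_keys_iff lookup_xmon split: if_splits)
  finally show ?thesis .
qed

lemma Phi_in_poly_ring: "0 < n \<Longrightarrow> f \<in> poly_ring n \<Longrightarrow> Phi n f \<in> poly_ring n"
  unfolding Phi_def
  by (rule poly_ring_closed(7)[OF var_in_poly_ring perm_in_poly_ring[OF cyc_permutes]]) auto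

context z_operators
begin

definition cong_part :: "nat \<Rightarrow> 'a mpol \<Rightarrow> 'a mpol" where
  "cong_part i = lin (\<lambda>\<mu>. if lookup \<mu> i mod l = lookup \<mu> (Suc i) mod l then xmon \<mu> else 0)"

text \<open>This is a degenerate Hecke relation. The only threshold that conjugation by
  \<open>s\<close> does not match is that of the pair of neighbours itself, which changes sides in
  \<open>cmp\<close>; \<open>ladder_Suc\<close> evaluates the difference.\<close>

lemma perm_zmon_swap:
  assumes i: "Suc i < n"
  defines "s \<equiv> transpose i (Suc i)"
  shows "perm s (zmon i \<mu>) = zmon (Suc i) (pexp s \<mu>)
    - scale (of_nat l * c0) (if lookup \<mu> i mod l = lookup \<mu> (Suc i) mod l then xmon \<mu> else 0)"
proof -
  let ?\<nu> = "pexp s \<mu>"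
  let ?c = "if lookup \<mu> i mod l = lookup \<mu> (Suc i) mod l then xmon \<mu> else 0 :: 'a mpol"
  have b: "bij s" by (simp add: s_def)
  have si: "s i = Suc i" "s (Suc i) = i" by (simp_all add: s_def)
  have "(\<Sum>j\<in>{0..<n} - {i}. ladder l (cmp i j \<mu>) (Suc i) (s j) ?\<nu>) =
      (\<Sum>j\<in>{0..<n} - {Suc i}. ladder l (cmp i (s j) \<mu>) (Suc i) j ?\<nu> :: 'a mpol)"
    by (rule sum.reindex_bij_witness[of _ s s]) (use i in \<open>auto simp: s_def transpose_def\<close>)
  also have "\<dots> = (\<Sum>j\<in>{0..<n} - {Suc i}. ladder l (cmp (Suc i) j ?\<nu>) (Suc i) j ?\<nu> + (if j = i then ?c else 0))"
  proof (rule sum.cong)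
    fix j assume j: "j \<in> {0..<n} - {Suc i}"
    show "ladder l (cmp i (s j) \<mu>) (Suc i) j ?\<nu> = ladder l (cmp (Suc i) j ?\<nu>) (Suc i) j ?\<nu> + (if j = i then ?c else 0)"
    proof (cases "j = i")
      case True
      have "ladder l (Suc (lookup ?\<nu> (Suc i))) (Suc i) i ?\<nu> = ladder l (lookup ?\<nu> (Suc i)) (Suc i) i ?\<nu> + ?c"
        by (subst ladder_Suc[OF l]) (simp_all add: s_def transpose_commute[of "Suc i"])
      then show ?thesis using True by (simp add: cmp_def s_def)
    next
      case False
      then have "s j = j" using j by (simp add: s_def transpose_def)
      then show ?thesis using False j by (auto simp: cmp_def s_def)
    qed
  qed simp
  also have "\<dots> = (\<Sum>j\<in>{0..<n} - {Suc i}. ladder l (cmp (Suc i) j ?\<nu>) (Suc i) j ?\<nu>) + ?c"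
    using i by (simp add: sum.distrib)
  finally have sum: "(\<Sum>j\<in>{0..<n} - {i}. ladder l (cmp i j \<mu>) (Suc i) (s j) ?\<nu>) = \<dots>" .
  have "perm s (zmon i \<mu>) = scale (of_nat (Suc (lookup \<mu> i)) - dd (Suc (lookup \<mu> i))) (xmon ?\<nu>)
      - scale (of_nat l * c0) (\<Sum>j\<in>{0..<n} - {i}. ladder l (cmp i j \<mu>) (Suc i) (s j) ?\<nu>)"
    by (simp add: zmon_def linopD[OF linop_perm] perm_ladder[OF b] si del: of_nat_Suc)
  also have "\<dots> = zmon (Suc i) ?\<nu> - scale (of_nat l * c0) ?c"
    unfolding sum by (simp add: zmon_def s_def scale_algebra del: of_nat_Suc)
  finally show ?thesis .
qed

lemma perm_zmon_other:
  assumes i: "Suc i < n" and h: "h < n" "h \<noteq> i" "h \<noteq> Suc i"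
  defines "s \<equiv> transpose i (Suc i)"
  shows "perm s (zmon h \<mu>) = zmon h (pexp s \<mu>)"
proof -
  let ?\<nu> = "pexp s \<mu>"
  have b: "bij s" by (simp add: s_def)
  have sh: "s h = h" using h by (simp add: s_def transpose_def)
  have "(\<Sum>j\<in>{0..<n} - {h}. ladder l (cmp h j \<mu>) h (s j) ?\<nu>) =
      (\<Sum>j\<in>{0..<n} - {h}. ladder l (cmp h j ?\<nu>) h j ?\<nu> :: 'a mpol)"
    by (rule sum.reindex_bij_witness[of _ s s])
      (use i h in \<open>auto simp: s_def transpose_def cmp_def\<close>)
  moreover have "lookup ?\<nu> h = lookup \<mu> h" using sh by (simp add: s_def)
  ultimately show ?thesis using sh
    by (simp add: zmon_def linopD[OF linop_perm] perm_ladder[OF b] del: of_nat_Suc)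
qed

lemma Z_perm_swap:
  assumes i: "Suc i < n"
  defines "s \<equiv> transpose i (Suc i)"
  shows "Z (Suc i) (perm s f) = perm s (Z i f) + scale (of_nat l * c0) (cong_part i f)"
    and "Z i (perm s f) = perm s (Z (Suc i) f) - scale (of_nat l * c0) (cong_part i f)"
    and "h < n \<Longrightarrow> h \<noteq> i \<Longrightarrow> h \<noteq> Suc i \<Longrightarrow> Z h (perm s f) = perm s (Z h f)"
proof -
  have lc: "linop (cong_part i)" unfolding cong_part_def by (rule linop_lin)
  show 1: "Z (Suc i) (perm s f) = perm s (Z i f) + scale (of_nat l * c0) (cong_part i f)" for f
  proof (rule linop_ext[where A = "\<lambda>f. Z (Suc i) (perm s f)"
          and B = "\<lambda>f. perm s (Z i f) + scale (of_nat l * c0) (cong_part i f)"])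
    show "linop (\<lambda>f. Z (Suc i) (perm s f))" by (rule linop_combine(3)[OF linop_Z linop_perm])
    show "linop (\<lambda>f. perm s (Z i f) + scale (of_nat l * c0) (cong_part i f))"
      by (rule linop_combine(1)[OF linop_combine(3)[OF linop_perm linop_Z] linop_scale[OF lc]])
  qed (simp add: perm_zmon_swap[OF i, folded s_def] cong_part_def)
  have tw: "perm s (perm s g) = g" for g :: "'a mpol" by (simp add: s_def)
  have cp: "cong_part i (perm s f) = perm s (cong_part i f)"
  proof (rule linop_commute[OF lc linop_perm])
    fix m
    show "cong_part i (perm s (xmon m)) = perm s (cong_part i (xmon m))"
      by (cases "lookup m i mod l = lookup m (Suc i) mod l")
        (simp_all add: cong_part_def s_def linopD(3)[OF linop_perm])
  qed
  \<comment> \<open>The second relation is the first one at \<open>perm s f\<close>, conjugated by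
    the involution \<open>s\<close>.\<close>
  have "Z (Suc i) f = perm s (Z i (perm s f)) + scale (of_nat l * c0) (perm s (cong_part i f))"
    using 1[of "perm s f"] by (simp only: tw cp)
  then have "perm s (Z (Suc i) f) = Z i (perm s f) + scale (of_nat l * c0) (cong_part i f)"
    by (simp only: linopD[OF linop_perm] tw)
  then show "Z i (perm s f) = perm s (Z (Suc i) f) - scale (of_nat l * c0) (cong_part i f)" by simp
  show "Z h (perm s f) = perm s (Z h f)" if "h < n" "h \<noteq> i" "h \<noteq> Suc i"
    by (rule linop_commute[OF linop_Z linop_perm]) (simp add: perm_zmon_other[OF i that] s_def)
qed

text \<open>Position 0 lies to the left of \<open>Suc a\<close>, but its image \<open>n - 1\<close>
  lies to the right of \<open>a\<close>, so its threshold has to rise by one; multiplication by the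
  last variable does this through \<open>ladder_mult_target\<close>.\<close>

lemma Phi_zmon_Suc:
  assumes a: "Suc a < n"
  shows "Phi n (zmon (Suc a) \<mu>) = zmon a (shift n \<mu>)"
proof -
  let ?\<rho> = "cyc n" and ?\<nu> = "pexp (cyc n) \<mu>"
  have \<rho>a: "?\<rho> (Suc a) = a" using a by (simp add: cyc_def)
  have "(\<Sum>j\<in>{0..<n} - {Suc a}. var (n - 1) * ladder l (cmp (Suc a) j \<mu>) a (?\<rho> j) ?\<nu>) =
      (\<Sum>j\<in>{0..<n} - {a}. ladder l (cmp a j (shift n \<mu>)) a j (shift n \<mu>) :: 'a mpol)"
  proof (rule sum.reindex_bij_witness[of _ "\<lambda>j. if j = n - 1 then 0 else Suc j" ?\<rho>])
    fix j assume j: "j \<in> {0..<n} - {Suc a}"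
    show "ladder l (cmp a (?\<rho> j) (shift n \<mu>)) a (?\<rho> j) (shift n \<mu>) =
        (var (n - 1) * ladder l (cmp (Suc a) j \<mu>) a (?\<rho> j) ?\<nu> :: 'a mpol)"
    proof (cases "j = 0")
      case True
      then have "?\<rho> j = n - 1" using j by (simp add: cyc_def)
      moreover have "ladder l (cmp a (n - 1) (shift n \<mu>)) a (n - 1) (shift n \<mu>) =
          (var (n - 1) * ladder l (cmp (Suc a) 0 \<mu>) a (n - 1) ?\<nu> :: 'a mpol)"
        using a unfolding shift_def by (subst ladder_mult_target)
          (auto simp: cmp_def lookup_shift_Suc[OF a] simp flip: shift_def[of n, simplified])
      ultimately show ?thesis using True by simp
    next
      case False
      then have "?\<rho> j = j - 1" using j by (simp add: cyc_def)
      moreover have "n - 1 \<noteq> a" "n - 1 \<noteq> j - 1" using a j False by auto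
      moreover have "cmp a (j - 1) (shift n \<mu>) = cmp (Suc a) j \<mu>"
        using False a j by (auto simp: cmp_def lookup_shift_Suc)
      ultimately show ?thesis using \<open>?\<rho> j = j - 1\<close> unfolding shift_def by (simp add: ladder_mult_other)
    qed
  qed (use a in \<open>auto simp: cyc_def split: if_splits\<close>)
  then show ?thesis using a \<rho>a
    by (simp add: zmon_def linopD[OF linop_Phi] Phi_def[of n "ladder _ _ _ _ _"] perm_ladder lookup_shift_Suc
        del: of_nat_Suc)
qed

text \<open>All other positions change from the right side to the left side. The threshold loses its
  \<open>Suc\<close> just when the entry gains one, so only the scalar part changes.\<close>

lemma Phi_zmon_0:
  assumes n: "0 < n"
  shows "zmon (n - 1) (shift n \<mu>) = Phi n (zmon 0 \<mu>)
    + scale (1 - dd (Suc (Suc (lookup \<mu> 0))) + dd (Suc (lookup \<mu> 0))) (xmon (shift n \<mu>))"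
proof -
  let ?\<rho> = "cyc n" and ?\<nu> = "pexp (cyc n) \<mu>"
  have \<rho>0: "?\<rho> 0 = n - 1" using n by (simp add: cyc_def)
  then have \<nu>: "lookup ?\<nu> (n - 1) = lookup \<mu> 0" using lookup_pexp'[OF bij_cyc, of n \<mu> 0] by simp
  have "(\<Sum>j\<in>{0..<n} - {0}. var (n - 1) * ladder l (cmp 0 j \<mu>) (n - 1) (?\<rho> j) ?\<nu>) =
      (\<Sum>j\<in>{0..<n} - {n - 1}. ladder l (cmp (n - 1) j (shift n \<mu>)) (n - 1) j (shift n \<mu>) :: 'a mpol)"
  proof (rule sum.reindex_bij_witness[of _ Suc ?\<rho>])
    fix j assume j: "j \<in> {0..<n} - {0}"
    then have "?\<rho> j < n - 1" by (auto simp: cyc_def)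
    then show "ladder l (cmp (n - 1) (?\<rho> j) (shift n \<mu>)) (n - 1) (?\<rho> j) (shift n \<mu>) =
        (var (n - 1) * ladder l (cmp 0 j \<mu>) (n - 1) (?\<rho> j) ?\<nu> :: 'a mpol)"
      using j n \<nu> lookup_shift_last[OF n, of \<mu>]
      by (subst ladder_mult_source) (auto simp: cmp_def shift_def)
  qed (auto simp: cyc_def)
  then have "Phi n (zmon 0 \<mu>) = scale (of_nat (Suc (lookup \<mu> 0)) - dd (Suc (lookup \<mu> 0))) (xmon (shift n \<mu>))
     - scale (of_nat l * c0) (\<Sum>j\<in>{0..<n} - {n - 1}. ladder l (cmp (n - 1) j (shift n \<mu>)) (n - 1) j (shift n \<mu>))"
    using \<rho>0 by (simp add: zmon_def linopD[OF linop_Phi] Phi_def[of n "ladder _ _ _ _ _"] perm_ladder del: of_nat_Suc)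
  then show ?thesis
    unfolding zmon_def[of "n - 1"] lookup_shift_last[OF n] of_nat_Suc[of "Suc _"]
    by (simp add: scale_linear(5,6,8) del: of_nat_Suc)
qed

end

section \<open>Joint eigenvectors, isolated exponents, and intertwiners between them\<close>

context z_operators
begin

definition eig :: "(nat \<Rightarrow>\<^sub>0 nat) \<Rightarrow> 'a mpol \<Rightarrow> bool" where
  "eig \<mu> f \<longleftrightarrow> f \<in> poly_ring n \<and>
     (\<forall>\<nu>\<in>keys f. \<forall>a<n. lookup \<nu> a mod l = lookup \<mu> a mod l) \<and>
     (\<forall>i<n. Z i f = scale (wt i \<mu>) f)"

definition isolated :: "(nat \<Rightarrow>\<^sub>0 nat) \<Rightarrow> bool" where
  "isolated \<mu> \<longleftrightarrow> \<mu> \<in> exponents n \<and> (\<forall>\<nu>\<in>exponents n.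
     (\<forall>i<n. lookup \<nu> i mod l = lookup \<mu> i mod l \<and> wt i \<nu> = wt i \<mu>) \<longrightarrow> \<nu> = \<mu>)"

text \<open>An exponent of maximal energy in \<open>f\<close> carries the weights and residues of
  \<open>\<mu>\<close> and so equals \<open>\<mu>\<close>; all others lie strictly lower.\<close>

lemma eig_keys:
  assumes iso: "isolated \<mu>" and f: "eig \<mu> f"
  shows "f \<noteq> 0 \<Longrightarrow> \<mu> \<in> keys f" "\<nu> \<in> keys f \<Longrightarrow> \<nu> \<noteq> \<mu> \<Longrightarrow> energy n \<nu> < energy n \<mu>"
proof -
  have lead: "\<nu> = \<mu>" if "\<nu> \<in> keys f" "\<And>\<rho>. \<rho> \<in> keys f \<Longrightarrow> energy n \<rho> \<le> energy n \<nu>" for \<nu>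
    using iso f that leading_weight[of f _ "wt _ \<mu>" \<nu>]
    by (auto simp: isolated_def eig_def poly_ring_def)
  show "\<mu> \<in> keys f" if "f \<noteq> 0" using leading_exponent[OF that] lead by metis
  show "energy n \<nu> < energy n \<mu>" if \<nu>: "\<nu> \<in> keys f" "\<nu> \<noteq> \<mu>"
  proof -
    have "f \<noteq> 0" using \<nu> by auto
    then obtain \<kappa> where \<kappa>: "\<kappa> \<in> keys f" "\<And>\<rho>. \<rho> \<in> keys f \<Longrightarrow> energy n \<rho> \<le> energy n \<kappa>"
      using leading_exponent by metis
    then have "\<kappa> = \<mu>" using lead by blast
    show ?thesis
    proof (rule ccontr)
      assume "\<not> ?thesis"
      then have "energy n \<rho> \<le> energy n \<nu>" if "\<rho> \<in> keys f" for \<rho>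
        using \<kappa>(2)[OF that] \<open>\<kappa> = \<mu>\<close> by simp
      then show False using lead \<nu> by blast
    qed
  qed
qed

lemma eig_lookup_eq_0:
  "isolated \<mu> \<Longrightarrow> eig \<mu> f \<Longrightarrow> energy n \<mu> \<le> energy n \<nu> \<Longrightarrow> \<nu> \<noteq> \<mu> \<Longrightarrow> lookup f \<nu> = 0"
  using eig_keys(2)[of \<mu> f \<nu>] by (auto simp: in_keys_iff)

lemma eig_eq_0: "isolated \<mu> \<Longrightarrow> eig \<mu> f \<Longrightarrow> lookup f \<mu> = 0 \<Longrightarrow> f = 0"
  using eig_keys(1)[of \<mu> f] by (auto simp: in_keys_iff)

lemma eig_scale: "eig \<mu> f \<Longrightarrow> eig \<mu> (scale a f)"
  by (auto simp: eig_def poly_ring_closed linopD[OF linop_Z] scale_algebra mult.commute in_keys_iff)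

lemma eig_diff: "eig \<mu> f \<Longrightarrow> eig \<mu> g \<Longrightarrow> eig \<mu> (f - g)"
  by (auto simp: eig_def poly_ring_closed linopD[OF linop_Z] scale_algebra in_keys_iff lookup_minus)

lemma eig_unique:
  assumes "isolated \<mu>" "eig \<mu> f" "eig \<mu> g" "lookup f \<mu> = 1"
  shows "g = scale (lookup g \<mu>) f"
proof -
  have "g - scale (lookup g \<mu>) f = 0"
    using assms by (intro eig_eq_0[of \<mu>] eig_diff eig_scale) (auto simp: lookup_minus)
  then show ?thesis by simp
qed

lemma wt_swap:
  assumes i: "Suc i < n" and ne: "lookup \<mu> i \<noteq> lookup \<mu> (Suc i)" and a: "a < n"
  shows "wt a (pexp (transpose i (Suc i)) \<mu>) = wt (transpose i (Suc i) a) \<mu>"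
  by (simp add: wt_def rk_swap[OF i ne a])

text \<open>The weights are given as the exchanged ones and not as those of the exchanged exponent.
  For equal neighbours the two differ, and that case, with \<open>e = - 1\<close>, yields the
  symmetry of Jack polynomials.\<close>

lemma Z_swap_intertwiner:
  assumes i: "Suc i < n" and f: "eig \<mu> f"
    and e: "if lookup \<mu> i mod l = lookup \<mu> (Suc i) mod l
      then e * (wt i \<mu> - wt (Suc i) \<mu>) = of_nat l * c0 else e = 0"
  defines "s \<equiv> transpose i (Suc i)"
  defines "g \<equiv> perm s f + scale e f"
  shows "g \<in> poly_ring n"
    and "a < n \<Longrightarrow> Z a g = scale (wt (s a) \<mu>) g"
    and "\<nu> \<in> keys g \<Longrightarrow> a < n \<Longrightarrow> lookup \<nu> a mod l = lookup \<mu> (s a) mod l"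
proof -
  have s: "s permutes {0..<n}" unfolding s_def using i by (intro transpose_permutes) auto
  have s_less: "s a < n \<longleftrightarrow> a < n" for a using permutes_in_image[OF s, of a] by simp
  have f': "f \<in> poly_ring n" "\<And>\<nu> a. \<nu> \<in> keys f \<Longrightarrow> a < n \<Longrightarrow> lookup \<nu> a mod l = lookup \<mu> a mod l"
    "\<And>i. i < n \<Longrightarrow> Z i f = scale (wt i \<mu>) f" using f by (auto simp: eig_def)
  show "g \<in> poly_ring n" unfolding g_def by (intro poly_ring_closed perm_in_poly_ring s f')
  let ?c = "lookup \<mu> i mod l = lookup \<mu> (Suc i) mod l"
  have c: "cong_part i f = (if ?c then f else 0)"
  proof -
    have "cong_part i f = lin (\<lambda>m. if ?c then xmon m else 0) f"
      unfolding cong_part_def lin_def using f'(2) i by (intro sum.cong) auto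
    also have "\<dots> = (if ?c then f else 0)" using xmon_expand[of f] by (auto simp: lin_def scale_algebra)
    finally show ?thesis .
  qed
  show "Z a g = scale (wt (s a) \<mu>) g" if a: "a < n"
  proof -
    consider "a = i" | "a = Suc i" | "a \<noteq> i" "a \<noteq> Suc i" by blast
    then show ?thesis
    proof cases
      case 1
      have "Z i g = scale (wt (Suc i) \<mu>) (perm s f) - scale (of_nat l * c0) (cong_part i f) + scale (e * wt i \<mu>) f"
        using i by (simp add: g_def linopD[OF linop_Z] Z_perm_swap(2)[OF i, folded s_def] f'(3)
            linopD[OF linop_perm] scale_algebra)
      also have "scale (e * wt i \<mu>) f = scale (e * wt (Suc i) \<mu>) f + scale (of_nat l * c0) (cong_part i f)"
      proof (cases ?c)
        case True
        then have "e * wt i \<mu> = e * wt (Suc i) \<mu> + of_nat l * c0" using e by (simp add: algebra_simps)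
        then show ?thesis using True by (simp add: c scale_algebra)
      qed (use e in \<open>simp add: c scale_algebra\<close>)
      finally show ?thesis using 1 by (simp add: g_def s_def scale_algebra mult.commute)
    next
      case 2
      have "Z (Suc i) g = scale (wt i \<mu>) (perm s f) + scale (of_nat l * c0) (cong_part i f) + scale (e * wt (Suc i) \<mu>) f"
        using i by (simp add: g_def linopD[OF linop_Z] Z_perm_swap(1)[OF i, folded s_def] f'(3)
            linopD[OF linop_perm] scale_algebra)
      also have "\<dots> = scale (wt i \<mu>) (perm s f) + scale (e * wt i \<mu>) f"
      proof (cases ?c)
        case True
        then have "e * wt i \<mu> = e * wt (Suc i) \<mu> + of_nat l * c0" using e by (simp add: algebra_simps)
        then show ?thesis using True by (simp add: c scale_algebra)
      qed (use e in \<open>simp add: c scale_algebra\<close>)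
      finally show ?thesis using 2 by (simp add: g_def s_def scale_algebra mult.commute)
    next
      case 3
      then have "s a = a" by (simp add: s_def transpose_def)
      then show ?thesis using 3 a
        by (simp add: g_def linopD[OF linop_Z] Z_perm_swap(3)[OF i, folded s_def] f'(3)
            linopD[OF linop_perm] scale_algebra mult.commute)
    qed
  qed
  show "lookup \<nu> a mod l = lookup \<mu> (s a) mod l" if \<nu>: "\<nu> \<in> keys g" and a: "a < n"
  proof -
    have "\<nu> \<in> keys (perm s f) \<or> \<nu> \<in> keys (scale e f)" using \<nu> keys_add[of "perm s f" "scale e f"] by (auto simp: g_def)
    then show ?thesis
    proof
      assume "\<nu> \<in> keys (perm s f)"
      then obtain \<kappa> where "\<kappa> \<in> keys f" "\<nu> = pexp s \<kappa>" using permutes_bij[OF s] by (auto simp: keys_perm)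
      then show ?thesis using f'(2)[of \<kappa> "s a"] a s_less by (simp add: s_def)
    next
      assume "\<nu> \<in> keys (scale e f)"
      then have "e \<noteq> 0" "\<nu> \<in> keys f" by (auto simp: in_keys_iff)
      then have "?c" using e by (auto split: if_splits)
      then show ?thesis using f'(2)[OF \<open>\<nu> \<in> keys f\<close> a] by (auto simp: s_def transpose_def)
    qed
  qed
qed

lemma eig_swap:
  assumes i: "Suc i < n" and f: "eig \<mu> f" and ne: "lookup \<mu> i \<noteq> lookup \<mu> (Suc i)"
    and e: "if lookup \<mu> i mod l = lookup \<mu> (Suc i) mod l
      then e * (wt i \<mu> - wt (Suc i) \<mu>) = of_nat l * c0 else e = 0"
  shows "eig (pexp (transpose i (Suc i)) \<mu>) (perm (transpose i (Suc i)) f + scale e f)"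
  unfolding eig_def using Z_swap_intertwiner[OF i f e] by (auto simp: wt_swap[OF i ne])

text \<open>The exchange is \<open>energy_repl\<close> with the difference of the entries as
  \<open>s\<close>; adjacency of the positions leaves a surplus of 1.\<close>

lemma swap_energy_less:
  assumes i: "Suc i < n" and less: "lookup \<mu> (Suc i) < lookup \<mu> i"
  shows "energy n (pexp (transpose i (Suc i)) \<mu>) < energy n \<mu>"
proof -
  let ?s = "lookup \<mu> i - lookup \<mu> (Suc i)"
  have "lookup \<mu> (Suc i) + ?s = lookup \<mu> i" using less by simp
  then have "n * lookup \<mu> (Suc i) + n * ?s = n * lookup \<mu> i" by (metis distrib_left)
  then have "code n \<mu> (Suc i) + n * ?s < code n \<mu> i" using i by (simp add: code_def)
  then show ?thesis
    using energy_repl[of i n "Suc i" ?s \<mu>] i less repl_swap[of i "Suc i" \<mu>] by simp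
qed

lemma wt_shift:
  assumes "0 < n"
  shows "Suc a < n \<Longrightarrow> wt a (shift n \<mu>) = wt (Suc a) \<mu>"
    and "wt (n - 1) (shift n \<mu>) = wt 0 \<mu> + (1 - dd (Suc (Suc (lookup \<mu> 0))) + dd (Suc (lookup \<mu> 0)))"
  using rk_shift[of "Suc a" n \<mu>] rk_shift[of 0 n \<mu>] lookup_shift_last[OF assms, of \<mu>] assms
  by (simp_all add: wt_def lookup_shift_Suc cyc_def)

lemma eig_shift:
  assumes n: "0 < n" and f: "eig \<mu> f"
  shows "eig (shift n \<mu>) (Phi n f)"
  unfolding eig_def
proof (intro conjI ballI allI impI)
  have f': "f \<in> poly_ring n" "\<And>\<nu> a. \<nu> \<in> keys f \<Longrightarrow> a < n \<Longrightarrow> lookup \<nu> a mod l = lookup \<mu> a mod l"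
    "\<And>i. i < n \<Longrightarrow> Z i f = scale (wt i \<mu>) f" using f by (auto simp: eig_def)
  show "Phi n f \<in> poly_ring n" by (rule Phi_in_poly_ring[OF n f'(1)])
  show "lookup \<nu> a mod l = lookup (shift n \<mu>) a mod l" if \<nu>: "\<nu> \<in> keys (Phi n f)" and a: "a < n" for \<nu> a
  proof -
    obtain \<kappa> where \<kappa>: "\<nu> = shift n \<kappa>" "\<kappa> \<in> keys f" using \<nu> keys_Phi by blast
    have "lookup \<kappa> 0 mod l = lookup \<mu> 0 mod l" using f'(2)[OF \<kappa>(2), of 0] n by simp
    then have "Suc (lookup \<kappa> 0) mod l = Suc (lookup \<mu> 0) mod l" by (metis mod_Suc_eq)
    moreover have "a = n - 1 \<or> Suc a < n" using a by auto
    ultimately show ?thesis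
      using f'(2)[OF \<kappa>(2), of "Suc a"] lookup_shift_last[OF n] lookup_shift_Suc[of a n] by (auto simp: \<kappa>(1))
  qed
  show "Z a (Phi n f) = scale (wt a (shift n \<mu>)) (Phi n f)" if a: "a < n" for a
  proof (cases "Suc a < n")
    case True
    have "Z a (Phi n f) = Phi n (Z (Suc a) f)"
      by (rule linop_ext[OF linop_combine(3)[OF linop_Z linop_Phi] linop_combine(3)[OF linop_Phi linop_Z]])
        (simp add: Phi_zmon_Suc[OF True])
    then show ?thesis using True f'(3)[of "Suc a"] by (simp add: linopD[OF linop_Phi] wt_shift(1)[OF n])
  next
    case False
    then have an: "a = n - 1" using a by simp
    let ?c = "1 - dd (Suc (Suc (lookup \<mu> 0))) + dd (Suc (lookup \<mu> 0))"
    have "Z (n - 1) (Phi n f) = Phi n (Z 0 f) + scale ?c (Phi n f)"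
    proof (rule linop_ext[where A = "\<lambda>f. Z (n - 1) (Phi n f)" and B = "\<lambda>f. Phi n (Z 0 f) + scale ?c (Phi n f)"])
      show "linop (\<lambda>f. Z (n - 1) (Phi n f))" by (rule linop_combine(3)[OF linop_Z linop_Phi])
      show "linop (\<lambda>f. Phi n (Z 0 f) + scale ?c (Phi n f))"
        by (rule linop_combine(1)[OF linop_combine(3)[OF linop_Phi linop_Z] linop_scale[OF linop_Phi]])
      fix \<nu> assume "\<nu> \<in> keys f"
      \<comment> \<open>The scalar in \<open>Phi_zmon_0\<close> depends on the exponent only through
        the residue of its first entry, which is constant on \<open>keys f\<close>.\<close>
      then have "lookup \<nu> 0 mod l = lookup \<mu> 0 mod l" using f'(2) n by simp
      then have "Suc (lookup \<nu> 0) mod l = Suc (lookup \<mu> 0) mod l"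
        "Suc (Suc (lookup \<nu> 0)) mod l = Suc (Suc (lookup \<mu> 0)) mod l"
        by (metis mod_Suc_eq)+
      then have "dd (Suc (lookup \<nu> 0)) = dd (Suc (lookup \<mu> 0))"
        "dd (Suc (Suc (lookup \<nu> 0))) = dd (Suc (Suc (lookup \<mu> 0)))" using dd by blast+
      then show "Z (n - 1) (Phi n (xmon \<nu>)) = Phi n (Z 0 (xmon \<nu>)) + scale ?c (Phi n (xmon \<nu>))"
        using Phi_zmon_0[OF n, of \<nu>] by simp
    qed
    then show ?thesis using f'(3)[OF n]
      unfolding an wt_shift(2)[OF n] by (simp add: linopD[OF linop_Phi] scale_linear(5))
  qed
qed

lemma eig_0:
  assumes n: "0 < n" shows "eig 0 (xmon 0)"
proof -
  have "below l n 0 = {}"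
    by (auto simp: below_def energy_def code_def not_less intro!: sum_mono power_mono)
  then have "Z i (xmon 0) = scale (wt i 0) (xmon 0)" if "i < n" for i
    using zmon_triangular[of 0 i] that by (simp add: exponents_def)
  then show ?thesis by (auto simp: eig_def exponents_def)
qed

text \<open>The closed form of \<open>x\<^sub>i y\<^sub>i\<close>.\<close>

definition xy_mon :: "nat \<Rightarrow> (nat \<Rightarrow>\<^sub>0 nat) \<Rightarrow> 'a mpol" where
  "xy_mon i \<mu> = scale (of_nat (lookup \<mu> i) - dd (lookup \<mu> i)) (xmon \<mu>)
     - scale (of_nat l * c0) (\<Sum>j\<in>{0..<n} - {i}. ladder l (lookup \<mu> i) i j \<mu>)"

definition XY :: "nat \<Rightarrow> 'a mpol \<Rightarrow> 'a mpol" where "XY i = lin (xy_mon i)"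

lemma linop_XY: "linop (XY i)" by (simp add: XY_def linop_lin)

text \<open>All other positions lie to the left of the last one, so \<open>Z (n - 1)\<close> already
  uses the thresholds of \<open>XY (n - 1)\<close>; on one residue class the operators differ by a
  scalar.\<close>

lemma XY_last:
  assumes n: "0 < n" and f: "eig \<mu> f"
  shows "XY (n - 1) f = scale (of_nat (lookup \<mu> (n - 1)) - dd (lookup \<mu> (n - 1))
    - of_nat l * c0 * of_nat (rk n \<mu> (n - 1))) f"
proof -
  let ?m = "lookup \<mu> (n - 1)"
  let ?c = "dd (Suc ?m) - dd ?m - 1"
  have "XY (n - 1) f = Z (n - 1) f + scale ?c f"
  proof (rule linop_ext[where A = "XY (n - 1)" and B = "\<lambda>f. Z (n - 1) f + scale ?c f"])
    show "linop (XY (n - 1))" by (rule linop_XY)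
    show "linop (\<lambda>f. Z (n - 1) f + scale ?c f)"
      by (rule linop_combine(1)[OF linop_Z linop_scale[OF linop_id]])
    fix \<nu> assume "\<nu> \<in> keys f"
    then have m: "lookup \<nu> (n - 1) mod l = ?m mod l" using f n by (simp add: eig_def)
    then have "Suc (lookup \<nu> (n - 1)) mod l = Suc ?m mod l" by (metis mod_Suc_eq)
    then have d: "dd (Suc (lookup \<nu> (n - 1))) = dd (Suc ?m)" "dd (lookup \<nu> (n - 1)) = dd ?m" using m dd by blast+
    have "(\<Sum>j\<in>{0..<n} - {n - 1}. ladder l (lookup \<nu> (n - 1)) (n - 1) j \<nu>)
        = (\<Sum>j\<in>{0..<n} - {n - 1}. ladder l (cmp (n - 1) j \<nu>) (n - 1) j \<nu> :: 'a mpol)"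
      by (intro sum.cong) (auto simp: cmp_def)
    then show "XY (n - 1) (xmon \<nu>) = Z (n - 1) (xmon \<nu>) + scale ?c (xmon \<nu>)"
      by (simp add: XY_def xy_mon_def zmon_def d d[simplified] scale_linear(5,6) scale_linear(8))
  qed
  also have "\<dots> = scale (wt (n - 1) \<mu> + ?c) f" using f n by (simp add: eig_def scale_linear(5))
  finally show ?thesis by (simp add: wt_def algebra_simps)
qed

end

section \<open>Normalised intertwiners and existence of eigenvectors\<close>

locale z_operators_field = z_operators l n c0 dd for l n :: nat and c0 :: "'a::field" and dd +
  assumes n_pos: "0 < n"
begin

definition swap_coeff :: "nat \<Rightarrow> (nat \<Rightarrow>\<^sub>0 nat) \<Rightarrow> 'a" where
  "swap_coeff i \<mu> = (if lookup \<mu> i mod l = lookup \<mu> (Suc i) mod l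
     then of_nat l * c0 / (wt i \<mu> - wt (Suc i) \<mu>) else 0)"

text \<open>Equal weights at the neighbours would make the exchanged exponent a second one with the
  same data. This keeps the denominator of \<open>swap_coeff\<close> away from zero.\<close>

lemma isolated_wt_neq:
  assumes "isolated \<mu>" "Suc i < n" "lookup \<mu> i \<noteq> lookup \<mu> (Suc i)"
    "lookup \<mu> i mod l = lookup \<mu> (Suc i) mod l"
  shows "wt i \<mu> \<noteq> wt (Suc i) \<mu>"
proof
  let ?s = "transpose i (Suc i)"
  assume eq: "wt i \<mu> = wt (Suc i) \<mu>"
  have "?s permutes {0..<n}" using assms by (intro transpose_permutes) auto
  then have "pexp ?s \<mu> \<in> exponents n" using assms(1) by (simp add: pexp_exponents isolated_def)
  moreover have "lookup (pexp ?s \<mu>) a mod l = lookup \<mu> a mod l" for a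
    using assms(4) by (auto simp: transpose_def)
  moreover have "wt a (pexp ?s \<mu>) = wt a \<mu>" if "a < n" for a
    using wt_swap[OF assms(2,3) that] eq by (auto simp: transpose_def)
  ultimately have "pexp ?s \<mu> = \<mu>" using assms(1) by (simp add: isolated_def)
  then have "lookup (pexp ?s \<mu>) i = lookup \<mu> i" by simp
  then show False using assms(3) by simp
qed

lemma eig_swap_coeff:
  assumes iso: "isolated \<mu>" and i: "Suc i < n" and f: "eig \<mu> f" and ne: "lookup \<mu> i \<noteq> lookup \<mu> (Suc i)"
  shows "eig (pexp (transpose i (Suc i)) \<mu>) (perm (transpose i (Suc i)) f + scale (swap_coeff i \<mu>) f)"
  by (rule eig_swap[OF i f ne]) (use isolated_wt_neq[OF iso i ne] in \<open>auto simp: swap_coeff_def\<close>)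

text \<open>Every nonzero exponent comes from one of smaller energy: a positive last entry is
  lowered by undoing \<open>shift\<close>, otherwise the last nonzero entry moves one place to the
  right. After an exchange the coefficient at \<open>\<mu>\<close> is still 1, since the predecessor
  has no term there.\<close>

lemma eig_exists:
  assumes iso: "\<And>\<mu>. \<mu> \<in> exponents n \<Longrightarrow> isolated \<mu>" and \<mu>: "\<mu> \<in> exponents n"
  shows "\<exists>f. eig \<mu> f \<and> lookup f \<mu> = 1"
  using \<mu>
proof (induction "energy n \<mu>" arbitrary: \<mu> rule: less_induct)
  case (less \<mu>)
  consider "\<mu> = 0" | "0 < lookup \<mu> (n - 1)" | "\<mu> \<noteq> 0" "lookup \<mu> (n - 1) = 0" by blast
  then show ?case
  proof cases
    case 1
    then show ?thesis using eig_0[OF n_pos] by (intro exI[of _ "xmon 0"]) (simp add: lookup_xmon)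
  next
    case 2
    obtain \<nu> where \<nu>: "\<nu> \<in> exponents n" "\<mu> = shift n \<nu>" using shift_surj[OF less.prems n_pos 2] .
    then obtain f where f: "eig \<nu> f" "lookup f \<nu> = 1"
      using less.hyps[of \<nu>] energy_shift[OF n_pos, of \<nu>] by auto
    then show ?thesis using eig_shift[OF n_pos f(1)] \<nu>(2) by (auto simp: lookup_Phi)
  next
    case 3
    have fin: "finite (keys \<mu>)" "keys \<mu> \<noteq> {}" using 3 by (auto simp: keys_eq_empty)
    define i where "i = Max (keys \<mu>)"
    have i: "i \<in> keys \<mu>" unfolding i_def using fin by (intro Max_in)
    then have "i \<noteq> n - 1" using 3 by (auto simp: in_keys_iff)
    moreover have "i < n" using i less.prems by (auto simp: exponents_def)
    ultimately have Si: "Suc i < n" by simp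
    have "Suc i \<notin> keys \<mu>"
    proof
      assume "Suc i \<in> keys \<mu>"
      from Max_ge[OF fin(1) this] show False by (simp add: i_def)
    qed
    then have ord: "lookup \<mu> (Suc i) < lookup \<mu> i" using i by (auto simp: in_keys_iff)
    let ?s = "transpose i (Suc i)"
    let ?\<nu> = "pexp ?s \<mu>"
    have "?s permutes {0..<n}" using Si by (intro transpose_permutes) auto
    then have \<nu>: "?\<nu> \<in> exponents n" using less.prems by (simp add: pexp_exponents)
    have en: "energy n ?\<nu> < energy n \<mu>" by (rule swap_energy_less[OF Si ord])
    obtain f where f: "eig ?\<nu> f" "lookup f ?\<nu> = 1" using less.hyps[OF en \<nu>] by auto
    have "eig (pexp ?s ?\<nu>) (perm ?s f + scale (swap_coeff i ?\<nu>) f)"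
      by (rule eig_swap_coeff[OF iso[OF \<nu>] Si f(1)]) (use ord in simp)
    moreover have "lookup f \<mu> = 0"
      using en by (intro eig_lookup_eq_0[OF iso[OF \<nu>] f(1)]) auto
    moreover have "lookup (perm ?s f) \<mu> = 1" using lookup_perm[of ?s f ?\<nu>] f(2) by simp
    ultimately show ?thesis by (auto simp: lookup_add intro!: exI[of _ "perm ?s f + scale (swap_coeff i ?\<nu>) f"])
  qed
qed

end

section \<open>Dunkl operators\<close>

definition mmat :: "nat \<Rightarrow> (nat \<Rightarrow> nat) \<Rightarrow> (nat \<Rightarrow> 'a::field) \<Rightarrow> 'a mat" where
  "mmat n \<sigma> c = mat n n (\<lambda>(a, b). if b = \<sigma> a then c a else 0)"

lemma mmat_carrier [simp]: "mmat n \<sigma> c \<in> carrier_mat n n" by (simp add: mmat_def)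

lemma mmat_dim [simp]: "dim_row (mmat n \<sigma> c) = n" "dim_col (mmat n \<sigma> c) = n" by (simp_all add: mmat_def)

lemma mmat_index: "a < n \<Longrightarrow> b < n \<Longrightarrow> mmat n \<sigma> c $$ (a, b) = (if b = \<sigma> a then c a else 0)"
  by (simp add: mmat_def)

lemma mmat_cong: "(\<And>a. a < n \<Longrightarrow> \<sigma> a = \<tau> a) \<Longrightarrow> (\<And>a. a < n \<Longrightarrow> c a = e a) \<Longrightarrow> mmat n \<sigma> c = mmat n \<tau> e"
  by (rule eq_matI) (auto simp: mmat_index)

lemma mmat_one: "1\<^sub>m n = mmat n id (\<lambda>_. 1)"
  by (rule eq_matI) (auto simp: mmat_index)

lemma mmat_mult:
  assumes "\<sigma> permutes {0..<n}"
  shows "mmat n \<sigma> c * mmat n \<tau> e = mmat n (\<tau> \<circ> \<sigma>) (\<lambda>a. c a * e (\<sigma> a))"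
proof (rule eq_matI)
  fix a b assume "a < dim_row (mmat n (\<tau> \<circ> \<sigma>) (\<lambda>a. c a * e (\<sigma> a)))" "b < dim_col (mmat n (\<tau> \<circ> \<sigma>) (\<lambda>a. c a * e (\<sigma> a)))"
  then have ab: "a < n" "b < n" by simp_all
  have \<sigma>a: "\<sigma> a < n" using permutes_in_image[OF assms, of a] ab by simp
  have "(mmat n \<sigma> c * mmat n \<tau> e) $$ (a, b) = (\<Sum>k\<in>{0..<n}. mmat n \<sigma> c $$ (a, k) * mmat n \<tau> e $$ (k, b))"
    using ab by (simp add: scalar_prod_def)
  also have "\<dots> = (\<Sum>k\<in>{0..<n}. if k = \<sigma> a then (if b = \<tau> k then c a * e k else 0) else 0)"
    using ab by (intro sum.cong) (auto simp: mmat_index)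
  also have "\<dots> = (if b = \<tau> (\<sigma> a) then c a * e (\<sigma> a) else 0)" using \<sigma>a by (subst sum.delta) auto
  finally show "(mmat n \<sigma> c * mmat n \<tau> e) $$ (a, b) = mmat n (\<tau> \<circ> \<sigma>) (\<lambda>a. c a * e (\<sigma> a)) $$ (a, b)"
    using ab by (simp add: mmat_index)
qed auto

lemma mat_inverse_eqI:
  assumes A: "(A :: 'a::field mat) \<in> carrier_mat n n" and B: "B \<in> carrier_mat n n"
    and AB: "A * B = 1\<^sub>m n" and BA: "B * A = 1\<^sub>m n"
  shows "mat_inverse A = Some B"
proof (cases "mat_inverse A")
  case None
  have "A \<in> Units (ring_mat TYPE('a) n ())"
    using A B AB BA by (auto simp: Units_def ring_mat_def intro!: bexI[of _ B])
  then show ?thesis using mat_inverse(1)[OF A None, of "()"] by blast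
next
  case (Some C)
  then have C: "C * A = 1\<^sub>m n" "C \<in> carrier_mat n n" using mat_inverse(2)[OF A] by auto
  have "C = C * (A * B)" using C AB by simp
  also have "\<dots> = (C * A) * B" by (rule assoc_mult_mat[OF C(2) A B, symmetric])
  also have "\<dots> = B" using C B by simp
  finally show ?thesis using Some by simp
qed

lemma mmat_inverse:
  assumes \<sigma>: "\<sigma> permutes {0..<n}" and c: "\<And>a. a < n \<Longrightarrow> c a \<noteq> 0"
  shows "mat_inverse (mmat n \<sigma> c) = Some (mmat n (pinv \<sigma>) (\<lambda>a. inverse (c (pinv \<sigma> a))))"
proof (rule mat_inverse_eqI)
  have in_n: "pinv \<sigma> a < n" if "a < n" for a
    using permutes_in_image[OF permutes_inv[OF \<sigma>], of a] that by simp
  show "mmat n \<sigma> c * mmat n (pinv \<sigma>) (\<lambda>a. inverse (c (pinv \<sigma> a))) = 1\<^sub>m n"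
    unfolding mmat_mult[OF \<sigma>] mmat_one using c
    by (intro mmat_cong) (simp_all add: permutes_inverses[OF \<sigma>])
  show "mmat n (pinv \<sigma>) (\<lambda>a. inverse (c (pinv \<sigma> a))) * mmat n \<sigma> c = 1\<^sub>m n"
    unfolding mmat_mult[OF permutes_inv[OF \<sigma>]] mmat_one using c in_n
    by (intro mmat_cong) (simp_all add: permutes_inverses[OF \<sigma>])
qed simp_all

definition monchar :: "(nat \<Rightarrow> 'a::comm_ring_1) \<Rightarrow> (nat \<Rightarrow>\<^sub>0 nat) \<Rightarrow> 'a" where
  "monchar c m = (\<Prod>i\<in>keys m. c i ^ lookup m i)"

lemma scale_power: "scale c f ^ k = scale (c ^ k) (f ^ k :: 'a::comm_ring_1 mpol)"
  by (induction k) (simp_all add: scale_algebra mult.commute)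

lemma scale_prod: "(\<Prod>i\<in>S. scale (c i) (F i)) = scale (\<Prod>i\<in>S. c i) (\<Prod>i\<in>S. F i :: 'a::comm_ring_1 mpol)"
  by (induction S rule: infinite_finite_induct) (simp_all add: scale_algebra mult.commute)

lemma var_power: "var j ^ k = (xmon (Poly_Mapping.single j k) :: 'a::comm_ring_1 mpol)"
  by (induction k) (simp_all add: xmon_def var_def mult_single flip: single_add)

lemma prod_xmon: "(\<Prod>i\<in>S. xmon (h i)) = (xmon (\<Sum>i\<in>S. h i) :: 'a::comm_ring_1 mpol)"
  by (induction S rule: infinite_finite_induct) (simp_all add: xmon_mult, simp_all add: xmon_def)

lemma prod_var_pexp:
  assumes "bij \<pi>"
  shows "(\<Prod>i\<in>keys m. scale (c i) (var (\<pi> i)) ^ lookup m i) = scale (monchar c m) (xmon (pexp \<pi> m) :: 'a::comm_ring_1 mpol)"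
proof -
  have "pexp \<pi> m = (\<Sum>i\<in>keys m. Poly_Mapping.single (\<pi> i) (lookup m i))"
  proof (rule pexp_eqI[OF assms])
    fix a
    have "\<pi> i = \<pi> a \<longleftrightarrow> i = a" for i using assms by (auto simp: bij_is_inj inj_eq)
    then show "lookup (\<Sum>i\<in>keys m. Poly_Mapping.single (\<pi> i) (lookup m i)) (\<pi> a) = lookup m a"
      by (simp add: lookup_sum lookup_single when_def in_keys_iff)
  qed
  then show ?thesis by (simp add: scale_power scale_prod var_power prod_xmon monchar_def)
qed

lemma subst_lin: "subst g f = lin (\<lambda>m. \<Prod>i\<in>keys m. g i ^ lookup m i) f"
  by (simp add: subst_def lin_def scale_def)

lemma linop_act: "linop (act n w)"
proof -
  have "act n w = lin (\<lambda>m. \<Prod>i\<in>keys m. (\<Sum>b<n. scale (the (mat_inverse w) $$ (i, b)) (var b)) ^ lookup m i)"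
    by (rule ext) (simp add: act_def subst_lin)
  then show ?thesis by (simp add: linop_lin)
qed

lemma act_mmat:
  assumes \<sigma>: "\<sigma> permutes {0..<n}" and c: "\<And>a. a < n \<Longrightarrow> c a \<noteq> 0" and m: "m \<in> exponents n"
  shows "act n (mmat n \<sigma> c) (xmon m) =
    scale (monchar (\<lambda>a. inverse (c (pinv \<sigma> a))) m) (xmon (pexp (pinv \<sigma>) m))"
proof -
  have "(\<Sum>b<n. scale (the (mat_inverse (mmat n \<sigma> c)) $$ (i, b)) (var b)) =
      scale (inverse (c (pinv \<sigma> i))) (var (pinv \<sigma> i))" if "i \<in> keys m" for i
  proof -
    have i: "i < n" using m that by (auto simp: exponents_def)
    then have pi: "pinv \<sigma> i < n" using permutes_in_image[OF permutes_inv[OF \<sigma>], of i] by simp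
    have "(\<Sum>b<n. scale (the (mat_inverse (mmat n \<sigma> c)) $$ (i, b)) (var b)) =
        (\<Sum>b<n. if b = pinv \<sigma> i then scale (inverse (c (pinv \<sigma> i))) (var b) else 0)"
      using i by (intro sum.cong) (auto simp: mmat_inverse[OF \<sigma> c] mmat_index scale_algebra)
    then show ?thesis using pi by simp
  qed
  then have "act n (mmat n \<sigma> c) (xmon m) = (\<Prod>i\<in>keys m. scale (inverse (c (pinv \<sigma> i))) (var (pinv \<sigma> i)) ^ lookup m i)"
    by (simp add: act_def subst_lin)
  also have "\<dots> = scale (monchar (\<lambda>a. inverse (c (pinv \<sigma> a))) m) (xmon (pexp (pinv \<sigma>) m))"
    using permutes_bij[OF permutes_inv[OF \<sigma>]] by (rule prod_var_pexp)
  finally show ?thesis .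
qed

lemma zeta_mat_mmat: "zeta_mat n \<zeta> i = mmat n id (\<lambda>a. if a = i then \<zeta> else 1)"
  by (rule eq_matI) (auto simp: zeta_mat_def mmat_index)

lemma zeta_mat_pow: "zeta_mat n \<zeta> i ^\<^sub>m t = mmat n id (\<lambda>a. if a = i then \<zeta> ^ t else 1)"
proof (induction t)
  case 0
  have "dim_row (zeta_mat n \<zeta> i) = n" by (simp add: zeta_mat_def)
  then show ?case by (simp add: mmat_one) (rule mmat_cong, simp_all)
next
  case (Suc t)
  show ?case
    unfolding pow_mat.simps Suc.IH unfolding zeta_mat_mmat mmat_mult[OF permutes_id]
    by (rule mmat_cong) auto
qed

lemma swaprows_mmat:
  assumes "i \<noteq> j" shows "swaprows_mat n i j = mmat n (transpose i j) (\<lambda>_. 1 :: 'a::field)"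
  by (rule eq_matI) (use assms in \<open>auto simp: swaprows_mat_def mmat_index transpose_def\<close>)

lemma refl_mat_mmat:
  assumes ij: "i < n" "j < n" "i \<noteq> j" and \<zeta>: "\<zeta> \<noteq> 0"
  shows "refl_mat n \<zeta> i j r =
    mmat n (transpose i j) (\<lambda>a. if a = i then \<zeta> ^ r else if a = j then inverse (\<zeta> ^ r) else 1)"
proof -
  have "mat_inverse (zeta_mat n \<zeta> i ^\<^sub>m r) = Some (mmat n (pinv id) (\<lambda>a. inverse (if pinv id a = i then \<zeta> ^ r else 1)))"
    unfolding zeta_mat_pow using \<zeta> by (intro mmat_inverse permutes_id) auto
  then show ?thesis
    unfolding refl_mat_def zeta_mat_pow
    by (simp add: swaprows_mmat[OF ij(3)] mmat_mult[OF permutes_id] mmat_mult[OF transpose_permutes[OF ij(1,2)]])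
      (rule mmat_cong, use ij in \<open>auto simp: transpose_def\<close>)
qed

lemma act_zeta_pow:
  assumes "i < n" "\<zeta> \<noteq> 0" "m \<in> exponents n"
  shows "act n (zeta_mat n \<zeta> i ^\<^sub>m t) (xmon m) = scale (inverse (\<zeta> ^ t) ^ lookup m i) (xmon m)"
proof -
  have "monchar (\<lambda>a. inverse (if a = i then \<zeta> ^ t else 1)) m = (\<Prod>a\<in>keys m. if a = i then inverse (\<zeta> ^ t) ^ lookup m a else 1)"
    unfolding monchar_def by (intro prod.cong) auto
  also have "\<dots> = inverse (\<zeta> ^ t) ^ lookup m i" by (simp add: in_keys_iff)
  finally show ?thesis
    unfolding zeta_mat_pow using assms by (subst act_mmat[OF permutes_id]) auto
qed

lemma act_zeta:
  assumes "i < n" "\<zeta> \<noteq> 0" "m \<in> exponents n"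
  shows "act n (zeta_mat n \<zeta> i) (xmon m) = scale (inverse \<zeta> ^ lookup m i) (xmon m)"
proof -
  have "zeta_mat n \<zeta> i ^\<^sub>m 1 = zeta_mat n \<zeta> i" by (simp only: zeta_mat_pow zeta_mat_mmat) simp
  then show ?thesis using act_zeta_pow[OF assms, of 1] by simp
qed

lemma act_refl:
  assumes "i < n" "j < n" "i \<noteq> j" "\<zeta> \<noteq> 0" "m \<in> exponents n"
  shows "act n (refl_mat n \<zeta> i j r) (xmon m) =
    scale ((\<zeta> ^ r) ^ lookup m i * inverse (\<zeta> ^ r) ^ lookup m j) (xmon (pexp (transpose i j) m))"
proof -
  let ?c = "\<lambda>a. if a = i then \<zeta> ^ r else if a = j then inverse (\<zeta> ^ r) else 1"
  have "monchar (\<lambda>a. inverse (?c (transpose i j a))) m = monchar ?c m"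
    unfolding monchar_def using assms(3) by (intro prod.cong) (auto simp: transpose_def)
  also have "\<dots> = (\<Prod>a\<in>keys m. (if a = i then (\<zeta> ^ r) ^ lookup m a else 1) * (if a = j then inverse (\<zeta> ^ r) ^ lookup m a else 1))"
    unfolding monchar_def using assms(3) by (intro prod.cong) auto
  also have "\<dots> = (\<zeta> ^ r) ^ lookup m i * inverse (\<zeta> ^ r) ^ lookup m j"
    by (simp add: prod.distrib in_keys_iff)
  finally have char: "monchar (\<lambda>a. inverse (?c (transpose i j a))) m = \<dots>" .
  have "act n (mmat n (transpose i j) ?c) (xmon m) =
      scale (monchar (\<lambda>a. inverse (?c (pinv (transpose i j) a))) m) (xmon (pexp (pinv (transpose i j)) m))"
    using assms by (intro act_mmat transpose_permutes) auto
  then show ?thesis unfolding refl_mat_mmat[OF assms(1-4)] inv_transpose_eq char .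
qed

lemma exact_div_lin:
  assumes "g \<noteq> 0" "\<And>m. m \<in> keys f \<Longrightarrow> q m * g = h m"
  shows "exact_div (lin h f) g = lin q f"
proof -
  have "lin q f * g = lin h f"
    unfolding lin_def sum_distrib_right by (intro sum.cong) (simp_all add: scale_algebra assms(2))
  then show ?thesis using exact_div_mult[OF assms(1), of "lin q f"] by simp
qed

lemma linop_as_lin: "linop A \<Longrightarrow> A f = lin (\<lambda>m. A (xmon m)) f"
  by (rule linop_ext[OF _ linop_lin]) simp_all

lemma sum_roots: "(x::'a::field) ^ l = 1 \<Longrightarrow> (\<Sum>r<l. x ^ r) = (if x = 1 then of_nat l else 0)"
proof -
  assume x: "x ^ l = 1"
  have "(x - 1) * (\<Sum>r<l. x ^ r) = 0" using power_diff_1_eq[of x l] x by simp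
  then show ?thesis by auto
qed

text \<open>The geometric sum for the divided difference of a monomial by
  \<open>var i - scale z (var j)\<close>. If the exponent of \<open>x_j\<close> dominates, the sum
  runs the other way, whence the sign and \<open>inverse z\<close>.\<close>

definition divdiff :: "'a::field \<Rightarrow> nat \<Rightarrow> nat \<Rightarrow> (nat \<Rightarrow>\<^sub>0 nat) \<Rightarrow> 'a mpol" where
  "divdiff z i j m = (let a = lookup m i; b = lookup m j in
     if b < a then \<Sum>s<a - b. scale (z ^ s) (xmon (repl m i (a - 1 - s) j (b + s)))
     else - (\<Sum>s<b - a. scale (inverse z ^ Suc s) (xmon (repl m i (a + s) j (b - 1 - s)))))"

lemma divdiff_mult:
  assumes ij: "i \<noteq> j" and z: "z \<noteq> 0"
  shows "divdiff z i j m * (var i - scale z (var j)) =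
    xmon m - scale (z ^ lookup m i * inverse z ^ lookup m j) (xmon (pexp (transpose i j) m))"
proof -
  let ?a = "lookup m i" and ?b = "lookup m j"
  have v: "xmon (repl m i a j b) * var i = (xmon (repl m i (Suc a) j b) :: 'a mpol)"
    "xmon (repl m i a j b) * var j = (xmon (repl m i a j (Suc b)) :: 'a mpol)" for a b
  proof -
    have "repl m i a j b + eps i = repl m i (Suc a) j b" "repl m i a j b + eps j = repl m i a j (Suc b)"
      using ij by (auto intro!: poly_mapping_eqI simp: lookup_repl lookup_add lookup_single when_def)
    then show "xmon (repl m i a j b) * var i = (xmon (repl m i (Suc a) j b) :: 'a mpol)"
      "xmon (repl m i a j b) * var j = (xmon (repl m i a j (Suc b)) :: 'a mpol)"
      by (simp_all add: var_mult_xmon mult.commute[of "xmon _"])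
  qed
  show ?thesis
  proof (cases "?b < ?a")
    case True
    define H where "H s = scale (z ^ s) (xmon (repl m i (?a - s) j (?b + s)) :: 'a mpol)" for s
    have "scale (z ^ s) (xmon (repl m i (?a - 1 - s) j (?b + s))) * (var i - scale z (var j)) = H s - H (Suc s)"
      if "s < ?a - ?b" for s
    proof -
      have "Suc (?a - 1 - s) = ?a - s" using that by simp
      then show ?thesis unfolding H_def
        by (simp only: right_diff_distrib scale_times v scale_linear) (simp add: mult.commute)
    qed
    then have "divdiff z i j m * (var i - scale z (var j)) = (\<Sum>s<?a - ?b. H s - H (Suc s))"
      using True by (simp add: divdiff_def Let_def sum_distrib_right)
    also have "\<dots> = H 0 - H (?a - ?b)" by (rule sum_lessThan_telescope')
    finally show ?thesis using True ij z
      by (simp add: H_def scale_algebra repl_swap power_diff power_inverse field_simps flip: repl_swap)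
  next
    case False
    define H where "H s = scale (inverse z ^ s) (xmon (repl m i (?a + s) j (?b - s)) :: 'a mpol)" for s
    have "- scale (inverse z ^ Suc s) (xmon (repl m i (?a + s) j (?b - 1 - s))) * (var i - scale z (var j)) = H s - H (Suc s)"
      if "s < ?b - ?a" for s
    proof -
      have "Suc (?b - 1 - s) = ?b - s" using that by simp
      then show ?thesis unfolding H_def mult_minus_left using z
        by (simp only: right_diff_distrib scale_times v scale_linear) simp
    qed
    then have "divdiff z i j m * (var i - scale z (var j)) = (\<Sum>s<?b - ?a. H s - H (Suc s))"
      using False by (simp add: divdiff_def Let_def sum_distrib_right flip: sum_negf)
    also have "\<dots> = H 0 - H (?b - ?a)" by (rule sum_lessThan_telescope')
    finally show ?thesis using False ij z
      by (simp add: H_def scale_algebra repl_swap power_diff power_inverse field_simps flip: repl_swap)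
  qed
qed

section \<open>Closed forms of the Dunkl operators and of the operators \<open>z_i\<close>\<close>

locale dunkl_field =
  fixes l n :: nat and \<zeta> c0 :: "'a::field" and d :: "int \<Rightarrow> 'a"
  assumes l_pos: "1 \<le> l" and n_pos: "0 < n" and root: "\<zeta> ^ l = 1"
    and primitive: "\<And>t. 0 < t \<Longrightarrow> t < l \<Longrightarrow> \<zeta> ^ t \<noteq> 1"
    and l_char: "of_nat l \<noteq> (0 :: 'a)" and periodic: "\<And>i. d (i + int l) = d i"
begin

lemma d_mod: "d (i mod int l) = d i"
proof -
  have nat: "d (i + int l * int k) = d i" for i k
  proof (induction k)
    case (Suc k)
    have "i + int l * int (Suc k) = (i + int l * int k) + int l" by (simp add: algebra_simps)
    then show ?case using Suc periodic by metis
  qed simp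
  have "d (i + int l * k) = d i" for i k
    using nat[of i "nat k"] nat[of "i + int l * k" "nat (- k)"] by (cases "0 \<le> k") auto
  from this[of "i mod int l" "i div int l"] show ?thesis by simp
qed

definition dd :: "nat \<Rightarrow> 'a" where "dd p = d 0 - d (- int p)"

sublocale z_operators_field l n c0 dd
proof
  show "dd a = dd b" if "a mod l = b mod l" for a b
  proof -
    have "int a mod int l = int b mod int l" using that by (metis of_nat_mod)
    then have "(- int a) mod int l = (- int b) mod int l" by (metis mod_minus_eq)
    then show ?thesis unfolding dd_def by (metis d_mod)
  qed
qed (use l_pos n_pos in auto)

lemma zeta_nonzero: "\<zeta> \<noteq> 0"
  using root l_pos by (metis power_0_left not_one_le_zero zero_neq_one)

lemma zeta_power_mod: "\<zeta> ^ (s mod l) = \<zeta> ^ s"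
proof -
  have "\<zeta> ^ s = \<zeta> ^ (l * (s div l) + s mod l)" by simp
  also have "\<dots> = \<zeta> ^ (s mod l)" by (simp only: power_add power_mult root power_one mult_1)
  finally show ?thesis by simp
qed

lemma zeta_power_eq_1_iff: "\<zeta> ^ s = 1 \<longleftrightarrow> l dvd s"
  using primitive[of "s mod l"] l_pos zeta_power_mod[of s] by (cases "s mod l = 0") auto

lemma zeta_power_eq_iff: "\<zeta> ^ a = \<zeta> ^ b \<longleftrightarrow> a mod l = b mod l"
proof -
  have *: "\<zeta> ^ a = \<zeta> ^ b \<longleftrightarrow> a mod l = b mod l" if "a \<le> b" for a b
  proof -
    have "\<zeta> ^ b = \<zeta> ^ a * \<zeta> ^ (b - a)" using that by (simp flip: power_add)
    then have "\<zeta> ^ a = \<zeta> ^ b \<longleftrightarrow> \<zeta> ^ (b - a) = 1" using zeta_nonzero by auto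
    then show ?thesis using mod_eq_dvd_iff_nat[OF that, of l] by (auto simp: zeta_power_eq_1_iff)
  qed
  show ?thesis using *[of a b] *[of b a] by (cases "a \<le> b") auto
qed

lemma sum_zeta: "(\<Sum>r<l. (\<zeta> ^ r) ^ s) = (if l dvd s then of_nat l else 0)"
proof -
  have "(\<zeta> ^ s) ^ l = 1" by (simp add: power_mult[symmetric] mult.commute[of s l]) (simp add: power_mult root)
  from sum_roots[OF this] show ?thesis
    by (simp add: zeta_power_eq_1_iff mult.commute flip: power_mult)
qed

lemma sum_zeta_inverse: "(\<Sum>r<l. (inverse \<zeta> ^ r) ^ s) = (if l dvd s then of_nat l else 0)"
proof -
  have "(inverse \<zeta> ^ s) ^ l = 1"
    by (simp add: power_inverse power_mult[symmetric] mult.commute[of s l]) (simp add: power_mult root)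
  from sum_roots[OF this] show ?thesis
    by (simp add: zeta_power_eq_1_iff[symmetric] mult.commute power_inverse flip: power_mult)
qed

lemma sum_zeta_quotient: "(\<Sum>r<l. (\<zeta> ^ r) ^ a * inverse (\<zeta> ^ r) ^ b) = (if a mod l = b mod l then of_nat l else 0)"
proof -
  let ?x = "\<zeta> ^ a * inverse \<zeta> ^ b"
  have "?x ^ l = (\<zeta> ^ l) ^ a * inverse (\<zeta> ^ l) ^ b"
    by (simp add: power_mult_distrib power_inverse mult.commute flip: power_mult)
  then have "?x ^ l = 1" by (simp add: root)
  moreover have "?x = 1 \<longleftrightarrow> a mod l = b mod l"
    using zeta_nonzero by (simp add: power_inverse field_simps zeta_power_eq_iff)
  moreover have "(\<Sum>r<l. (\<zeta> ^ r) ^ a * inverse (\<zeta> ^ r) ^ b) = (\<Sum>r<l. ?x ^ r)"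
    by (intro sum.cong) (simp_all add: power_mult_distrib power_inverse mult.commute flip: power_mult)
  ultimately show ?thesis using sum_roots[of ?x l] by simp
qed

lemma sum_dvd_reindex:
  "(\<Sum>s | s < (k :: nat) \<and> l dvd s. F s) = (\<Sum>u | l * u < k. F (l * u))"
  by (rule sum.reindex_bij_witness[of _ "\<lambda>u. l * u" "\<lambda>s. s div l"]) (use l_pos in auto)

lemma sum_dvd_reindex_Suc:
  "(\<Sum>s | s < (k :: nat) \<and> l dvd Suc s. F (Suc s)) = (\<Sum>u | 1 \<le> u \<and> l * u \<le> k. F (l * u))"
  by (rule sum.reindex_bij_witness[of _ "\<lambda>u. l * u - 1" "\<lambda>s. Suc s div l"])
    (use l_pos in \<open>auto simp: Suc_le_eq dvd_imp_le intro!: div_greater_zero_iff[THEN iffD2] less_le_trans[OF diff_Suc_less]\<close>)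

text \<open>Summation over all \<open>l\<close>-th roots of unity keeps only the powers divisible by
  \<open>l\<close>; multiplied by \<open>x_i\<close>, the survivors are the rungs of the
  ladder.\<close>

lemma sum_divdiff:
  assumes ij: "i \<noteq> j"
  shows "(\<Sum>r<l. var i * divdiff (\<zeta> ^ r) i j m) = scale (of_nat l) (ladder l (lookup m i) i j m)"
proof (cases "lookup m j < lookup m i")
  case True
  let ?a = "lookup m i" and ?b = "lookup m j"
  let ?X = "\<lambda>s. xmon (repl m i (?a - s) j (?b + s)) :: 'a mpol"
  have v: "var i * xmon (repl m i (?a - 1 - s) j (?b + s)) = ?X s" if "s < ?a - ?b" for s
  proof -
    have "repl m i (?a - 1 - s) j (?b + s) + eps i = repl m i (?a - s) j (?b + s)"
      using ij that by (auto intro!: poly_mapping_eqI simp: lookup_repl lookup_add lookup_single when_def)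
    then show ?thesis by (simp add: var_mult_xmon)
  qed
  have "(\<Sum>r<l. var i * divdiff (\<zeta> ^ r) i j m) = (\<Sum>r<l. \<Sum>s<?a - ?b. scale ((\<zeta> ^ r) ^ s) (?X s))"
    using True by (simp add: divdiff_def Let_def sum_distrib_left scale_times v[simplified])
  also have "\<dots> = (\<Sum>s<?a - ?b. scale (\<Sum>r<l. (\<zeta> ^ r) ^ s) (?X s))"
    by (subst sum.swap) (auto intro!: sum.cong poly_mapping_eqI simp: lookup_sum sum_distrib_right)
  also have "\<dots> = (\<Sum>s | s < ?a - ?b \<and> l dvd s. scale (of_nat l) (?X s))"
    by (rule sum.mono_neutral_cong_right) (auto simp: sum_zeta scale_algebra)
  also have "\<dots> = scale (of_nat l) (\<Sum>u | l * u < ?a - ?b. ?X (l * u))"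
    by (subst sum_dvd_reindex) (simp add: scale_algebra)
  finally show ?thesis using True by (simp add: ladder_def)
next
  case False
  let ?a = "lookup m i" and ?b = "lookup m j"
  let ?X = "\<lambda>s. xmon (repl m i (?a + s) j (?b - s)) :: 'a mpol"
  have v: "var i * xmon (repl m i (?a + s) j (?b - 1 - s)) = ?X (Suc s)" if "s < ?b - ?a" for s
  proof -
    have "repl m i (?a + s) j (?b - 1 - s) + eps i = repl m i (?a + Suc s) j (?b - Suc s)"
      using ij that by (auto intro!: poly_mapping_eqI simp: lookup_repl lookup_add lookup_single when_def)
    then show ?thesis by (simp add: var_mult_xmon)
  qed
  have "(\<Sum>r<l. var i * divdiff (\<zeta> ^ r) i j m) = - (\<Sum>r<l. \<Sum>s<?b - ?a. scale ((inverse \<zeta> ^ r) ^ Suc s) (?X (Suc s)))"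
    using False by (simp add: divdiff_def Let_def sum_distrib_left scale_times v[simplified] sum_negf power_inverse
        del: power_Suc)
  also have "(\<Sum>r<l. \<Sum>s<?b - ?a. scale ((inverse \<zeta> ^ r) ^ Suc s) (?X (Suc s))) =
      (\<Sum>s<?b - ?a. scale (\<Sum>r<l. (inverse \<zeta> ^ r) ^ Suc s) (?X (Suc s)))"
    by (subst sum.swap) (auto intro!: sum.cong poly_mapping_eqI simp: lookup_sum sum_distrib_right)
  also have "\<dots> = (\<Sum>s | s < ?b - ?a \<and> l dvd Suc s. scale (of_nat l) (?X (Suc s)))"
    by (rule sum.mono_neutral_cong_right) (auto simp: sum_zeta_inverse scale_algebra simp del: power_Suc)
  also have "\<dots> = scale (of_nat l) (\<Sum>u | 1 \<le> u \<and> l * u \<le> ?b - ?a. ?X (l * u))"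
    by (subst sum_dvd_reindex_Suc) (simp add: scale_algebra)
  finally show ?thesis using False by (simp add: ladder_def scale_algebra)
qed

lemma linop_e_op: "linop (e_op l n \<zeta> i r)"
  unfolding linop_def e_op_def
  by (simp add: linopD[OF linop_act] scale_algebra sum.distrib mult.commute mult.left_commute)

lemma e_op_xmon:
  assumes "i < n" "m \<in> exponents n"
  shows "e_op l n \<zeta> i r (xmon m) = (if l dvd r + lookup m i then xmon m else 0)"
proof -
  have pw: "\<zeta> powi (- int (t * r)) = (inverse \<zeta> ^ t) ^ r" for t
    by (simp only: power_int_minus power_int_of_nat power_mult power_inverse)
  have "e_op l n \<zeta> i r (xmon m) = scale (1 / of_nat l) (scale (\<Sum>t<l. (inverse \<zeta> ^ t) ^ (r + lookup m i)) (xmon m))"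
    unfolding e_op_def pw act_zeta_pow[OF assms(1) zeta_nonzero assms(2)]
    by (rule arg_cong[where f = "scale _"], rule poly_mapping_eqI)
      (simp add: lookup_sum sum_distrib_right power_inverse power_add)
  then show ?thesis using l_char by (simp add: sum_zeta_inverse scale_algebra)
qed

lemma sum_e_op_xmon:
  assumes "i < n" "m \<in> exponents n"
  shows "(\<Sum>r<l. scale (d 0 - d (int r)) (e_op l n \<zeta> i r (xmon m))) = scale (dd (lookup m i)) (xmon m)"
proof -
  let ?a = "lookup m i"
  \<comment> \<open>The only class whose projection keeps the monomial: the residue of minus its
    exponent.\<close>
  define r0 where "r0 = nat ((- int ?a) mod int l)"
  have r0: "int r0 = (- int ?a) mod int l" "r0 < l" using l_pos by (auto simp: r0_def nat_less_iff)
  have iff: "l dvd r + ?a \<longleftrightarrow> r = r0" if "r < l" for r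
  proof -
    have "l dvd r + ?a \<longleftrightarrow> int l dvd int r - (- int ?a)" by (simp flip: of_nat_add)
    also have "\<dots> \<longleftrightarrow> int r mod int l = (- int ?a) mod int l" by (rule mod_eq_dvd_iff[symmetric])
    also have "int r mod int l = int r" using that by simp
    finally show ?thesis using r0(1) by (metis of_nat_eq_iff)
  qed
  have "(\<Sum>r<l. scale (d 0 - d (int r)) (e_op l n \<zeta> i r (xmon m))) =
      (\<Sum>r<l. if r = r0 then scale (d 0 - d (int r)) (xmon m) else 0)"
    by (intro sum.cong) (auto simp: e_op_xmon[OF assms] iff scale_algebra)
  also have "\<dots> = scale (d 0 - d (int r0)) (xmon m)" using r0(2) by simp
  finally show ?thesis by (simp add: dd_def r0(1) d_mod)
qed

lemma var_neq: "i \<noteq> j \<Longrightarrow> var i - scale z (var j) \<noteq> (0 :: 'a mpol)"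
proof
  assume "i \<noteq> j" "var i - scale z (var j) = (0 :: 'a mpol)"
  then have "lookup (var i - scale z (var j)) (eps i) = (0 :: 'a)" by simp
  moreover have "eps j \<noteq> eps i" using \<open>i \<noteq> j\<close> by (metis lookup_single_eq lookup_single_not_eq nat.distinct(1))
  ultimately show False by (simp add: lookup_minus var_xmon lookup_xmon)
qed

lemma var_nonzero: "var i \<noteq> (0 :: 'a mpol)"
  using var_neq[of i "Suc i" 0] by (simp add: scale_algebra)

lemma var_mult_minus_eps: "0 < lookup m i \<Longrightarrow> var i * xmon (m - eps i) = (xmon m :: 'a mpol)"
proof -
  assume "0 < lookup m i"
  then have "m - eps i + eps i = m"
    by (auto intro!: poly_mapping_eqI simp: lookup_add lookup_minus lookup_single when_def)
  then show ?thesis by (simp add: var_mult_xmon)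
qed

text \<open>The product with \<open>x_i\<close> has a closed form without division, and it
  determines \<open>y_i\<close> because polynomials form a domain.\<close>

lemma var_mult_dunkl:
  assumes i: "i < n" and f: "f \<in> poly_ring n"
  shows "var i * dunkl l n \<zeta> c0 d i f = XY i f"
proof -
  have exp: "m \<in> exponents n" if "m \<in> keys f" for m using f that by (auto simp: poly_ring_def)
  let ?P = "\<lambda>m. scale (of_nat (lookup m i)) (xmon (m - eps i)) :: 'a mpol"
  let ?R = "\<lambda>m. scale (dd (lookup m i)) (xmon (m - eps i)) :: 'a mpol"
  let ?J = "{0..<n} - {i}"
  have P: "pderiv_var i f = lin ?P f"
    unfolding pderiv_var_def lin_def
    by (intro sum.cong) (auto intro!: poly_mapping_eqI simp: lookup_single lookup_xmon when_def)
  have Q: "exact_div (f - act n (refl_mat n \<zeta> i j r) f) (var i - scale (\<zeta> ^ r) (var j)) = lin (divdiff (\<zeta> ^ r) i j) f"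
    if j: "j \<in> ?J" for j r
  proof -
    have "f - act n (refl_mat n \<zeta> i j r) f = lin (\<lambda>m. xmon m - act n (refl_mat n \<zeta> i j r) (xmon m)) f"
      by (rule linop_as_lin[OF linop_combine(2)[OF linop_id linop_act]])
    also have "exact_div \<dots> (var i - scale (\<zeta> ^ r) (var j)) = lin (divdiff (\<zeta> ^ r) i j) f"
    proof (rule exact_div_lin)
      show "var i - scale (\<zeta> ^ r) (var j) \<noteq> 0" using j by (intro var_neq) auto
      fix m assume "m \<in> keys f"
      then show "divdiff (\<zeta> ^ r) i j m * (var i - scale (\<zeta> ^ r) (var j)) = xmon m - act n (refl_mat n \<zeta> i j r) (xmon m)"
        using j i zeta_nonzero by (subst divdiff_mult) (auto simp: act_refl[OF _ _ _ zeta_nonzero exp])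
    qed
    finally show ?thesis .
  qed
  have R: "exact_div (\<Sum>r<l. scale (d 0 - d (int r)) (e_op l n \<zeta> i r f)) (var i) = lin ?R f"
  proof -
    have lo: "linop (\<lambda>f. \<Sum>r<l. scale (d 0 - d (int r)) (e_op l n \<zeta> i r f))"
      by (rule linop_sum) (rule linop_scale[OF linop_e_op])
    have "(\<Sum>r<l. scale (d 0 - d (int r)) (e_op l n \<zeta> i r f)) =
        lin (\<lambda>m. \<Sum>r<l. scale (d 0 - d (int r)) (e_op l n \<zeta> i r (xmon m))) f"
      by (rule linop_as_lin[OF lo])
    also have "exact_div \<dots> (var i) = lin ?R f"
    proof (rule exact_div_lin[OF var_nonzero])
      fix m assume m: "m \<in> keys f"
      have "?R m * var i = scale (dd (lookup m i)) (var i * xmon (m - eps i))"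
        by (simp add: scale_algebra mult.commute)
      \<comment> \<open>At exponent 0 the truncated \<open>m - eps i\<close> does no harm, because
        \<open>dd 0 = 0\<close>.\<close>
      also have "\<dots> = scale (dd (lookup m i)) (xmon m)"
        by (cases "lookup m i = 0") (simp_all add: var_mult_minus_eps, simp add: dd_def scale_algebra)
      finally show "?R m * var i = (\<Sum>r<l. scale (d 0 - d (int r)) (e_op l n \<zeta> i r (xmon m)))"
        using sum_e_op_xmon[OF i exp[OF m]] by simp
    qed
    finally show ?thesis .
  qed
  let ?D = "\<lambda>f. lin ?P f - scale c0 (\<Sum>j\<in>?J. \<Sum>r<l. lin (divdiff (\<zeta> ^ r) i j) f) - lin ?R f"
  have "dunkl l n \<zeta> c0 d i f = ?D f"
    unfolding dunkl_def P R using Q by simp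
  moreover have "var i * ?D f = XY i f"
  proof (rule linop_ext[where A = "\<lambda>f. var i * ?D f" and B = "XY i"])
    show "linop (\<lambda>f. var i * ?D f)"
      by (rule linop_combine(3)[OF linop_times linop_combine(2)[OF linop_combine(2)[OF linop_lin
          linop_scale[OF linop_sum[OF linop_sum[OF linop_lin]]]] linop_lin]])
    show "linop (XY i)" by (rule linop_XY)
    fix m
    have p: "var i * ?P m = scale (of_nat (lookup m i)) (xmon m)"
      by (cases "lookup m i = 0") (simp_all add: var_mult_minus_eps scale_algebra)
    have r: "var i * ?R m = scale (dd (lookup m i)) (xmon m)"
      by (cases "lookup m i = 0") (simp_all add: var_mult_minus_eps scale_times, simp add: dd_def scale_algebra)
    have q: "var i * (\<Sum>j\<in>?J. \<Sum>r<l. divdiff (\<zeta> ^ r) i j m) = scale (of_nat l) (\<Sum>j\<in>?J. ladder l (lookup m i) i j m)"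
      by (simp add: sum_distrib_left scale_linear(10) sum_divdiff)
    show "var i * ?D (xmon m) = XY i (xmon m)"
      unfolding XY_def lin_xmon xy_mon_def right_diff_distrib p r
      unfolding scale_times(1) q by (simp add: scale_linear(4,6) mult.commute)
  qed
  ultimately show ?thesis by simp
qed

text \<open>After multiplication by \<open>x_i\<close>, the term \<open>y_i x_i f\<close> becomes
  \<open>XY i\<close> at \<open>x_i f\<close>, with threshold \<open>Suc (lookup m i)\<close>. The
  averaged reflections bring it down by one for \<open>j < i\<close>, and the variable is cancelled
  at the end.\<close>

lemma z_op_Z:
  assumes i: "i < n" and f: "f \<in> poly_ring n"
  shows "z_op l n \<zeta> c0 d i f = Z i f"
proof -
  have exp: "m \<in> exponents n" if "m \<in> keys f" for m using f that by (auto simp: poly_ring_def)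
  let ?S = "\<lambda>f. \<Sum>j<i. \<Sum>r<l. act n (refl_mat n \<zeta> i j r) f"
  have "var i * z_op l n \<zeta> c0 d i f = XY i (var i * f) + var i * scale c0 (?S f)"
    unfolding z_op_def distrib_left
    using var_mult_dunkl[OF i poly_ring_closed(7)[OF var_in_poly_ring[OF i] f]] by simp
  also have "\<dots> = var i * Z i f"
  proof (rule linop_ext[where A = "\<lambda>f. XY i (var i * f) + var i * scale c0 (?S f)" and B = "\<lambda>f. var i * Z i f"])
    show "linop (\<lambda>f. XY i (var i * f) + var i * scale c0 (?S f))"
      by (rule linop_combine(1)[OF linop_combine(3)[OF linop_XY linop_times]
          linop_combine(3)[OF linop_times linop_scale[OF linop_sum[OF linop_sum[OF linop_act]]]]])
    show "linop (\<lambda>f. var i * Z i f)" by (rule linop_combine(3)[OF linop_times linop_Z])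
    fix m assume "m \<in> keys f"
    then have m: "m \<in> exponents n" by (rule exp)
    let ?a = "lookup m i"
    let ?w = "\<lambda>j. if ?a mod l = lookup m j mod l then xmon (pexp (transpose i j) m) else 0 :: 'a mpol"
    have "?S (xmon m) = (\<Sum>j<i. scale (\<Sum>r<l. (\<zeta> ^ r) ^ ?a * inverse (\<zeta> ^ r) ^ lookup m j) (xmon (pexp (transpose i j) m)))"
      using i by (intro sum.cong) (auto intro!: poly_mapping_eqI simp: act_refl[OF i _ _ zeta_nonzero m] lookup_sum sum_distrib_right)
    also have "\<dots> = scale (of_nat l) (\<Sum>j<i. ?w j)"
      unfolding scale_linear(10) by (intro sum.cong) (auto simp: sum_zeta_quotient scale_algebra)
    finally have S: "?S (xmon m) = scale (of_nat l) (\<Sum>j<i. ?w j)" .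
    have "(\<Sum>j\<in>{0..<n} - {i}. ladder l (Suc ?a) i j m) =
        (\<Sum>j\<in>{0..<n} - {i}. ladder l (cmp i j m) i j m + (if j < i then ?w j else 0))"
      by (intro sum.cong) (auto simp: cmp_def ladder_Suc[OF l_pos])
    also have "\<dots> = (\<Sum>j\<in>{0..<n} - {i}. ladder l (cmp i j m) i j m) + (\<Sum>j<i. ?w j)"
      unfolding sum.distrib using i
      by (intro arg_cong2[where f = "(+)"] refl sum.mono_neutral_cong_right) auto
    finally have L: "(\<Sum>j\<in>{0..<n} - {i}. ladder l (Suc ?a) i j m) = \<dots>" .
    have "(\<Sum>j\<in>{0..<n} - {i}. ladder l (Suc ?a) i j (m + eps i)) = var i * (\<Sum>j\<in>{0..<n} - {i}. ladder l (Suc ?a) i j m :: 'a mpol)"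
      unfolding sum_distrib_left by (intro sum.cong) (auto simp: ladder_mult_source)
    then have "XY i (var i * xmon m) = var i * (scale (of_nat (Suc ?a) - dd (Suc ?a)) (xmon m)
        - scale (of_nat l * c0) (\<Sum>j\<in>{0..<n} - {i}. ladder l (Suc ?a) i j m))"
      by (simp add: var_mult_xmon XY_def xy_mon_def lookup_add right_diff_distrib scale_times(1) del: of_nat_Suc)
    then show "XY i (var i * xmon m) + var i * scale c0 (?S (xmon m)) = var i * Z i (xmon m)"
      unfolding L S by (simp add: zmon_def right_diff_distrib scale_times(1) scale_linear(1,4) distrib_left mult.commute
          del: of_nat_Suc)
  qed
  finally show ?thesis using var_nonzero mult_left_cancel by blast
qed

lemma act_zeta_iff:
  assumes i: "i < n" and f: "f \<in> poly_ring n"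
  shows "act n (zeta_mat n \<zeta> i) f = scale (\<zeta> powi (- int p)) f \<longleftrightarrow> (\<forall>\<nu>\<in>keys f. lookup \<nu> i mod l = p mod l)"
proof -
  have exp: "m \<in> exponents n" if "m \<in> keys f" for m using f that by (auto simp: poly_ring_def)
  have "act n (zeta_mat n \<zeta> i) f = lin (\<lambda>m. scale (inverse \<zeta> ^ lookup m i) (xmon m)) f"
    by (rule linop_ext[OF linop_act linop_lin]) (simp add: act_zeta[OF i zeta_nonzero exp])
  then have look: "lookup (act n (zeta_mat n \<zeta> i) f) \<nu> = lookup f \<nu> * inverse \<zeta> ^ lookup \<nu> i" for \<nu>
    by (simp add: lookup_lin lookup_xmon if_distrib in_keys_iff cong: if_cong)
  have "inverse \<zeta> ^ lookup \<nu> i = \<zeta> powi (- int p) \<longleftrightarrow> lookup \<nu> i mod l = p mod l" for \<nu>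
    by (simp add: power_int_minus power_inverse zeta_power_eq_iff)
  then have "lookup f \<nu> * inverse \<zeta> ^ lookup \<nu> i = \<zeta> powi (- int p) * lookup f \<nu>
      \<longleftrightarrow> (\<nu> \<in> keys f \<longrightarrow> lookup \<nu> i mod l = p mod l)" for \<nu>
    by (auto simp: in_keys_iff)
  then show ?thesis by (auto simp: poly_mapping_eq_iff fun_eq_iff look)
qed

lemma eig_iff:
  "eig \<mu> f \<longleftrightarrow> f \<in> poly_ring n \<and> (\<forall>i<n. let m = lookup \<mu> i in
     act n (zeta_mat n \<zeta> i) f = scale (\<zeta> powi (- int m)) f \<and>
     z_op l n \<zeta> c0 d i f = scale (of_nat m + 1 - (d 0 - d (- int m - 1))
       - of_nat l * c0 * of_nat (w_perm n \<mu> i)) f)"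
proof -
  have "wt i \<mu> = of_nat (lookup \<mu> i) + 1 - (d 0 - d (- int (lookup \<mu> i) - 1)) - of_nat l * c0 * of_nat (w_perm n \<mu> i)" for i
  proof -
    have "- int (Suc (lookup \<mu> i)) = - int (lookup \<mu> i) - 1" by simp
    then show ?thesis by (simp only: wt_def dd_def w_perm_rk of_nat_Suc add.commute)
  qed
  then show ?thesis
    by (cases "f \<in> poly_ring n") (auto simp: eig_def Let_def act_zeta_iff z_op_Z)
qed

end

section \<open>Specialisation of Jack polynomials\<close>

definition mapc :: "('a::zero \<Rightarrow> 'b::zero) \<Rightarrow> 'a mpol \<Rightarrow> 'b mpol" where
  "mapc h f = Poly_Mapping.map h f"

context comm_ring_hom
begin

lemma lookup_mapc [simp]: "lookup (mapc hom f) m = hom (lookup f m)"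
  by (simp add: mapc_def Poly_Mapping.map.rep_eq when_def)

lemma keys_mapc: "keys (mapc hom f) \<subseteq> keys f"
  by (auto simp: in_keys_iff)

lemma mapc_linear:
  "mapc hom (f + g) = mapc hom f + mapc hom g" "mapc hom (f - g) = mapc hom f - mapc hom g"
  "mapc hom (- f) = - mapc hom f" "mapc hom 0 = 0" "mapc hom (xmon m) = xmon m"
  "mapc hom (scale a f) = scale (hom a) (mapc hom f)" "mapc hom (sum F S) = (\<Sum>x\<in>S. mapc hom (F x))"
  by (rule poly_mapping_eqI; simp add: lookup_add lookup_minus lookup_sum lookup_xmon hom_distribs)+

lemma mapc_ladder: "mapc hom (ladder l A i j \<mu>) = ladder l A i j \<mu>"
  by (simp add: ladder_def mapc_linear)

lemma mapc_lin: "mapc hom (lin g f) = lin (\<lambda>m. mapc hom (g m)) (mapc hom f)"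
  using lin_superset[OF finite_keys keys_mapc, of "\<lambda>m. mapc hom (g m)" f]
  by (simp add: lin_def mapc_linear)

end

text \<open>Used for two homomorphisms out of the polynomials in \<open>c0\<close>: the embedding
  into rational functions and the evaluation at a number. The closed form of \<open>Z\<close> has no
  denominators, so it passes along both.\<close>

locale z_operators_hom = A: z_operators l n c0 dd + B: z_operators l n c0' dd' + comm_ring_hom hom
  for l n :: nat and c0 :: "'a::idom" and dd and c0' :: "'b::idom" and dd' and hom :: "'a \<Rightarrow> 'b" +
  assumes c0': "c0' = hom c0" and dd': "\<And>p. dd' p = hom (dd p)"
begin

lemma mapc_Z: "mapc hom (A.Z i f) = B.Z i (mapc hom f)"
proof -
  have "mapc hom (A.zmon i \<mu>) = B.zmon i \<mu>" for \<mu>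
    unfolding A.zmon_def B.zmon_def A.cmp_def B.cmp_def
    by (simp add: mapc_linear mapc_ladder c0' dd' hom_distribs)
  then show ?thesis by (simp add: A.Z_def B.Z_def mapc_lin)
qed

lemma hom_wt: "hom (A.wt i \<mu>) = B.wt i \<mu>"
  unfolding A.wt_def B.wt_def by (simp add: c0' dd' hom_distribs)

end

lemma rk_Suc:
  assumes "Suc i < n" "lookup \<mu> i = lookup \<mu> (Suc i)"
  shows "rk n \<mu> i = Suc (rk n \<mu> (Suc i))"
proof -
  have code: "code n \<mu> i = Suc (code n \<mu> (Suc i))" using assms by (simp add: code_def)
  have "{b. b < n \<and> code n \<mu> b < code n \<mu> i} = insert (Suc i) {b. b < n \<and> code n \<mu> b < code n \<mu> (Suc i)}"
    using assms(1) code_eq_iff[of _ n "Suc i" \<mu>] by (auto simp: code less_Suc_eq)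
  then show ?thesis using assms(1) by (simp add: rk_def)
qed

text \<open>The ranks of equal neighbours are consecutive, which makes \<open>- 1\<close> the right
  coefficient. The difference \<open>perm s f - f\<close> is then a joint eigenvector for the
  exchanged weights, and \<open>no\<close> forbids it a leading exponent.\<close>

lemma (in z_operators) eig_swap_equal:
  assumes i: "Suc i < n" and eq: "lookup \<mu> i = lookup \<mu> (Suc i)" and f: "eig \<mu> f"
    and no: "\<And>\<nu>. \<nu> \<in> exponents n \<Longrightarrow> (\<And>a. a < n \<Longrightarrow> lookup \<nu> a mod l = lookup \<mu> a mod l) \<Longrightarrow>
      (\<And>a. a < n \<Longrightarrow> wt a \<nu> = wt (transpose i (Suc i) a) \<mu>) \<Longrightarrow> False"
  shows "perm (transpose i (Suc i)) f = f"
proof (rule ccontr)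
  let ?s = "transpose i (Suc i)"
  let ?g = "perm ?s f + scale (- 1) f"
  assume "perm ?s f \<noteq> f"
  moreover have "scale (- 1) f = - f" by (rule poly_mapping_eqI) simp
  ultimately have ne: "?g \<noteq> 0" by simp
  have "- 1 * (wt i \<mu> - wt (Suc i) \<mu>) = of_nat l * c0"
    using rk_Suc[OF i eq] eq by (simp add: wt_def algebra_simps)
  then have e: "if lookup \<mu> i mod l = lookup \<mu> (Suc i) mod l
      then - 1 * (wt i \<mu> - wt (Suc i) \<mu>) = of_nat l * c0 else - 1 = (0 :: 'a)" using eq by simp
  note g = Z_swap_intertwiner[OF i f e]
  obtain \<nu> where \<nu>: "\<nu> \<in> keys ?g" "\<And>\<rho>. \<rho> \<in> keys ?g \<Longrightarrow> energy n \<rho> \<le> energy n \<nu>"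
    using leading_exponent[OF ne] by blast
  show False
  proof (rule no)
    show "\<nu> \<in> exponents n" using g(1) \<nu>(1) by (auto simp: poly_ring_def)
    show "lookup \<nu> a mod l = lookup \<mu> a mod l" if "a < n" for a
      using g(3)[OF \<nu>(1) that] eq by (auto simp: transpose_def split: if_splits)
    show "wt a \<nu> = wt (?s a) \<mu>" if "a < n" for a
      using leading_weight[OF g(1) that g(2)[OF that] \<nu>] by simp
  qed
qed

lemma to_fract_hom: "comm_ring_hom (to_fract :: 'a::idom \<Rightarrow> 'a fract)"
  by unfold_locales simp_all

lemma poly_eval_hom: "comm_ring_hom (\<lambda>p :: 'a::comm_ring_1 poly. poly p a)"
  by unfold_locales simp_all

lemma common_denominator:
  fixes f :: "'a::idom fract mpol"
  shows "\<exists>b F. b \<noteq> 0 \<and> (\<forall>m. to_fract (lookup F m) = to_fract b * lookup f m)"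
proof -
  have "\<exists>u v. v \<noteq> 0 \<and> lookup f m = Fraction_Field.Fract u v" for m
    by (cases "lookup f m" rule: Fract_cases) auto
  then obtain u v where uv: "\<And>m. v m \<noteq> 0 \<and> lookup f m = Fraction_Field.Fract (u m) (v m)" by metis
  define b where "b = (\<Prod>m\<in>keys f. v m)"
  define F where "F = (\<Sum>m\<in>keys f. scale (u m * (\<Prod>m'\<in>keys f - {m}. v m')) (xmon m) :: 'a mpol)"
  have "to_fract (lookup F m) = to_fract b * lookup f m" for m
  proof (cases "m \<in> keys f")
    case True
    have "lookup F m = u m * (\<Prod>m'\<in>keys f - {m}. v m')"
      using True by (simp add: F_def lookup_sum lookup_xmon if_distrib cong: if_cong)
    moreover have "b = v m * (\<Prod>m'\<in>keys f - {m}. v m')"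
      unfolding b_def using True by (intro prod.remove) auto
    moreover have "to_fract (v m) * lookup f m = to_fract (u m)"
      using uv[of m] by (simp add: to_fract_def eq_fract)
    ultimately show ?thesis by (simp add: mult.commute mult.left_commute)
  next
    case False
    then have "lookup F m = 0" by (auto simp: F_def lookup_sum lookup_xmon intro!: sum.neutral)
    then show ?thesis using False by (simp add: in_keys_iff)
  qed
  moreover have "b \<noteq> 0" using uv by (simp add: b_def)
  ultimately show ?thesis by blast
qed

section \<open>Generic Jack polynomials and their value at a number\<close>

locale jack_setting =
  fixes l n :: nat and \<zeta> c0 :: complex and d :: "int \<Rightarrow> complex"
  assumes l1: "1 \<le> l" and n0: "0 < n" and zeta_root: "\<zeta> ^ l = 1"
    and zeta_primitive: "\<And>t. 0 < t \<Longrightarrow> t < l \<Longrightarrow> \<zeta> ^ t \<noteq> 1" and d_periodic: "\<And>i. d (i + int l) = d i"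
begin

lemma ratfun_const_to_fract: "ratfun_const a = to_fract [:a:]"
  by (simp add: ratfun_const_def to_fract_def)

lemma ratfun_indet_to_fract: "ratfun_indet = to_fract [:0, 1:]"
  by (simp add: ratfun_indet_def to_fract_def)

sublocale C: dunkl_field l n \<zeta> c0 d
  using l1 n0 zeta_root zeta_primitive d_periodic by unfold_locales auto

sublocale K: dunkl_field l n "ratfun_const \<zeta>" ratfun_indet "\<lambda>i. ratfun_const (d i)"
proof
  have pow: "ratfun_const \<zeta> ^ t = to_fract [:\<zeta> ^ t:]" for t
  proof (induction t)
    case 0
    show ?case by (simp flip: one_pCons)
  next
    case (Suc t)
    then show ?case by (simp add: ratfun_const_to_fract flip: to_fract_mult)
  qed
  show "ratfun_const \<zeta> ^ l = 1" unfolding pow by (simp add: zeta_root flip: one_pCons)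
  show "ratfun_const \<zeta> ^ t \<noteq> 1" if "0 < t" "t < l" for t
  proof
    assume "ratfun_const \<zeta> ^ t = 1"
    then have "to_fract [:\<zeta> ^ t:] = to_fract [:1:]" unfolding pow by (simp flip: one_pCons)
    then show False using zeta_primitive[OF that] by simp
  qed
  have "(of_nat l :: complex poly fract) = to_fract (of_nat l)"
    by (induction l) simp_all
  then show "(of_nat l :: complex poly fract) \<noteq> 0" using l1 by simp
qed (use l1 n0 d_periodic in auto)

sublocale R: z_operators l n "[:0, 1:]" "\<lambda>p. [:C.dd p:]"
proof
  show "[:C.dd a:] = [:C.dd b:]" if "a mod l = b mod l" for a b using C.dd[OF that] by simp
qed (rule l1)

sublocale RK: z_operators_hom l n "[:0, 1:]" "\<lambda>p. [:C.dd p:]" ratfun_indet K.dd to_fract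
proof (intro z_operators_hom.intro z_operators_hom_axioms.intro)
  show "K.dd p = to_fract [:C.dd p:]" for p
    unfolding K.dd_def C.dd_def by (simp add: ratfun_const_to_fract flip: to_fract_diff)
qed (fact R.z_operators_axioms K.z_operators_axioms to_fract_hom ratfun_indet_to_fract)+

text \<open>At \<open>c0 = 0\<close> a weight reduces to the entry plus 1 minus a term that depends
  on the residue only, so generic weights determine the entries. Admitting another index
  \<open>b\<close> with the same entry makes room for exchanged weights.\<close>

lemma generic_exponent:
  assumes "\<mu> \<in> exponents n" "\<nu> \<in> exponents n"
    and res: "\<And>a. a < n \<Longrightarrow> lookup \<nu> a mod l = lookup \<mu> a mod l"
    and wt: "\<And>a. a < n \<Longrightarrow> \<exists>b<n. lookup \<mu> b = lookup \<mu> a \<and> K.wt a \<nu> = K.wt b \<mu>"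
  shows "\<nu> = \<mu>"
proof (rule exponents_eqI[OF assms(2,1)])
  fix a assume a: "a < n"
  then obtain b where b: "lookup \<mu> b = lookup \<mu> a" "K.wt a \<nu> = K.wt b \<mu>" using wt by blast
  then have "R.wt a \<nu> = R.wt b \<mu>" by (simp flip: RK.hom_wt)
  then have "poly (R.wt a \<nu>) 0 = poly (R.wt b \<mu>) 0" by simp
  moreover have "Suc (lookup \<nu> a) mod l = Suc (lookup \<mu> a) mod l" using res[OF a] by (metis mod_Suc_eq)
  then have "C.dd (Suc (lookup \<nu> a)) = C.dd (Suc (lookup \<mu> a))" by (rule C.dd)
  ultimately show "lookup \<nu> a = lookup \<mu> a" by (simp add: R.wt_def b(1))
qed

lemma K_isolated: "\<mu> \<in> exponents n \<Longrightarrow> K.isolated \<mu>"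
  unfolding K.isolated_def
proof (intro conjI ballI impI)
  fix \<nu> assume \<mu>: "\<mu> \<in> exponents n" and "\<nu> \<in> exponents n"
    and "\<forall>i<n. lookup \<nu> i mod l = lookup \<mu> i mod l \<and> K.wt i \<nu> = K.wt i \<mu>"
  then show "\<nu> = \<mu>" by (intro generic_exponent) auto
qed simp

lemma jack_eig:
  assumes \<mu>: "\<mu> \<in> exponents n"
  shows "K.eig \<mu> (jack l n \<zeta> d \<mu>)" "lookup (jack l n \<zeta> d \<mu>) \<mu> = 1"
proof -
  have jack: "jack l n \<zeta> d \<mu> = (THE f. K.eig \<mu> f \<and> lookup f \<mu> = 1)"
    unfolding jack_def Let_def K.eig_iff by (rule arg_cong[where f = The]) auto
  obtain f where f: "K.eig \<mu> f" "lookup f \<mu> = 1" using K.eig_exists[OF K_isolated \<mu>] by blast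
  have "K.eig \<mu> (jack l n \<zeta> d \<mu>) \<and> lookup (jack l n \<zeta> d \<mu>) \<mu> = 1"
    unfolding jack
  proof (rule theI)
    show "K.eig \<mu> f \<and> lookup f \<mu> = 1" using f by simp
    fix g assume "K.eig \<mu> g \<and> lookup g \<mu> = 1"
    then show "g = f" using K.eig_unique[OF K_isolated[OF \<mu>] f(1) _ f(2), of g] by (simp add: scale_algebra)
  qed
  then show "K.eig \<mu> (jack l n \<zeta> d \<mu>)" "lookup (jack l n \<zeta> d \<mu>) \<mu> = 1" by auto
qed

lemma jack_symmetric:
  assumes \<mu>: "\<mu> \<in> exponents n" and i: "Suc i < n" and eq: "lookup \<mu> i = lookup \<mu> (Suc i)"
  shows "perm (transpose i (Suc i)) (jack l n \<zeta> d \<mu>) = jack l n \<zeta> d \<mu>"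
proof (rule K.eig_swap_equal[OF i eq jack_eig(1)[OF \<mu>]])
  let ?s = "transpose i (Suc i)"
  fix \<nu> assume \<nu>: "\<nu> \<in> exponents n" "\<And>a. a < n \<Longrightarrow> lookup \<nu> a mod l = lookup \<mu> a mod l"
    "\<And>a. a < n \<Longrightarrow> K.wt a \<nu> = K.wt (?s a) \<mu>"
  have "\<nu> = \<mu>"
  proof (rule generic_exponent[OF \<mu> \<nu>(1,2)])
    show "\<exists>b<n. lookup \<mu> b = lookup \<mu> a \<and> K.wt a \<nu> = K.wt b \<mu>" if "a < n" for a
      using \<nu>(3)[OF that] that i eq by (intro exI[of _ "?s a"]) (auto simp: transpose_def)
  qed
  then have "K.wt i \<mu> = K.wt (Suc i) \<mu>" using \<nu>(3)[of i] i by simp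
  \<comment> \<open>At \<open>c0 = 1\<close> these weights differ by \<open>l\<close>, as the ranks
    of equal neighbours are consecutive.\<close>
  then have "poly (R.wt i \<mu>) 1 = poly (R.wt (Suc i) \<mu>) 1" by (simp flip: RK.hom_wt)
  then show False using rk_Suc[OF i eq] l1 eq by (simp add: R.wt_def)
qed

text \<open>A common denominator of least degree does not vanish at \<open>c0\<close>: otherwise the specialised
  numerator would be an eigenvector whose coefficient at its own leading exponent vanishes.\<close>

lemma specialize_eig:
  assumes iso: "C.isolated \<mu>" and f: "K.eig \<mu> f" "lookup f \<mu> = 1"
  shows "C.eig \<mu> (specialize c0 f)" "lookup (specialize c0 f) \<mu> = 1"
proof -
  let ?ev = "\<lambda>p. poly p c0"
  interpret RC: z_operators_hom l n "[:0, 1:]" "\<lambda>p. [:C.dd p:]" c0 C.dd ?ev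
    by (intro z_operators_hom.intro z_operators_hom_axioms.intro)
      (fact R.z_operators_axioms C.z_operators_axioms poly_eval_hom | simp)+
  let ?den = "\<lambda>b F. b \<noteq> 0 \<and> (\<forall>m. to_fract (lookup F m) = to_fract b * lookup f m)"
  define deg where "deg = (LEAST k. \<exists>b F. ?den b F \<and> degree b = k)"
  have "\<exists>k b F. ?den b F \<and> degree b = k" using common_denominator[of f] by blast
  then have "\<exists>b F. ?den b F \<and> degree b = deg" unfolding deg_def by (rule LeastI_ex)
  then obtain b F where b: "b \<noteq> 0" "degree b = deg" and F: "\<And>m. to_fract (lookup F m) = to_fract b * lookup f m"
    by blast
  have mapF: "mapc to_fract F = scale (to_fract b) f" by (rule poly_mapping_eqI) (simp add: F)
  have keysF: "keys F = keys f"
  proof -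
    have zero_iff: "lookup F m = 0 \<longleftrightarrow> lookup f m = 0" for m 
    proof -
      have "to_fract (lookup F m) = 0 \<longleftrightarrow> lookup f m = 0" unfolding F using b(1) by simp
      then show ?thesis by simp
    qed
    show ?thesis by (rule Set.set_eqI) (simp add: in_keys_iff zero_iff)
  qed
  have "R.Z i F = scale (R.wt i \<mu>) F" if "i < n" for i
  proof -
    have "mapc to_fract (R.Z i F) = K.Z i (scale (to_fract b) f)" by (simp add: RK.mapc_Z mapF)
    also have "\<dots> = scale (to_fract (R.wt i \<mu>)) (mapc to_fract F)"
      using f(1) that by (simp add: K.eig_def linopD[OF K.linop_Z] RK.hom_wt mapF scale_algebra mult.commute)
    also have "\<dots> = mapc to_fract (scale (R.wt i \<mu>) F)" by (simp add: RK.mapc_linear)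
    finally have "to_fract (lookup (R.Z i F) m) = to_fract (lookup (scale (R.wt i \<mu>) F) m)" for m
      by (metis RK.lookup_mapc)
    then show ?thesis unfolding to_fract_eq_iff by (rule poly_mapping_eqI)
  qed
  then have Z: "C.Z i (mapc ?ev F) = scale (C.wt i \<mu>) (mapc ?ev F)" if "i < n" for i
    using that unfolding RC.mapc_Z[symmetric] RC.hom_wt[symmetric] by (simp only: RC.mapc_linear)
  have eig: "C.eig \<mu> (mapc ?ev F)"
    using f(1) RC.keys_mapc[of F] Z by (auto simp: C.eig_def K.eig_def poly_ring_def keysF)
  \<comment> \<open>Since \<open>f\<close> has coefficient 1 at \<open>\<mu>\<close>, the numerator
    has the denominator as its coefficient there.\<close>
  have "lookup F \<mu> = b" using F[of \<mu>] f(2) by simp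
  have nz: "poly b c0 \<noteq> 0"
  proof
    assume b0: "poly b c0 = 0"
    have "mapc ?ev F = 0"
      by (rule C.eig_eq_0[OF iso eig]) (simp add: \<open>lookup F \<mu> = b\<close> b0)
    then have "poly (lookup F m) c0 = 0" for m using RC.lookup_mapc[of F m] by simp
    moreover define q where "q = [:- c0, 1:]"
    ultimately have dvd: "q dvd lookup F m" for m by (simp add: poly_eq_0_iff_dvd)
    obtain b' where b': "b = q * b'" using b0 by (auto simp: poly_eq_0_iff_dvd q_def)
    have q: "to_fract q \<noteq> 0" by (simp add: q_def)
    \<comment> \<open>Cancelling the linear factor \<open>q\<close> from numerator and denominator
      contradicts the minimal degree of \<open>b\<close>.\<close>
    define F' where "F' = mapc (\<lambda>p. p div q) F"
    have F': "lookup F m = q * lookup F' m" for m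
      using dvd[of m] by (cases "lookup F m = 0") (simp_all add: F'_def mapc_def Poly_Mapping.map.rep_eq when_def)
    have "to_fract (lookup F' m) = to_fract b' * lookup f m" for m
    proof -
      have "to_fract q * to_fract (lookup F' m) = to_fract q * (to_fract b' * lookup f m)"
        using F[of m] unfolding b' F' to_fract_mult mult.assoc .
      then show ?thesis using q mult_left_cancel by blast
    qed
    moreover have "b' \<noteq> 0" using b(1) b' by auto
    ultimately have "deg \<le> degree b'" unfolding deg_def by (intro Least_le) blast
    moreover have "degree b = Suc (degree b')"
    proof -
      have "q \<noteq> 0" "degree q = 1" by (simp_all add: q_def)
      then show ?thesis unfolding b' using \<open>b' \<noteq> 0\<close> by (simp add: degree_mult_eq)
    qed
    ultimately show False using b(2) by simp
  qed
  have "ratfun_eval c0 (lookup f m) = poly (lookup F m) c0 / poly b c0" for m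
  proof -
    have "lookup f m = Fraction_Field.Fract (lookup F m) b"
      unfolding Fract_conv_to_fract using F[of m] b(1) by (simp add: nonzero_eq_divide_eq mult.commute)
    then show ?thesis by (simp add: ratfun_eval_Fract[OF nz])
  qed
  moreover have "lookup F m = 0" if "lookup f m = 0" for m using that F[of m] by simp
  ultimately have spec: "specialize c0 f = scale (1 / poly b c0) (mapc ?ev F)"
    by (intro poly_mapping_eqI) (auto simp: specialize_def Poly_Mapping.map.rep_eq when_def)
  show "C.eig \<mu> (specialize c0 f)" unfolding spec by (rule C.eig_scale[OF eig])
  show "lookup (specialize c0 f) \<mu> = 1" using nz by (simp add: spec \<open>lookup F \<mu> = b\<close>)
qed

end

section \<open>The submodule spanned by the admissible Jack polynomials\<close>

lemma srt_mod_neq: "x < n \<Longrightarrow> y < n \<Longrightarrow> x \<noteq> y \<Longrightarrow> srt n \<mu> x mod n \<noteq> srt n \<mu> y mod n"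
proof
  assume xy: "x < n" "y < n" "x \<noteq> y" "srt n \<mu> x mod n = srt n \<mu> y mod n"
  let ?p = "pinv (rk n \<mu>) x" and ?q = "pinv (rk n \<mu>) y"
  have "?p < n" "?q < n" using xy by simp_all
  moreover from this have "n - 1 - ?p = n - 1 - ?q" using xy(4) unfolding srt_def by (metis code_mod)
  ultimately have "?p = ?q" by linarith
  then have "rk n \<mu> ?p = rk n \<mu> ?q" by simp
  then show False using xy(3) by simp
qed

lemma srt_shift: "m < n \<Longrightarrow> srt n (shift n \<mu>) m = Suc (srt n \<mu> m)"
proof -
  assume m: "m < n"
  let ?p = "pinv (rk n \<mu>) m"
  have p: "?p < n" using m by simp
  have "rk n (shift n \<mu>) (cyc n ?p) = m" using rk_shift[OF p] by simp
  then have "srt n (shift n \<mu>) m = code n (shift n \<mu>) (cyc n ?p)" using srt_rk by metis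
  also have "\<dots> = Suc (srt n \<mu> m)" using code_shift[OF p] by (simp add: srt_def)
  finally show ?thesis .
qed

lemma gap_at_shift: "gap_at n L k (shift n \<mu>) x \<longleftrightarrow> gap_at n L k \<mu> x"
  by (auto simp: gap_at_def srt_shift)

lemma rearr_shift: "m < n \<Longrightarrow> rearr n \<mu> m \<le> rearr n (shift n \<mu>) m"
  by (simp add: rearr_srt srt_shift div_le_mono)

lemma pinv_rk_swap:
  assumes i: "Suc i < n" and ne: "lookup \<mu> i \<noteq> lookup \<mu> (Suc i)" and m: "m < n"
  shows "pinv (rk n (pexp (transpose i (Suc i)) \<mu>)) m = transpose i (Suc i) (pinv (rk n \<mu>) m)"
proof -
  let ?s = "transpose i (Suc i)"
  have "?s permutes {0..<n}" using i by (intro transpose_permutes) auto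
  then have "?s (pinv (rk n \<mu>) m) < n"
    using m permutes_in_image[of ?s "{0..<n}" "pinv (rk n \<mu>) m"] by simp
  then have "rk n (pexp ?s \<mu>) (?s (pinv (rk n \<mu>) m)) = m" using rk_swap[OF i ne] by simp
  then show ?thesis using rk_inv(2) by metis
qed

lemma rearr_swap:
  assumes i: "Suc i < n" and ne: "lookup \<mu> i \<noteq> lookup \<mu> (Suc i)" and m: "m < n"
  shows "rearr n (pexp (transpose i (Suc i)) \<mu>) m = rearr n \<mu> m"
  using m by (simp add: rearr_inv_rk pinv_rk_swap[OF i ne m])

text \<open>Exchanged entries keep their ranks and only trade positions, so one sorted code falls by
  one and the other rises by one. The additive form avoids truncated subtraction.\<close>

lemma srt_swap:
  assumes i: "Suc i < n" and ne: "lookup \<mu> i \<noteq> lookup \<mu> (Suc i)" and m: "m < n"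
  defines "\<nu> \<equiv> pexp (transpose i (Suc i)) \<mu>"
  shows "srt n \<nu> m + (if m = rk n \<mu> i then 1 else 0) = srt n \<mu> m + (if m = rk n \<mu> (Suc i) then 1 else 0)"
proof -
  let ?p = "pinv (rk n \<mu>) m"
  have p: "?p < n" using m by simp
  have eq: "m = rk n \<mu> a \<longleftrightarrow> ?p = a" for a by (metis rk_inv)
  have "srt n \<nu> m = n * lookup \<mu> ?p + (n - 1 - transpose i (Suc i) ?p)"
    unfolding \<nu>_def srt_def pinv_rk_swap[OF i ne m] by (simp add: code_def)
  moreover have "srt n \<mu> m = n * lookup \<mu> ?p + (n - 1 - ?p)" by (simp add: srt_def code_def)
  ultimately show ?thesis using i p unfolding eq by (auto simp: transpose_def)
qed

text \<open>Unless both ends move towards each other, a gap shrinks by at most one. Strictness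
  survives because equality is impossible: sorted codes have distinct residues modulo
  \<open>n\<close>, and \<open>n * L\<close> has residue 0.\<close>

lemma gap_at_swap:
  assumes i: "Suc i < n" and ne: "lookup \<mu> i \<noteq> lookup \<mu> (Suc i)" and k: "2 \<le> k"
    and gap: "gap_at n L k \<mu> x"
    and not: "\<not> (x = rk n \<mu> (Suc i) \<and> x + (k - 1) = rk n \<mu> i)"
  shows "gap_at n L k (pexp (transpose i (Suc i)) \<mu>) x"
  unfolding gap_at_def
proof
  let ?\<nu> = "pexp (transpose i (Suc i)) \<mu>"
  assume x: "x + (k - 1) < n"
  have "srt n \<mu> x + n * L < srt n \<mu> (x + (k - 1))" using gap x by (simp add: gap_at_def)
  moreover have "srt n ?\<nu> x + n * L \<noteq> srt n ?\<nu> (x + (k - 1))"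
    using srt_mod_neq[of x n "x + (k - 1)" ?\<nu>] x k by (metis mod_mult_self2 add_lessD1 add_cancel_right_right
      diff_is_0_eq not_less_eq_eq numeral_2_eq_2 One_nat_def)
  ultimately show "srt n ?\<nu> x + n * L < srt n ?\<nu> (x + (k - 1))"
    using srt_swap[OF i ne, of x] srt_swap[OF i ne, of "x + (k - 1)"] x not by (auto split: if_splits)
qed

lemma perm_specialize: "bij \<pi> \<Longrightarrow> perm \<pi> (specialize a f) = specialize a (perm \<pi> f)"
proof (rule poly_mapping_eqI)
  fix m assume b: "bij \<pi>"
  have m: "pexp \<pi> (pexp (pinv \<pi>) m) = m"
    using b by (simp add: pexp_comp bij_imp_bij_inv surj_iff[THEN iffD1] bij_is_surj)
  show "lookup (perm \<pi> (specialize a f)) m = lookup (specialize a (perm \<pi> f)) m"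
    using lookup_perm[OF b, of "specialize a f" "pexp (pinv \<pi>) m"] lookup_perm[OF b, of f "pexp (pinv \<pi>) m"]
    by (simp add: m specialize_def Poly_Mapping.map.rep_eq)
qed

lemma span_closed:
  assumes "linop A" "\<And>x. x \<in> B \<Longrightarrow> A x \<in> mpol.span B" "f \<in> mpol.span B"
  shows "A f \<in> mpol.span B"
  using assms(3)
proof (rule mpol.span_induct)
  show "mpol.subspace {f. A f \<in> mpol.span B}"
    by (auto simp: mpol.subspace_def linopD[OF assms(1)] mpol.span_zero mpol.span_add mpol.span_scale)
qed (use assms(2) in auto)

lemma poly_ring_subspace: "mpol.subspace (poly_ring n)"
  by (auto simp: mpol.subspace_def poly_ring_closed)

text \<open>In contrast to \<open>Z\<close>, the threshold of \<open>XY i\<close> is the same on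
  both sides of \<open>i\<close>, so all permutations are respected without a correction
  term.\<close>

lemma (in z_operators) perm_XY:
  assumes \<pi>: "\<pi> permutes {0..<n}" and i: "i < n"
  shows "perm \<pi> (XY i f) = XY (\<pi> i) (perm \<pi> f)"
proof (rule linop_ext[OF linop_combine(3)[OF linop_perm linop_XY] linop_combine(3)[OF linop_XY linop_perm]])
  fix \<mu>
  have b: "bij \<pi>" by (rule permutes_bij[OF \<pi>])
  have "(\<Sum>j\<in>{0..<n} - {i}. ladder l (lookup \<mu> i) (\<pi> i) (\<pi> j) (pexp \<pi> \<mu>)) =
      (\<Sum>j\<in>{0..<n} - {\<pi> i}. ladder l (lookup \<mu> i) (\<pi> i) j (pexp \<pi> \<mu>) :: 'a mpol)"
  proof (rule sum.reindex_bij_betw)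
    have "bij_betw \<pi> {0..<n} {0..<n}" by (rule permutes_imp_bij[OF \<pi>])
    then show "bij_betw \<pi> ({0..<n} - {i}) ({0..<n} - {\<pi> i})" using i permutes_in_image[OF \<pi>, of i] by (intro bij_betw_DiffI) auto
  qed
  then show "perm \<pi> (XY i (xmon \<mu>)) = XY (\<pi> i) (perm \<pi> (xmon \<mu>))"
    by (simp add: XY_def xy_mon_def linopD[OF linop_perm] perm_ladder[OF b] lookup_pexp'[OF b])
qed

lemma G_group_mmat:
  assumes \<sigma>: "\<sigma> permutes {0..<n}" and c: "\<And>a. a < n \<Longrightarrow> c a ^ l = 1" and l: "1 \<le> l"
  shows "mmat n \<sigma> c \<in> G_group l n"
proof -
  have nz: "c a \<noteq> 0" if "a < n" for a using c[OF that] l by (auto simp: power_0_left)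
  have in_n: "\<sigma> a < n \<longleftrightarrow> a < n" for a using permutes_in_image[OF \<sigma>, of a] by simp
  have "\<exists>!b. b < n \<and> mmat n \<sigma> c $$ (a, b) \<noteq> 0" if a: "a < n" for a
  proof (rule ex1I[of _ "\<sigma> a"])
    show "\<sigma> a < n \<and> mmat n \<sigma> c $$ (a, \<sigma> a) \<noteq> 0" using a in_n[of a] nz[OF a] by (simp add: mmat_index)
    fix b assume "b < n \<and> mmat n \<sigma> c $$ (a, b) \<noteq> 0"
    then show "b = \<sigma> a" using a by (metis mmat_index)
  qed
  moreover have "\<exists>!a. a < n \<and> mmat n \<sigma> c $$ (a, b) \<noteq> 0" if b: "b < n" for b
  proof (rule ex1I[of _ "pinv \<sigma> b"])
    have "pinv \<sigma> b < n" using permutes_in_image[OF permutes_inv[OF \<sigma>], of b] b by simp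
    then show "pinv \<sigma> b < n \<and> mmat n \<sigma> c $$ (pinv \<sigma> b, b) \<noteq> 0"
      using b nz by (simp add: mmat_index permutes_inverses[OF \<sigma>])
    fix a assume "a < n \<and> mmat n \<sigma> c $$ (a, b) \<noteq> 0"
    then have "b = \<sigma> a" using b by (metis mmat_index)
    then show "a = pinv \<sigma> b" by (simp add: permutes_inverses[OF \<sigma>])
  qed
  moreover have "mmat n \<sigma> c $$ (a, b) ^ l = 1" if "a < n" "b < n" "mmat n \<sigma> c $$ (a, b) \<noteq> 0" for a b
    using that c by (auto simp: mmat_index split: if_splits)
  ultimately show ?thesis by (simp add: G_group_def)
qed

lemma G_group_cases:
  assumes w: "w \<in> G_group l n"
  obtains \<sigma> c where "\<sigma> permutes {0..<n}" "\<And>a. a < n \<Longrightarrow> c a ^ l = 1" "\<And>a. a < n \<Longrightarrow> c a \<noteq> 0" "w = mmat n \<sigma> c"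
proof -
  from w have car: "w \<in> carrier_mat n n"
    and row: "\<And>a. a < n \<Longrightarrow> \<exists>!b. b < n \<and> w $$ (a, b) \<noteq> 0"
    and col: "\<And>b. b < n \<Longrightarrow> \<exists>!a. a < n \<and> w $$ (a, b) \<noteq> 0"
    and ent: "\<And>a b. a < n \<Longrightarrow> b < n \<Longrightarrow> w $$ (a, b) \<noteq> 0 \<Longrightarrow> w $$ (a, b) ^ l = 1"
    by (auto simp: G_group_def)
  define \<sigma> where "\<sigma> a = (if a < n then THE b. b < n \<and> w $$ (a, b) \<noteq> 0 else a)" for a
  have \<sigma>: "\<sigma> a < n \<and> w $$ (a, \<sigma> a) \<noteq> 0" if "a < n" for a
    using theI'[OF row[OF that]] that by (simp add: \<sigma>_def)
  have \<sigma>_eq: "b = \<sigma> a" if "a < n" "b < n" "w $$ (a, b) \<noteq> 0" for a b using row[OF that(1)] \<sigma>[OF that(1)] that by blast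
  have "\<sigma> permutes {0..<n}"
  proof (rule bij_imp_permutes)
    have "inj_on \<sigma> {0..<n}"
    proof (rule inj_onI)
      fix a b assume "a \<in> {0..<n}" "b \<in> {0..<n}" "\<sigma> a = \<sigma> b"
      then show "a = b" using \<sigma>[of a] \<sigma>[of b] col[of "\<sigma> a"] by auto
    qed
    moreover have "\<sigma> ` {0..<n} \<subseteq> {0..<n}" using \<sigma> by auto
    ultimately show "bij_betw \<sigma> {0..<n} {0..<n}" by (simp add: bij_betw_def endo_inj_surj)
  qed (simp add: \<sigma>_def)
  moreover have "w = mmat n \<sigma> (\<lambda>a. w $$ (a, \<sigma> a))"
    by (rule eq_matI) (use car \<sigma>_eq in \<open>auto simp: mmat_index\<close>)
  ultimately show thesis using that[of \<sigma> "\<lambda>a. w $$ (a, \<sigma> a)"] \<sigma> ent by blast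
qed

lemma monchar_cong_mod:
  assumes "m \<in> exponents n" "\<mu> \<in> exponents n" "\<And>a. a < n \<Longrightarrow> lookup m a mod l = lookup \<mu> a mod l"
    and c: "\<And>a. a < n \<Longrightarrow> c a ^ l = 1"
  shows "monchar c m = monchar c \<mu>"
proof -
  have *: "monchar c m = (\<Prod>a\<in>{0..<n}. c a ^ (lookup m a mod l))" if "m \<in> exponents n" for m
  proof -
    have pow: "c a ^ (s mod l) = c a ^ s" if "a < n" for a s
    proof -
      have "c a ^ s = c a ^ (l * (s div l) + s mod l)" by simp
      also have "\<dots> = c a ^ (s mod l)" by (simp only: power_add power_mult c[OF that] power_one mult_1)
      finally show ?thesis by simp
    qed
    have "monchar c m = (\<Prod>a\<in>{0..<n}. c a ^ lookup m a)"
      unfolding monchar_def using that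
      by (intro prod.mono_neutral_left) (auto simp: exponents_def in_keys_iff)
    also have "\<dots> = (\<Prod>a\<in>{0..<n}. c a ^ (lookup m a mod l))" using pow by (intro prod.cong) auto
    finally show ?thesis .
  qed
  show ?thesis using *[OF assms(1)] *[OF assms(2)] assms(3) by simp
qed

section \<open>The admissible exponents at \<open>c0 = j / k\<close> and the intertwiners on
  them\<close>

locale socle_setting = jack_setting l n \<zeta> c0 d for l n :: nat and \<zeta> c0 :: complex and d +
  fixes j k :: nat
  assumes j0: "0 < j" and jk: "coprime j k" and k2: "2 \<le> k" and kn: "k \<le> n"
    and c0: "c0 = of_nat j / of_nat k"
begin

definition E :: "(nat \<Rightarrow>\<^sub>0 nat) \<Rightarrow> complex mpol" where "E \<mu> = specialize c0 (jack l n \<zeta> d \<mu>)"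

definition low :: "(nat \<Rightarrow>\<^sub>0 nat) \<Rightarrow> bool" where
  "low \<mu> \<longleftrightarrow> (\<forall>m p :: nat. m \<le> n - 1 \<and> p > 0 \<and> \<not> l dvd p \<and>
     d 0 - d (- int p) + of_nat l * of_nat m * c0 = of_nat p \<longrightarrow> rearr n \<mu> m \<ge> p)"

definition A :: "(nat \<Rightarrow>\<^sub>0 nat) set" where
  "A = {\<mu> \<in> exponents n. admissible n (l * j) k \<mu> \<and> low \<mu>}"

definition S :: "complex mpol set" where "S = mpol.span (E ` A)"

abbreviation sw :: "nat \<Rightarrow> nat \<Rightarrow> nat" where "sw i \<equiv> transpose i (Suc i)"

lemma A_iff: "\<mu> \<in> A \<longleftrightarrow> \<mu> \<in> exponents n \<and> (\<forall>x. gap_at n (l * j) k \<mu> x) \<and> low \<mu>"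
  by (auto simp: A_def admissible_iff_gap)

lemma k_nz: "(of_nat k :: complex) \<noteq> 0" using k2 by simp

lemma c0_nz: "c0 \<noteq> 0" using k_nz j0 by (simp add: c0)

lemma wt_diff_iff:
  "of_nat a - of_nat l * c0 * of_nat r = of_nat b - of_nat l * c0 * (of_nat s :: complex)
   \<longleftrightarrow> int k * (int a - int b) = int l * int j * (int r - int s)"
proof -
  have "of_nat a - of_nat l * c0 * of_nat r = of_nat b - of_nat l * c0 * (of_nat s :: complex) \<longleftrightarrow>
      of_nat k * (of_nat a - of_nat b) = of_nat l * of_nat j * (of_nat r - (of_nat s :: complex))"
    using k_nz by (simp add: c0 field_simps)
  also have "\<dots> \<longleftrightarrow> of_int (int k * (int a - int b)) = (of_int (int l * int j * (int r - int s)) :: complex)"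
    by simp
  finally show ?thesis by (simp only: of_int_eq_iff)
qed

lemma gapped_isolated:
  assumes \<mu>: "\<mu> \<in> exponents n" and gap: "\<And>x. x \<noteq> x0 \<Longrightarrow> gap_at n (l * j) k \<mu> x"
  shows "C.isolated \<mu>"
  unfolding C.isolated_def
proof (intro conjI ballI impI)
  fix \<nu> assume \<nu>: "\<nu> \<in> exponents n" and same: "\<forall>i<n. lookup \<nu> i mod l = lookup \<mu> i mod l \<and> C.wt i \<nu> = C.wt i \<mu>"
  have "\<mu> = \<nu>"
  proof (rule gapped_weight_unique[OF \<mu> \<nu> k2 gap])
    fix i assume i: "i < n"
    have "Suc (lookup \<nu> i) mod l = Suc (lookup \<mu> i) mod l" using same i by (metis mod_Suc_eq)
    then have "C.dd (Suc (lookup \<nu> i)) = C.dd (Suc (lookup \<mu> i))" by (rule C.dd)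
    then have "of_nat (lookup \<mu> i) - of_nat l * c0 * of_nat (rk n \<mu> i) =
        of_nat (lookup \<nu> i) - of_nat l * c0 * of_nat (rk n \<nu> i)"
    proof -
      have "C.wt i \<mu> - 1 + C.dd (Suc (lookup \<mu> i)) = of_nat (lookup \<mu> i) - of_nat l * c0 * of_nat (rk n \<mu> i)"
        by (simp add: C.wt_def)
      moreover have "C.wt i \<nu> - 1 + C.dd (Suc (lookup \<nu> i)) = of_nat (lookup \<nu> i) - of_nat l * c0 * of_nat (rk n \<nu> i)"
        by (simp add: C.wt_def)
      moreover have "C.wt i \<nu> = C.wt i \<mu>" using same i by simp
      ultimately show ?thesis using \<open>C.dd (Suc (lookup \<nu> i)) = C.dd (Suc (lookup \<mu> i))\<close> by simp
    qed
    then have eq: "int k * (int (lookup \<mu> i) - int (lookup \<nu> i)) = int l * int j * (int (rk n \<mu> i) - int (rk n \<nu> i))"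
      by (simp add: wt_diff_iff)
    have "int (lookup \<mu> i) mod int l = int (lookup \<nu> i) mod int l" using same i by (metis of_nat_mod)
    then obtain e where e: "int (lookup \<mu> i) - int (lookup \<nu> i) = int l * e"
      by (metis mod_eq_dvd_iff dvdE)
    \<comment> \<open>The congruence has removed the factor \<open>l\<close>; coprimality now yields
      one integer \<open>t\<close> for entries and ranks alike.\<close>
    have ke: "int k * e = int j * (int (rk n \<mu> i) - int (rk n \<nu> i))" using eq l1 by (simp add: e)
    then have "int k dvd int j * (int (rk n \<mu> i) - int (rk n \<nu> i))" by (metis dvd_triv_left)
    moreover have "coprime (int k) (int j)" using jk by (simp add: coprime_commute)
    ultimately have "int k dvd int (rk n \<mu> i) - int (rk n \<nu> i)" by (simp add: coprime_dvd_mult_right_iff)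
    then obtain t where t: "int (rk n \<mu> i) - int (rk n \<nu> i) = int k * t" by (elim dvdE)
    then have "e = int j * t" using ke k2 by simp
    then show "\<exists>t. int (lookup \<mu> i) = int (lookup \<nu> i) + int (l * j) * t \<and> int (rk n \<mu> i) = int (rk n \<nu> i) + int k * t"
      using e t by (intro exI[of _ t]) (simp add: algebra_simps)
  qed
  then show "\<nu> = \<mu>" by simp
qed (rule \<mu>)

lemma E_eig:
  assumes "\<mu> \<in> exponents n" "\<And>x. x \<noteq> x0 \<Longrightarrow> gap_at n (l * j) k \<mu> x"
  shows "C.isolated \<mu>" "C.eig \<mu> (E \<mu>)" "lookup (E \<mu>) \<mu> = 1"
  using gapped_isolated[OF assms] specialize_eig[OF gapped_isolated[OF assms] jack_eig[OF assms(1)]]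
  by (simp_all add: E_def)

lemma E_eig_A:
  assumes "\<mu> \<in> A" shows "C.isolated \<mu>" "C.eig \<mu> (E \<mu>)" "lookup (E \<mu>) \<mu> = 1" "E \<mu> \<in> poly_ring n"
  \<comment> \<open>No gap is violated, so the exceptional index may be anything.\<close>
  using E_eig[of \<mu> undefined] assms by (auto simp: A_iff C.eig_def)

lemma E_unique:
  assumes "\<mu> \<in> exponents n" "\<And>x. x \<noteq> x0 \<Longrightarrow> gap_at n (l * j) k \<mu> x" "C.eig \<mu> g"
  shows "g = scale (lookup g \<mu>) (E \<mu>)"
  using C.eig_unique[OF E_eig(1,2)[OF assms(1,2)] assms(3) E_eig(3)[OF assms(1,2)]] by blast

lemma E_in_S: "\<mu> \<in> A \<Longrightarrow> E \<mu> \<in> S"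
  unfolding S_def by (rule mpol.span_base) simp

lemma S_subspace: "mpol.subspace S" unfolding S_def by (rule mpol.subspace_span)

lemma S_poly_ring: "S \<subseteq> poly_ring n"
  unfolding S_def by (rule mpol.span_minimal[OF _ poly_ring_subspace]) (auto simp: E_eig_A)

lemma shift_A: "\<mu> \<in> A \<Longrightarrow> shift n \<mu> \<in> A"
proof -
  assume \<mu>: "\<mu> \<in> A"
  have "low (shift n \<mu>)"
    unfolding low_def
  proof (intro allI impI)
    fix m p assume H: "m \<le> n - 1 \<and> p > 0 \<and> \<not> l dvd p \<and> d 0 - d (- int p) + of_nat l * of_nat m * c0 = of_nat p"
    then have "rearr n \<mu> m \<ge> p" using \<mu> by (simp add: A_iff low_def)
    moreover have "m < n" using H n0 by auto
    ultimately show "rearr n (shift n \<mu>) m \<ge> p" using rearr_shift[of m n \<mu>] by simp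
  qed
  then show ?thesis using \<mu> n0 by (simp add: A_iff shift_exponents gap_at_shift)
qed

lemma Phi_E:
  assumes \<mu>: "\<mu> \<in> exponents n" and gap: "\<And>x. gap_at n (l * j) k \<mu> x"
  shows "Phi n (E \<mu>) = E (shift n \<mu>)"
proof -
  have g: "\<And>x. x \<noteq> undefined \<Longrightarrow> gap_at n (l * j) k (shift n \<mu>) x" using gap by (simp add: gap_at_shift)
  have "Phi n (E \<mu>) = scale (lookup (Phi n (E \<mu>)) (shift n \<mu>)) (E (shift n \<mu>))"
    by (rule E_unique[OF shift_exponents[OF n0 \<mu>] g C.eig_shift[OF n0 E_eig(2)[OF \<mu> gap]]])
  then show ?thesis by (simp add: lookup_Phi E_eig(3)[OF \<mu> gap] scale_algebra)
qed

lemma swap_low: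
  assumes i: "Suc i < n" and ne: "lookup \<mu> i \<noteq> lookup \<mu> (Suc i)"
  shows "low (pexp (sw i) \<mu>) \<longleftrightarrow> low \<mu>"
proof -
  have "m \<le> n - 1 \<Longrightarrow> m < n" for m using n0 by auto
  then show ?thesis unfolding low_def using rearr_swap[OF i ne] by metis
qed

text \<open>If the exchange of two neighbours destroys admissibility, then the intertwiner has
  coefficient 1, and this makes it vanish on \<open>E \<mu>\<close>.\<close>

lemma swap_not_admissible:
  assumes i: "Suc i < n" and ne: "lookup \<mu> i \<noteq> lookup \<mu> (Suc i)" and gap: "\<And>x. gap_at n (l * j) k \<mu> x"
    and not: "\<not> gap_at n (l * j) k (pexp (sw i) \<mu>) x"
  shows "lookup \<mu> i = lookup \<mu> (Suc i) + l * j" "rk n \<mu> i = rk n \<mu> (Suc i) + (k - 1)"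
proof -
  have x: "x = rk n \<mu> (Suc i)" "x + (k - 1) = rk n \<mu> i" using gap_at_swap[OF i ne k2 gap, of x] not by auto
  then show rk: "rk n \<mu> i = rk n \<mu> (Suc i) + (k - 1)" by simp
  have xn: "x + (k - 1) < n" using rk_less[of i n \<mu>] i x by simp
  have ne_x: "rk n \<mu> i \<noteq> x" "rk n \<mu> (Suc i) \<noteq> x + (k - 1)" using x k2 by auto
  have "srt n (pexp (sw i) \<mu>) x = Suc (srt n \<mu> x)" using srt_swap[OF i ne, of x] x ne_x xn by simp
  moreover have "Suc (srt n (pexp (sw i) \<mu>) (x + (k - 1))) = srt n \<mu> (x + (k - 1))"
    using srt_swap[OF i ne, of "x + (k - 1)"] x ne_x xn by simp
  moreover have "srt n \<mu> x = code n \<mu> (Suc i)" "srt n \<mu> (x + (k - 1)) = code n \<mu> i"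
    by (simp only: x(1) srt_rk) (simp only: x(2) srt_rk)
  \<comment> \<open>Both ends move, so the gap loses 2. The difference of the codes is thus
    \<open>n * (l * j)\<close> plus 1 or 2; it is also 1 more than a multiple of \<open>n\<close>,
    and \<open>n\<close> is at least 2, which leaves plus 1.\<close>
  ultimately have up: "code n \<mu> i \<le> code n \<mu> (Suc i) + n * (l * j) + 2" using not xn by (simp add: gap_at_def)
  have dn: "code n \<mu> (Suc i) + n * (l * j) < code n \<mu> i"
    using gap[of x] xn \<open>srt n \<mu> x = _\<close> \<open>srt n \<mu> (x + (k - 1)) = _\<close> by (simp add: gap_at_def)
  have c: "code n \<mu> i + n * lookup \<mu> (Suc i) = code n \<mu> (Suc i) + n * lookup \<mu> i + 1"
    using i by (simp add: code_def)
  have "n * (lookup \<mu> (Suc i) + l * j) < n * lookup \<mu> i + 1" using c dn by (simp add: distrib_left)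
  then have "lookup \<mu> (Suc i) + l * j \<le> lookup \<mu> i" using n0 by (simp add: less_Suc_eq_le)
  moreover have "n * lookup \<mu> i < n * (lookup \<mu> (Suc i) + l * j) + n"
  proof -
    have "n * lookup \<mu> i \<le> n * (lookup \<mu> (Suc i) + l * j) + 1" using c up by (simp add: distrib_left)
    then show ?thesis using i by simp
  qed
  then have "n * lookup \<mu> i < n * Suc (lookup \<mu> (Suc i) + l * j)" by simp
  then have "lookup \<mu> i \<le> lookup \<mu> (Suc i) + l * j" using n0 mult_less_cancel1 less_Suc_eq_le by metis
  ultimately show "lookup \<mu> i = lookup \<mu> (Suc i) + l * j" by simp
qed

lemma swap_exponents: "Suc i < n \<Longrightarrow> pexp (sw i) \<mu> \<in> exponents n \<longleftrightarrow> \<mu> \<in> exponents n"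
  by (intro pexp_exponents transpose_permutes) auto

text \<open>Even when the exchange leaves the admissible set, it breaks at most the gap that starts
  at \<open>rk n \<mu> (Suc i)\<close>; the exceptional index absorbs that one.\<close>

lemma near_gap:
  assumes i: "Suc i < n" and ne: "lookup \<mu> i \<noteq> lookup \<mu> (Suc i)" and gap: "\<And>x. gap_at n (l * j) k \<mu> x"
    and x: "x \<noteq> rk n \<mu> (Suc i)"
  shows "gap_at n (l * j) k (pexp (sw i) \<mu>) x"
  using gap_at_swap[OF i ne k2 gap] x by simp

text \<open>Of the two exponents, the one of larger energy cannot occur in the eigenvector of the
  other. Comparing coefficients, with \<open>e\<close> for \<open>swap_coeff\<close>, the factor is
  \<open>1 - e * e\<close> if the larger entry moves right and 1 if it moves left.\<close>

lemma swap_E: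
  assumes \<mu>: "\<mu> \<in> A" and i: "Suc i < n" and ne: "lookup \<mu> i \<noteq> lookup \<mu> (Suc i)"
  defines "g \<equiv> perm (sw i) (E \<mu>) + scale (C.swap_coeff i \<mu>) (E \<mu>)"
  shows "g = scale (lookup g (pexp (sw i) \<mu>)) (E (pexp (sw i) \<mu>))"
    and "lookup g (pexp (sw i) \<mu>) = 1 + C.swap_coeff i \<mu> * lookup (E \<mu>) (pexp (sw i) \<mu>)"
    and "lookup \<mu> (Suc i) < lookup \<mu> i \<Longrightarrow> lookup (E \<mu>) (pexp (sw i) \<mu>) = - C.swap_coeff i \<mu>"
    and "lookup \<mu> i < lookup \<mu> (Suc i) \<Longrightarrow> lookup (E \<mu>) (pexp (sw i) \<mu>) = 0"
proof -
  let ?\<nu> = "pexp (sw i) \<mu>"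
  have \<mu>': "\<mu> \<in> exponents n" "\<And>x. gap_at n (l * j) k \<mu> x" using \<mu> by (auto simp: A_iff)
  have \<nu>: "?\<nu> \<in> exponents n" using \<mu>' swap_exponents[OF i] by simp
  have eig: "C.eig ?\<nu> g"
    unfolding g_def by (rule C.eig_swap_coeff[OF E_eig_A(1)[OF \<mu>] i E_eig_A(2)[OF \<mu>] ne])
  note iso = E_eig(1)[OF \<nu> near_gap[OF i ne \<mu>'(2)]]
  show "g = scale (lookup g ?\<nu>) (E ?\<nu>)" by (rule E_unique[OF \<nu> near_gap[OF i ne \<mu>'(2)] eig])
  have look: "lookup (perm (sw i) (E \<mu>)) m = lookup (E \<mu>) (pexp (sw i) m)" for m
    using lookup_perm[of "sw i" "E \<mu>" "pexp (sw i) m"] by simp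
  show "lookup g ?\<nu> = 1 + C.swap_coeff i \<mu> * lookup (E \<mu>) ?\<nu>"
    by (simp add: g_def lookup_add look E_eig_A(3)[OF \<mu>])
  have neq: "?\<nu> \<noteq> \<mu>"
  proof
    assume "?\<nu> = \<mu>"
    then have "lookup ?\<nu> i = lookup \<mu> i" by simp
    then show False using ne by simp
  qed
  show "lookup (E \<mu>) ?\<nu> = - C.swap_coeff i \<mu>" if "lookup \<mu> (Suc i) < lookup \<mu> i"
  proof -
    have "lookup g \<mu> = 0"
      using C.swap_energy_less[OF i that] neq by (intro C.eig_lookup_eq_0[OF iso eig]) auto
    then show ?thesis by (simp add: g_def lookup_add look E_eig_A(3)[OF \<mu>] eq_neg_iff_add_eq_0)
  qed
  show "lookup (E \<mu>) ?\<nu> = 0" if "lookup \<mu> i < lookup \<mu> (Suc i)"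
  proof -
    have "energy n (pexp (sw i) ?\<nu>) < energy n ?\<nu>" using that by (intro C.swap_energy_less[OF i]) simp
    then show ?thesis
      using neq by (intro C.eig_lookup_eq_0[OF E_eig_A(1,2)[OF \<mu>]]) auto
  qed
qed

lemma swap_A: "\<mu> \<in> A \<Longrightarrow> Suc i < n \<Longrightarrow> lookup \<mu> i \<noteq> lookup \<mu> (Suc i) \<Longrightarrow>
   pexp (sw i) \<mu> \<in> A \<longleftrightarrow> (\<forall>x. gap_at n (l * j) k (pexp (sw i) \<mu>) x)"
  using swap_low swap_exponents by (auto simp: A_iff)

lemma perm_E_in_S:
  assumes \<mu>: "\<mu> \<in> A" and i: "Suc i < n"
  shows "perm (sw i) (E \<mu>) \<in> S"
proof (cases "lookup \<mu> i = lookup \<mu> (Suc i)")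
  case True
  have "perm (sw i) (E \<mu>) = E \<mu>"
    using jack_symmetric[OF _ i True] \<mu> by (simp add: E_def perm_specialize A_iff)
  then show ?thesis using E_in_S[OF \<mu>] by simp
next
  case ne: False
  let ?\<nu> = "pexp (sw i) \<mu>"
  define g where "g = perm (sw i) (E \<mu>) + scale (C.swap_coeff i \<mu>) (E \<mu>)"
  note g = swap_E[OF \<mu> i ne, folded g_def]
  have "g \<in> S"
  proof (cases "?\<nu> \<in> A")
    case True
    then show ?thesis using g(1) mpol.subspace_scale[OF S_subspace E_in_S[OF True]] by metis
  next
    case False
    then obtain x where "\<not> gap_at n (l * j) k ?\<nu> x" using swap_A[OF \<mu> i ne] by blast
    note \<mu>i = swap_not_admissible[OF i ne _ this]
    have gap: "\<And>x. gap_at n (l * j) k \<mu> x" using \<mu> by (simp add: A_iff)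
    have lu: "lookup \<mu> i = lookup \<mu> (Suc i) + l * j" and rk: "rk n \<mu> i = rk n \<mu> (Suc i) + (k - 1)"
      using \<mu>i[OF gap] by auto
    have cong: "lookup \<mu> i mod l = lookup \<mu> (Suc i) mod l" using lu by simp
    then have "Suc (lookup \<mu> i) mod l = Suc (lookup \<mu> (Suc i)) mod l" by (metis mod_Suc_eq)
    then have "C.dd (Suc (lookup \<mu> i)) = C.dd (Suc (lookup \<mu> (Suc i)))" by (rule C.dd)
    \<comment> \<open>The value \<open>l * j - l * (j / k) * (k - 1)\<close> is
      \<open>l * j / k\<close>, the numerator of the coefficient.\<close>
    then have "C.wt i \<mu> - C.wt (Suc i) \<mu> = of_nat l * of_nat j - of_nat l * c0 * of_nat (k - 1)"
      by (simp add: C.wt_def lu rk algebra_simps)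
    also have "\<dots> = of_nat l * c0"
      using k2 k_nz by (simp add: c0 of_nat_diff field_simps)
    finally have "C.swap_coeff i \<mu> = 1" using cong l1 c0_nz by (simp add: C.swap_coeff_def)
    moreover have "lookup \<mu> (Suc i) < lookup \<mu> i" using lu l1 j0 by simp
    ultimately have "lookup g ?\<nu> = 0" using g(2,3) by simp
    then have "g = 0" using g(1) by (simp add: scale_algebra)
    then show ?thesis using mpol.subspace_0[OF S_subspace] by simp
  qed
  moreover have "perm (sw i) (E \<mu>) = g - scale (C.swap_coeff i \<mu>) (E \<mu>)" by (simp add: g_def)
  ultimately show ?thesis
    using mpol.subspace_diff[OF S_subspace] mpol.subspace_scale[OF S_subspace E_in_S[OF \<mu>]] by metis
qed

end

context socle_setting
begin

lemma perm_S_adjacent: "Suc i < n \<Longrightarrow> f \<in> S \<Longrightarrow> perm (sw i) f \<in> S"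
  unfolding S_def by (rule span_closed[OF linop_perm]) (auto simp: S_def[symmetric] perm_E_in_S)

lemma perm_S_transpose: "a < b \<Longrightarrow> b < n \<Longrightarrow> f \<in> S \<Longrightarrow> perm (transpose a b) f \<in> S"
proof (induction b arbitrary: f)
  case (Suc b)
  show ?case
  proof (cases "a = b")
    case True
    then show ?thesis using Suc.prems perm_S_adjacent by simp
  next
    case False
    then have ab: "a < b" using Suc.prems by simp
    then have "transpose a (Suc b) = sw b \<circ> (transpose a b \<circ> sw b)"
      by (auto simp: fun_eq_iff transpose_def)
    then have "perm (transpose a (Suc b)) f = perm (sw b) (perm (transpose a b) (perm (sw b) f))"
      by (simp add: perm_comp bij_comp)
    then show ?thesis using Suc ab by (simp add: perm_S_adjacent)
  qed
qed simp

lemma perm_S: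
  assumes "\<pi> permutes {0..<n}" "f \<in> S"
  shows "perm \<pi> f \<in> S"
proof -
  have "finite {0..<n}" by simp
  with assms(1) have "\<forall>f\<in>S. perm \<pi> f \<in> S"
  proof (induction rule: permutes_induct)
    case id
    show ?case by (intro ballI) (simp only: perm_id)
  next
    case (swap a b p)
    have "perm (transpose a b) f \<in> S" if "f \<in> S" for f
    proof (cases "a < b")
      case True
      then show ?thesis using perm_S_transpose[of a b f] swap that by simp
    next
      case False
      then show ?thesis using perm_S_transpose[of b a f] swap that by (simp add: transpose_commute)
    qed
    moreover have "perm (transpose a b \<circ> p) f = perm (transpose a b) (perm p f)" for f :: "complex mpol"
      using perm_comp[of "transpose a b" p f] permutes_bij[OF swap.hyps(4)] by simp
    ultimately show ?case using swap.IH by (simp only:) blast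
  qed
  then show ?thesis using assms(2) by blast
qed

lemma Phi_S: "f \<in> S \<Longrightarrow> Phi n f \<in> S"
  unfolding S_def
proof (rule span_closed[OF linop_Phi])
  fix x assume "x \<in> E ` A"
  then obtain \<mu> where \<mu>: "\<mu> \<in> A" "x = E \<mu>" by blast
  then have "Phi n x = E (shift n \<mu>)" using Phi_E by (simp add: A_iff)
  then show "Phi n x \<in> mpol.span (E ` A)" using E_in_S[OF shift_A[OF \<mu>(1)]] by (simp add: S_def)
qed

text \<open>Undoing the cyclic permutation inside \<open>Phi\<close> isolates the last variable;
  transpositions carry it to the others.\<close>

lemma var_S:
  assumes i: "i < n" and f: "f \<in> S"
  shows "var i * f \<in> S"
proof -
  have last: "var (n - 1) * f \<in> S" if "f \<in> S" for f
  proof -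
    have "perm (pinv (cyc n)) f \<in> S" by (rule perm_S[OF permutes_inv[OF cyc_permutes] that])
    moreover have "perm (cyc n) (perm (pinv (cyc n)) f) = f"
      by (simp add: perm_comp bij_imp_bij_inv surj_iff[THEN iffD1] bij_is_surj)
    ultimately show ?thesis using Phi_S[of "perm (pinv (cyc n)) f"] by (simp add: Phi_def)
  qed
  let ?t = "transpose i (n - 1)"
  have t: "?t permutes {0..<n}" using i n0 by (intro transpose_permutes) auto
  have "perm ?t (var (n - 1) * perm ?t f) \<in> S" by (intro perm_S[OF t] last perm_S[OF t f])
  also have "perm ?t (var (n - 1) * perm ?t f) = var i * f" by (simp add: perm_mult_var)
  finally show ?thesis .
qed

lemma mult_S:
  assumes g: "g \<in> poly_ring n" and f: "f \<in> S"
  shows "g * f \<in> S"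
proof -
  have pow: "\<forall>f\<in>S. var i ^ k * f \<in> S" if "i < n" for i k
    by (induction k) (simp_all add: var_S[OF that] mult.assoc)
  have "\<forall>f\<in>S. (\<Prod>i\<in>J. var i ^ e i) * f \<in> S" if "finite J" "J \<subseteq> {0..<n}" for J e
    using that pow by (induction J rule: finite_induct) (simp_all add: mult.assoc)
  moreover have "(\<Prod>i\<in>keys m. var i ^ lookup m i) = (xmon m :: complex mpol)" for m
    using prod_var_pexp[OF bij_id, of "\<lambda>_. 1" m] by (simp add: monchar_def scale_algebra)
  moreover have "keys m \<subseteq> {0..<n}" if "m \<in> exponents n" for m :: "nat \<Rightarrow>\<^sub>0 nat"
    using that by (simp add: exponents_def)
  ultimately have x: "xmon m * f \<in> S" if "m \<in> exponents n" for m
    using f that finite_keys[of m] by metis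
  have "g * f = (\<Sum>m\<in>keys g. scale (lookup g m) (xmon m * f))"
    by (subst xmon_expand[of g]) (simp add: sum_distrib_right scale_algebra)
  also have "\<dots> \<in> S"
    using g x by (intro mpol.subspace_sum[OF S_subspace] mpol.subspace_scale[OF S_subspace]) (auto simp: poly_ring_def)
  finally show ?thesis .
qed

text \<open>As \<open>exact_div\<close> is a definite description, identities for
  \<open>y_i\<close>, even its linearity, are proved through the linear \<open>XY\<close> by
  cancelling the variable.\<close>

lemma dunkl_cancel:
  assumes "i < n" "f \<in> poly_ring n" "var i * g = C.XY i f"
  shows "dunkl l n \<zeta> c0 d i f = g"
  using C.var_mult_dunkl[OF assms(1,2)] assms(3) C.var_nonzero mult_left_cancel by metis

lemma dunkl_linear:
  assumes i: "i < n" and f: "f \<in> poly_ring n" "g \<in> poly_ring n"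
  shows "dunkl l n \<zeta> c0 d i (f + g) = dunkl l n \<zeta> c0 d i f + dunkl l n \<zeta> c0 d i g"
    and "dunkl l n \<zeta> c0 d i (scale a f) = scale a (dunkl l n \<zeta> c0 d i f)"
  by (rule dunkl_cancel[OF i], use f in \<open>simp_all add: poly_ring_closed distrib_left scale_algebra
      C.var_mult_dunkl[OF i] linopD[OF C.linop_XY]\<close>)+

lemma dunkl_perm:
  assumes i: "i < n" and f: "f \<in> poly_ring n" and \<pi>: "\<pi> permutes {0..<n}"
  shows "dunkl l n \<zeta> c0 d (\<pi> i) (perm \<pi> f) = perm \<pi> (dunkl l n \<zeta> c0 d i f)"
proof (rule dunkl_cancel)
  show "\<pi> i < n" using i permutes_in_image[OF \<pi>, of i] by simp
  show "perm \<pi> f \<in> poly_ring n" by (rule perm_in_poly_ring[OF \<pi> f])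
  show "var (\<pi> i) * perm \<pi> (dunkl l n \<zeta> c0 d i f) = C.XY (\<pi> i) (perm \<pi> f)"
    by (simp add: perm_mult_var[OF permutes_bij[OF \<pi>], symmetric] C.var_mult_dunkl[OF i f] C.perm_XY[OF \<pi> i])
qed

text \<open>The eigenvalue of \<open>x_n y_n\<close> after the shift is the weight of position 0
  before it, and removing the last variable from \<open>Phi\<close> leaves a cyclic
  permutation.\<close>

lemma dunkl_E_shift:
  assumes \<nu>: "\<nu> \<in> exponents n" and gap: "\<And>x. gap_at n (l * j) k \<nu> x"
  shows "dunkl l n \<zeta> c0 d (n - 1) (E (shift n \<nu>)) = scale (C.wt 0 \<nu>) (perm (cyc n) (E \<nu>))"
proof (rule dunkl_cancel)
  have eig: "C.eig (shift n \<nu>) (E (shift n \<nu>))"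
    unfolding Phi_E[OF \<nu> gap, symmetric] by (rule C.eig_shift[OF n0 E_eig(2)[OF \<nu> gap]])
  then show "E (shift n \<nu>) \<in> poly_ring n" by (simp add: C.eig_def)
  have "rk n (shift n \<nu>) (n - 1) = rk n \<nu> 0" using rk_shift[of 0 n \<nu>] n0 by (simp add: cyc_def)
  then have "C.XY (n - 1) (E (shift n \<nu>)) = scale (C.wt 0 \<nu>) (E (shift n \<nu>))"
    unfolding C.XY_last[OF n0 eig] lookup_shift_last[OF n0] by (simp add: C.wt_def)
  also have "\<dots> = var (n - 1) * scale (C.wt 0 \<nu>) (perm (cyc n) (E \<nu>))"
    unfolding Phi_E[OF \<nu> gap, symmetric] Phi_def by (simp add: scale_algebra)
  finally show "var (n - 1) * scale (C.wt 0 \<nu>) (perm (cyc n) (E \<nu>)) = C.XY (n - 1) (E (shift n \<nu>))" by simp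
qed (use n0 in simp)

text \<open>The lower bounds on \<open>\<mu>\<^sup>-\<close> are violated by lowering \<open>\<mu>\<close> exactly when the eigenvalue of
  \<open>x\<^sub>n y\<^sub>n\<close> vanishes.\<close>

lemma low_unshift:
  assumes low: "low (shift n \<nu>)" and wt: "C.wt 0 \<nu> \<noteq> 0"
  shows "low \<nu>"
  unfolding low_def
proof (intro allI impI, rule ccontr)
  fix m p assume H: "m \<le> n - 1 \<and> p > 0 \<and> \<not> l dvd p \<and> d 0 - d (- int p) + of_nat l * of_nat m * c0 = of_nat p"
    and less: "\<not> p \<le> rearr n \<nu> m"
  have m: "m < n" using H n0 by auto
  have "p \<le> rearr n (shift n \<nu>) m" using H low by (simp add: low_def)
  let ?a = "pinv (rk n \<nu>) m"
  have a: "?a < n" using m by simp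
  have "rk n (shift n \<nu>) (cyc n ?a) = m" using rk_shift[OF a] by simp
  then have "rearr n (shift n \<nu>) m = lookup (shift n \<nu>) (cyc n ?a)"
    using rearr_rk[of "cyc n ?a" n "shift n \<nu>"] a permutes_in_image[OF cyc_permutes, of n ?a] by simp
  also have "\<dots> = (if ?a = 0 then Suc (lookup \<nu> 0) else lookup \<nu> ?a)" by (rule lookup_shift[OF a])
  finally have "?a = 0" "p = Suc (lookup \<nu> 0)"
    using less \<open>p \<le> rearr n (shift n \<nu>) m\<close> rearr_inv_rk[OF m, of \<nu>] by (auto split: if_splits)
  then have "m = rk n \<nu> 0" by (metis rk_inv(1))
  then have "C.wt 0 \<nu> = of_nat p - (d 0 - d (- int p)) - of_nat l * of_nat m * c0"
    by (simp only: C.wt_def C.dd_def \<open>p = _\<close>[symmetric] mult.assoc mult.commute)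
  also have "\<dots> = 0" using H by (simp add: algebra_simps)
  finally show False using wt by simp
qed

lemma dunkl_E_in_S:
  assumes \<mu>: "\<mu> \<in> A"
  shows "dunkl l n \<zeta> c0 d (n - 1) (E \<mu>) \<in> S"
proof (cases "lookup \<mu> (n - 1) = 0")
  case True
  \<comment> \<open>A last entry 0 has the least possible code and so rank 0; with
    \<open>dd 0 = 0\<close> the eigenvalue of \<open>x_n y_n\<close> is zero.\<close>
  then have "code n \<mu> (n - 1) = 0" by (simp add: code_def)
  then have "rk n \<mu> (n - 1) = 0" using n0 by (simp add: rk_def)
  then have "C.XY (n - 1) (E \<mu>) = 0"
    unfolding C.XY_last[OF n0 E_eig_A(2)[OF \<mu>]] True by (simp add: C.dd_def scale_algebra)
  then have "dunkl l n \<zeta> c0 d (n - 1) (E \<mu>) = 0"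
    using n0 E_eig_A(4)[OF \<mu>] by (intro dunkl_cancel) auto
  then show ?thesis using mpol.subspace_0[OF S_subspace] by simp
next
  case False
  have "\<mu> \<in> exponents n" using \<mu> by (simp add: A_iff)
  then obtain \<nu> where \<nu>: "\<nu> \<in> exponents n" "\<mu> = shift n \<nu>" using shift_surj n0 False by blast
  have gap: "\<And>x. gap_at n (l * j) k \<nu> x" using \<mu> by (simp add: A_iff \<nu>(2) gap_at_shift)
  have eq: "dunkl l n \<zeta> c0 d (n - 1) (E \<mu>) = scale (C.wt 0 \<nu>) (perm (cyc n) (E \<nu>))"
    unfolding \<nu>(2) by (rule dunkl_E_shift[OF \<nu>(1) gap])
  show ?thesis
  proof (cases "C.wt 0 \<nu> = 0")
    case True
    then show ?thesis using eq mpol.subspace_0[OF S_subspace] by (simp add: scale_algebra)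
  next
    case False
    then have "low \<nu>" using low_unshift \<mu> by (simp add: A_iff \<nu>(2))
    then have "\<nu> \<in> A" using \<nu>(1) gap by (simp add: A_iff)
    then show ?thesis unfolding eq
      by (intro mpol.subspace_scale[OF S_subspace] perm_S[OF cyc_permutes] E_in_S)
  qed
qed

lemma dunkl_S:
  assumes i: "i < n" and f: "f \<in> S"
  shows "dunkl l n \<zeta> c0 d i f \<in> S"
proof -
  have n1: "n - 1 < n" using n0 by simp
  have last: "f \<in> poly_ring n \<and> dunkl l n \<zeta> c0 d (n - 1) f \<in> S" if "f \<in> S" for f
    using that unfolding S_def
  proof (rule mpol.span_induct)
    have "dunkl l n \<zeta> c0 d (n - 1) 0 = 0"
      by (rule dunkl_cancel[OF n1]) (simp_all add: poly_ring_closed linopD[OF C.linop_XY])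
    then show "mpol.subspace {f. f \<in> poly_ring n \<and> dunkl l n \<zeta> c0 d (n - 1) f \<in> mpol.span (E ` A)}"
      by (auto simp: mpol.subspace_def poly_ring_closed dunkl_linear[OF n1, unfolded One_nat_def] mpol.span_zero mpol.span_add mpol.span_scale)
    fix x assume "x \<in> E ` A"
    then show "x \<in> poly_ring n \<and> dunkl l n \<zeta> c0 d (n - 1) x \<in> mpol.span (E ` A)"
      using dunkl_E_in_S E_eig_A(4) by (auto simp: S_def)
  qed
  let ?t = "transpose i (n - 1)"
  have t: "?t permutes {0..<n}" using i n1 by (intro transpose_permutes) auto
  have tf: "perm ?t f \<in> S" by (rule perm_S[OF t f])
  have "dunkl l n \<zeta> c0 d (?t (n - 1)) (perm ?t (perm ?t f)) \<in> S"
    using dunkl_perm[OF n1 _ t, of "perm ?t f"] last[OF tf] perm_S[OF t] by simp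
  then show ?thesis by simp
qed

text \<open>All exponents in an eigenvector share their residues modulo \<open>l\<close>, so the
  diagonal part of \<open>w\<close> acts on it by a single scalar.\<close>

lemma act_S:
  assumes w: "w \<in> G_group l n" and f: "f \<in> S"
  shows "act n w f \<in> S"
  unfolding S_def
proof (rule span_closed[OF linop_act _ f[unfolded S_def]])
  fix x assume "x \<in> E ` A"
  then obtain \<mu> where \<mu>: "\<mu> \<in> A" and x: "x = E \<mu>" by blast
  obtain \<sigma> c where \<sigma>: "\<sigma> permutes {0..<n}" and c: "\<And>a. a < n \<Longrightarrow> c a ^ l = 1" "\<And>a. a < n \<Longrightarrow> c a \<noteq> 0"
    and weq: "w = mmat n \<sigma> c" using G_group_cases[OF w] by blast
  let ?c = "\<lambda>a. inverse (c (pinv \<sigma> a))"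
  have exp: "m \<in> exponents n" if "m \<in> keys (E \<mu>)" for m
    using that E_eig_A(4)[OF \<mu>] by (auto simp: poly_ring_def)
  have "act n w (E \<mu>) = scale (monchar ?c \<mu>) (perm (pinv \<sigma>) (E \<mu>))"
  proof (rule linop_ext[OF linop_act linop_scale[OF linop_perm]])
    fix m assume m: "m \<in> keys (E \<mu>)"
    have "monchar ?c m = monchar ?c \<mu>"
    proof (rule monchar_cong_mod[OF exp[OF m]])
      show "\<mu> \<in> exponents n" using \<mu> by (simp add: A_iff)
      show "lookup m a mod l = lookup \<mu> a mod l" if "a < n" for a
        using E_eig_A(2)[OF \<mu>] m that by (simp add: C.eig_def)
      show "?c a ^ l = 1" if "a < n" for a
        using c(1)[of "pinv \<sigma> a"] permutes_in_image[OF permutes_inv[OF \<sigma>], of a] that by (simp add: power_inverse)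
    qed
    then show "act n w (xmon m) = scale (monchar ?c \<mu>) (perm (pinv \<sigma>) (xmon m))"
      unfolding weq by (simp add: act_mmat[OF \<sigma> c(2) exp[OF m]])
  qed
  then show "act n w x \<in> mpol.span (E ` A)"
    using mpol.subspace_scale[OF S_subspace perm_S[OF permutes_inv[OF \<sigma>] E_in_S[OF \<mu>]]]
    by (simp add: x S_def)
qed

lemma S_submodule: "submodule_H l n \<zeta> c0 d S"
proof -
  have "\<forall>f\<in>S. T f \<in> S" if "T \<in> cherednik l n \<zeta> c0 d" for T
    using that
  proof induction
    case (group w)
    then show ?case using S_poly_ring by (auto simp: act_S)
  next
    case (mult g)
    then show ?case using S_poly_ring by (auto simp: mult_S)
  next
    case (dunkl i)
    then show ?case using S_poly_ring by (auto simp: dunkl_S)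
  next
    case (plus T U)
    then show ?case using S_poly_ring mpol.subspace_add[OF S_subspace] by (auto simp: subset_iff)
  next
    case (scalar T a)
    then show ?case using S_poly_ring mpol.subspace_scale[OF S_subspace] by (auto simp: subset_iff)
  next
    case (comp T U)
    then show ?case using S_poly_ring by (auto simp: compose_def subset_iff)
  qed
  then show ?thesis using S_poly_ring S_subspace by (auto simp: submodule_H_def)
qed

section \<open>Arbitrary submodules: stability and extraction of one eigenvector\<close>

context
  fixes M
  assumes M: "submodule_H l n \<zeta> c0 d M"
begin

lemma submodule_subspace: "mpol.subspace M" and submodule_poly_ring: "f \<in> M \<Longrightarrow> f \<in> poly_ring n"
  and submodule_closed: "T \<in> cherednik l n \<zeta> c0 d \<Longrightarrow> f \<in> M \<Longrightarrow> T f \<in> M"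
  using M by (auto simp: submodule_H_def)

lemma submodule_act: "w \<in> G_group l n \<Longrightarrow> f \<in> M \<Longrightarrow> act n w f \<in> M"
  using submodule_closed[OF cherednik.group, of w f] submodule_poly_ring[of f] by simp

lemma submodule_mult: "g \<in> poly_ring n \<Longrightarrow> f \<in> M \<Longrightarrow> g * f \<in> M"
  using submodule_closed[OF cherednik.mult, of g f] submodule_poly_ring[of f] by simp

lemma submodule_dunkl: "i < n \<Longrightarrow> f \<in> M \<Longrightarrow> dunkl l n \<zeta> c0 d i f \<in> M"
  using submodule_closed[OF cherednik.dunkl, of i f] submodule_poly_ring[of f] by simp

lemma submodule_perm:
  assumes \<pi>: "\<pi> permutes {0..<n}" and f: "f \<in> M"
  shows "perm \<pi> f \<in> M"
proof -
  let ?w = "mmat n (pinv \<pi>) (\<lambda>_. 1)"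
  have "act n ?w f = perm \<pi> f"
  proof (rule linop_ext[OF linop_act linop_perm])
    fix m assume "m \<in> keys f"
    then have "m \<in> exponents n" using submodule_poly_ring[OF f] by (auto simp: poly_ring_def)
    then have "act n ?w (xmon m) = scale (monchar (\<lambda>a. inverse 1) m) (xmon (pexp (pinv (pinv \<pi>)) m))"
      by (intro act_mmat permutes_inv[OF \<pi>]) auto
    then show "act n ?w (xmon m) = perm \<pi> (xmon m)"
      by (simp add: monchar_def scale_algebra inv_inv_eq permutes_bij[OF \<pi>])
  qed
  moreover have "?w \<in> G_group l n" by (rule G_group_mmat[OF permutes_inv[OF \<pi>] _ l1]) simp
  ultimately show ?thesis using submodule_act[OF _ f, of ?w] by simp
qed

lemma submodule_zeta: "i < n \<Longrightarrow> f \<in> M \<Longrightarrow> act n (zeta_mat n \<zeta> i) f \<in> M"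
  unfolding zeta_mat_mmat by (intro submodule_act G_group_mmat permutes_id l1) (auto simp: zeta_root)

lemma submodule_Z:
  assumes i: "i < n" and f: "f \<in> M"
  shows "C.Z i f \<in> M"
proof -
  have refl: "act n (refl_mat n \<zeta> i h r) f \<in> M" if "h < i" for h r
  proof -
    have "(\<zeta> ^ r) ^ l = 1" by (simp add: mult.commute[of r l] flip: power_mult) (simp add: power_mult zeta_root)
    moreover have "h < n" "i \<noteq> h" using that i by auto
    ultimately have "refl_mat n \<zeta> i h r \<in> G_group l n"
      unfolding refl_mat_mmat[OF i \<open>h < n\<close> \<open>i \<noteq> h\<close> C.zeta_nonzero]
      by (intro G_group_mmat transpose_permutes i l1) (auto simp: power_inverse)
    then show ?thesis by (rule submodule_act[OF _ f])
  qed
  have "C.Z i f = dunkl l n \<zeta> c0 d i (var i * f) + scale c0 (\<Sum>h<i. \<Sum>r<l. act n (refl_mat n \<zeta> i h r) f)"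
    using C.z_op_Z[OF i submodule_poly_ring[OF f]] by (simp add: z_op_def)
  also have "\<dots> \<in> M"
    by (intro mpol.subspace_add[OF submodule_subspace] mpol.subspace_scale[OF submodule_subspace] mpol.subspace_sum[OF submodule_subspace]
        submodule_dunkl[OF i] submodule_mult[OF var_in_poly_ring[OF i] f] refl) auto
  finally show ?thesis .
qed

text \<open>Subtracting the eigenvalue at \<open>\<nu>\<close> from an operator that tells
  \<open>\<mu>\<close> and \<open>\<nu>\<close> apart deletes one term and keeps another. Isolation
  finds this operator among the \<open>z_i\<close> and the diagonal matrices, all of which preserve
  \<open>M\<close>.\<close>

lemma submodule_extract:
  assumes "finite F" "F \<subseteq> A" "\<exists>\<mu>\<in>F. c \<mu> \<noteq> 0" "(\<Sum>\<mu>\<in>F. scale (c \<mu>) (E \<mu>)) \<in> M"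
  shows "\<exists>\<mu>\<in>A. E \<mu> \<in> M"
  using assms
proof (induction "card F" arbitrary: F c rule: less_induct)
  case less
  obtain \<mu> where \<mu>: "\<mu> \<in> F" "c \<mu> \<noteq> 0" using less.prems by blast
  show ?case
  proof (cases "F = {\<mu>}")
    case True
    then have "scale (c \<mu>) (E \<mu>) \<in> M" using less.prems(4) by simp
    then have "scale (inverse (c \<mu>)) (scale (c \<mu>) (E \<mu>)) \<in> M" by (rule mpol.subspace_scale[OF submodule_subspace])
    then have "E \<mu> \<in> M" using \<mu>(2) by (simp add: scale_linear(4,8))
    then show ?thesis using \<mu> less.prems(2) by blast
  next
    case False
    then obtain \<nu> where \<nu>: "\<nu> \<in> F" "\<nu> \<noteq> \<mu>" using \<mu> by blast
    have A: "\<mu> \<in> A" "\<nu> \<in> A" using \<mu> \<nu> less.prems by auto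
    have sep: "\<exists>\<mu>\<in>A. E \<mu> \<in> M"
      if T: "linop T" "\<And>f. f \<in> M \<Longrightarrow> T f \<in> M" "\<And>\<kappa>. \<kappa> \<in> A \<Longrightarrow> T (E \<kappa>) = scale (ev \<kappa>) (E \<kappa>)"
        and ne: "ev \<mu> \<noteq> ev \<nu>" for T ev
    proof -
      let ?f = "\<Sum>\<kappa>\<in>F. scale (c \<kappa>) (E \<kappa>)"
      let ?c = "\<lambda>\<kappa>. c \<kappa> * (ev \<kappa> - ev \<nu>)"
      have Tf: "T ?f = (\<Sum>\<kappa>\<in>F. scale (c \<kappa> * ev \<kappa>) (E \<kappa>))"
        unfolding linopD(6)[OF T(1)]
      proof (rule sum.cong)
        fix \<kappa> assume "\<kappa> \<in> F"
        then have "T (E \<kappa>) = scale (ev \<kappa>) (E \<kappa>)" using T(3) less.prems(2) by blast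
        then show "T (scale (c \<kappa>) (E \<kappa>)) = scale (c \<kappa> * ev \<kappa>) (E \<kappa>)"
          by (simp only: linopD(2)[OF T(1)] scale_linear(4))
      qed simp
      have "T ?f - scale (ev \<nu>) ?f = (\<Sum>\<kappa>\<in>F. scale (c \<kappa> * ev \<kappa> - ev \<nu> * c \<kappa>) (E \<kappa>))"
        by (simp only: Tf scale_linear(10,4,6) sum_subtractf)
      also have "\<dots> = (\<Sum>\<kappa>\<in>F. scale (?c \<kappa>) (E \<kappa>))"
        by (simp only: right_diff_distrib mult.commute[of "ev \<nu>"])
      also have "\<dots> = (\<Sum>\<kappa>\<in>F - {\<nu>}. scale (?c \<kappa>) (E \<kappa>))"
        using less.prems(1) by (intro sum.mono_neutral_right) (auto simp: scale_linear(7))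
      finally have "(\<Sum>\<kappa>\<in>F - {\<nu>}. scale (?c \<kappa>) (E \<kappa>)) \<in> M"
        using mpol.subspace_diff[OF submodule_subspace T(2)[OF less.prems(4)] mpol.subspace_scale[OF submodule_subspace less.prems(4), of "ev \<nu>"]]
        by simp
      moreover have "card (F - {\<nu>}) < card F" using less.prems(1) \<nu>(1) by (intro psubset_card_mono) auto
      moreover have "\<exists>\<mu>\<in>F - {\<nu>}. ?c \<mu> \<noteq> 0" using \<mu> \<nu> ne by (intro bexI[of _ \<mu>]) auto
      ultimately show ?thesis
        using less.hyps[of "F - {\<nu>}" ?c] less.prems(1,2) by (meson Diff_subset finite_Diff subset_trans)
    qed
    have "\<exists>i<n. lookup \<nu> i mod l \<noteq> lookup \<mu> i mod l \<or> C.wt i \<nu> \<noteq> C.wt i \<mu>"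
      using E_eig_A(1)[OF A(1)] A(2) \<nu>(2) unfolding C.isolated_def A_iff by blast
    then obtain i where i: "i < n" and "lookup \<nu> i mod l \<noteq> lookup \<mu> i mod l \<or> C.wt i \<nu> \<noteq> C.wt i \<mu>" by blast
    then show ?thesis
    proof (elim disjE)
      assume "C.wt i \<nu> \<noteq> C.wt i \<mu>"
      then show ?thesis
        using E_eig_A(2) i submodule_Z[OF i]
        by (intro sep[of "C.Z i" "C.wt i"]) (auto simp: C.linop_Z C.eig_def)
    next
      assume res: "lookup \<nu> i mod l \<noteq> lookup \<mu> i mod l"
      let ?ev = "\<lambda>\<kappa>. \<zeta> powi (- int (lookup \<kappa> i))"
      show ?thesis
      proof (rule sep[of "act n (zeta_mat n \<zeta> i)" ?ev])
        show "act n (zeta_mat n \<zeta> i) (E \<kappa>) = scale (?ev \<kappa>) (E \<kappa>)" if "\<kappa> \<in> A" for \<kappa>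
          using E_eig_A(2)[OF that] i by (subst C.act_zeta_iff[OF i E_eig_A(4)[OF that]]) (auto simp: C.eig_def)
        show "?ev \<mu> \<noteq> ?ev \<nu>" using res C.zeta_power_eq_iff[of "lookup \<mu> i" "lookup \<nu> i"]
          by (simp add: power_int_minus)
      qed (auto simp: linop_act submodule_zeta[OF i])
    qed
  qed
qed

lemma submodule_shift:
  assumes \<mu>: "\<mu> \<in> A" and E: "E \<mu> \<in> M"
  shows "E (shift n \<mu>) \<in> M"
proof -
  have "var (n - 1) * perm (cyc n) (E \<mu>) \<in> M"
    using n0 by (intro submodule_mult var_in_poly_ring submodule_perm cyc_permutes E) auto
  then show ?thesis using Phi_E[of \<mu>] \<mu> by (simp add: A_iff Phi_def)
qed

end

end

section \<open>The socle\<close>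

text \<open>A code reveals its position by its residue modulo \<open>n\<close> and its entry by the
  quotient, so the set of codes is the exponent.\<close>

lemma srt_inject:
  assumes "\<mu> \<in> exponents n" "\<nu> \<in> exponents n" "\<And>m. m < n \<Longrightarrow> srt n \<mu> m = srt n \<nu> m"
  shows "\<mu> = \<nu>"
proof (rule exponents_eqI[OF assms(1,2)])
  fix a assume a: "a < n"
  let ?b = "pinv (rk n \<nu>) (rk n \<mu> a)"
  have b: "?b < n" using rk_less[OF a] by simp
  have eq: "code n \<mu> a = code n \<nu> ?b" using assms(3)[OF rk_less[OF a, of \<mu>]] srt_rk[of n \<mu> a] by (simp add: srt_def)
  then have "n - 1 - a = n - 1 - ?b" using code_mod[OF a, of \<mu>] code_mod[OF b, of \<nu>] by simp
  then have "?b = a" using a b by linarith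
  then show "lookup \<mu> a = lookup \<nu> a" using eq code_div[OF a, of \<mu>] code_div[OF a, of \<nu>] by simp
qed

text \<open>It is compared only where no sorted code of \<open>\<nu>\<close> exceeds the one of
  \<open>\<mu>\<close>, so the subtraction is a true one.\<close>

definition excess :: "nat \<Rightarrow> (nat \<Rightarrow>\<^sub>0 nat) \<Rightarrow> (nat \<Rightarrow>\<^sub>0 nat) \<Rightarrow> nat \<Rightarrow> nat" where
  "excess n \<nu> \<mu> a = code n \<mu> a - srt n \<nu> (rk n \<mu> a)"

section \<open>Invertibility of the moves inside \<open>A\<close>, and connectedness of
  \<open>A\<close>\<close>

context socle_setting
begin

text \<open>The exceptional index \<open>n\<close> lies outside every window, so no gap is
  exempted.\<close>

lemma gaps_srt:
  assumes "\<And>x. gap_at n (l * j) k \<mu> x"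
  shows "gaps (\<lambda>x. int (srt n \<mu> x)) n k n (int (n * (l * j)))"
proof
  show "int (srt n \<mu> x) + int (n * (l * j)) < int (srt n \<mu> (x + (k - 1)))" if "x + (k - 1) < n" "x \<noteq> n" for x
    using assms[of x] that by (simp add: gap_at_def flip: of_nat_add of_nat_mult)
qed (use k2 in \<open>auto simp: srt_less_iff\<close>)

lemma mult_k_dvd:
  assumes "int k * int a = int j * int b"
  obtains t where "b = k * t" "a = j * t"
proof -
  have "k * a = j * b" using assms by (metis of_nat_eq_iff of_nat_mult)
  moreover have "coprime k j" using jk by (simp add: coprime_commute)
  ultimately have "k dvd b" by (metis coprime_dvd_mult_right_iff dvd_triv_left)
  then obtain t where t: "b = k * t" by (elim dvdE)
  have "k * a = k * (j * t)" using \<open>k * a = j * b\<close> unfolding t by (simp only: mult.left_commute)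
  then have "a = j * t" using k2 by simp
  with t that show thesis by blast
qed

lemma cancel_l:
  assumes "int k * (int l * int D) = int l * int j * X" shows "int k * int D = int j * X"
proof -
  have "int l * (int k * int D) = int l * (int j * X)" using assms by (simp only: mult_ac)
  then show ?thesis using l1 by simp
qed

text \<open>A zero is an equation of the kind in \<open>low\<close> for
  \<open>p = Suc (lookup \<nu> 0)\<close> and the rank of position 0. If \<open>l\<close> does not
  divide \<open>p\<close>, the bound is contradicted at that rank. Otherwise the rank is
  \<open>k * t\<close> and \<open>p = l * j * t\<close>, and \<open>t\<close> gaps push the code up
  to \<open>n * p\<close>, which is too large for the entry \<open>p - 1\<close>.\<close>

lemma wt_0_nonzero:
  assumes \<nu>: "\<nu> \<in> A" shows "C.wt 0 \<nu> \<noteq> 0"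
proof
  assume wt: "C.wt 0 \<nu> = 0"
  let ?p = "Suc (lookup \<nu> 0)" and ?m = "rk n \<nu> 0"
  have m: "?m < n" by (rule rk_less[OF n0])
  have eq: "C.dd ?p + of_nat l * of_nat ?m * c0 = of_nat ?p"
    using wt by (simp only: C.wt_def) (simp add: algebra_simps del: of_nat_Suc)
  show False
  proof (cases "l dvd ?p")
    case False
    have "rearr n \<nu> ?m \<ge> ?p"
      using \<nu> False eq m by (simp add: A_iff low_def C.dd_def del: of_nat_Suc)
    then show False by (simp add: rearr_rk[OF n0])
  next
    case True
    have "C.dd ?p = C.dd 0" using True by (intro C.dd) simp
    also have "\<dots> = 0" by (simp add: C.dd_def)
    finally have "of_nat ?p - of_nat l * c0 * of_nat ?m = of_nat 0 - of_nat l * c0 * (of_nat 0 :: complex)"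
      using eq by (simp add: algebra_simps del: of_nat_Suc)
    then have kp: "int k * (int ?p - int 0) = int l * int j * (int ?m - int 0)" by (simp only: wt_diff_iff)
    obtain p where p: "?p = l * p" using True by (elim dvdE)
    have "int k * int p = int j * int ?m"
      using kp unfolding p of_nat_mult of_nat_0 diff_zero by (rule cancel_l)
    then obtain t where t: "?m = k * t" "p = j * t" by (rule mult_k_dvd)
    interpret gaps "\<lambda>x. int (srt n \<nu> x)" n k n "int (n * (l * j))"
      by (rule gaps_srt) (use \<nu> in \<open>simp add: A_iff\<close>)
    have "int t * int (n * (l * j)) \<le> int (srt n \<nu> ?m)"
      using steps[of 0 t] m t(1) by (simp add: mult.commute)
    moreover have "int t * int (n * (l * j)) = int (n * (l * (j * t)))" by (simp add: mult_ac)
    ultimately have "n * ?p \<le> srt n \<nu> ?m" unfolding p t(2) by (simp only: of_nat_le_iff)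
    then show False using n0 by (simp add: code_def)
  qed
qed

text \<open>The two codes differ by exactly \<open>n * (l * D) + 1\<close>. A coefficient 1 or -1
  would place the ranks \<open>k * t - 1\<close> or \<open>k * t + 1\<close> apart, with
  \<open>D = j * t\<close>, and the gaps then force a difference of at least
  \<open>n * (l * D) + 2\<close>. The one escape, ranks \<open>k - 1\<close> apart, is the exchange
  that leaves \<open>A\<close>.\<close>

lemma swap_coeff_neq:
  assumes \<mu>: "\<mu> \<in> A" and i: "Suc i < n" and less: "lookup \<mu> (Suc i) < lookup \<mu> i" and sw: "pexp (sw i) \<mu> \<in> A"
  shows "C.swap_coeff i \<mu> * C.swap_coeff i \<mu> \<noteq> 1"
proof
  let ?e = "C.swap_coeff i \<mu>" and ?\<delta> = "C.wt i \<mu> - C.wt (Suc i) \<mu>"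
  assume e: "?e * ?e = 1"
  then have cong: "lookup \<mu> i mod l = lookup \<mu> (Suc i) mod l" by (auto simp: C.swap_coeff_def split: if_splits)
  have "?e = 1 \<or> ?e = - 1" using e by (simp add: square_eq_1_iff)
  moreover have "?e = of_nat l * c0 / ?\<delta>" using cong by (simp add: C.swap_coeff_def)
  ultimately have \<delta>: "?\<delta> = of_nat l * c0 \<or> ?\<delta> = - (of_nat l * c0)"
    by (auto simp: divide_eq_1_iff) (metis add.inverse_inverse divide_minus_right divide_eq_1_iff)
  let ?p = "rk n \<mu> i" and ?q = "rk n \<mu> (Suc i)"
  have pq: "?q < ?p" "?p < n" using less i by (simp_all add: rk_less rk_less_iff code_less_iff)
  have "Suc (lookup \<mu> i) mod l = Suc (lookup \<mu> (Suc i)) mod l" using cong by (metis mod_Suc_eq)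
  then have "C.dd (Suc (lookup \<mu> i)) = C.dd (Suc (lookup \<mu> (Suc i)))" by (rule C.dd)
  then have \<delta>_eq: "?\<delta> = (of_nat (lookup \<mu> i) - of_nat l * c0 * of_nat ?p) - (of_nat (lookup \<mu> (Suc i)) - of_nat l * c0 * of_nat ?q)"
    by (simp add: C.wt_def)
  obtain D where D: "lookup \<mu> i = lookup \<mu> (Suc i) + l * D"
    using cong less by (metis mod_eq_dvd_iff_nat dvdE less_imp_le le_add_diff_inverse)
  have D_int: "int (lookup \<mu> i) - int (lookup \<mu> (Suc i)) = int l * int D" by (simp add: D)
  have c: "srt n \<mu> ?p = srt n \<mu> ?q + n * (l * D) + 1" using i by (simp add: code_def D algebra_simps)
  interpret gaps "\<lambda>x. int (srt n \<mu> x)" n k n "int (n * (l * j))"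
    by (rule gaps_srt) (use \<mu> in \<open>simp add: A_iff\<close>)
  have strict: "int (srt n \<mu> x) + int t * int (n * (l * j)) < int (srt n \<mu> (x + t * k))" if "0 < t" "x + t * k < n" for x t
  proof -
    obtain s where s: "t = Suc s" using \<open>0 < t\<close> by (cases t) auto
    have "int (srt n \<mu> x) + int s * int (n * (l * j)) \<le> int (srt n \<mu> (x + s * k))"
      using that s by (intro steps) simp
    moreover have "int (srt n \<mu> (x + s * k)) + int (n * (l * j)) < int (srt n \<mu> (x + s * k + k))"
      using that s by (intro step) (simp add: add_ac)
    ultimately show ?thesis by (simp add: s algebra_simps)
  qed
  have absurd: False if "int (srt n \<mu> ?q) + int t * int (n * (l * j)) + 2 \<le> int (srt n \<mu> ?p)" "D = j * t" for t
  proof -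
    have "int (srt n \<mu> ?p) = int (srt n \<mu> ?q) + int t * int (n * (l * j)) + 1"
      unfolding c that(2) by (simp add: algebra_simps)
    then show False using that(1) by simp
  qed
  from \<delta> show False
  proof
    assume "?\<delta> = of_nat l * c0"
    then have "of_nat (lookup \<mu> i) - of_nat l * c0 * of_nat (Suc ?p) =
        of_nat (lookup \<mu> (Suc i)) - of_nat l * c0 * (of_nat ?q :: complex)"
      unfolding \<delta>_eq by (simp add: algebra_simps)
    then have "int k * (int (lookup \<mu> i) - int (lookup \<mu> (Suc i))) = int l * int j * (int (Suc ?p) - int ?q)"
      by (simp only: wt_diff_iff)
    moreover have "int (Suc ?p) - int ?q = int (Suc ?p - ?q)" using pq by simp
    ultimately have "int k * int D = int j * int (Suc ?p - ?q)"
      using D_int by (intro cancel_l) (simp only:)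
    then obtain t where t: "Suc ?p - ?q = k * t" "D = j * t" by (rule mult_k_dvd)
    have "t \<noteq> 0" using t(1) pq by (cases t) auto
    have p: "?p = ?q + t * k - 1" using t(1) pq by (simp add: mult.commute)
    show False
    proof (cases "t = 1")
      case True
      have gap: "gap_at n (l * j) k (pexp (sw i) \<mu>) ?q" using sw by (simp add: A_iff)
      have p': "?p = ?q + (k - 1)" using p True k2 by simp
      have ne: "lookup \<mu> i \<noteq> lookup \<mu> (Suc i)" using less by simp
      have "srt n (pexp (sw i) \<mu>) ?q = Suc (srt n \<mu> ?q)" "Suc (srt n (pexp (sw i) \<mu>) ?p) = srt n \<mu> ?p"
        using srt_swap[OF i ne, of ?q] srt_swap[OF i ne, of ?p] pq by (simp_all del: srt_rk)
      moreover have "srt n (pexp (sw i) \<mu>) ?q + n * (l * j) < srt n (pexp (sw i) \<mu>) ?p"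
        using gap[unfolded gap_at_def, folded p'] pq(2) by blast
      ultimately show False using c t(2) True by simp
    next
      case False
      have pos: "?q + (t - 1) * k + (k - 1) = ?p" using \<open>t \<noteq> 0\<close> p k2 by (cases t) auto
      have "int (srt n \<mu> ?q) + int (t - 1) * int (n * (l * j)) < int (srt n \<mu> (?q + (t - 1) * k))"
        by (rule strict) (use False \<open>t \<noteq> 0\<close> pos pq(2) in linarith)+
      moreover have "int (srt n \<mu> (?q + (t - 1) * k)) + int (n * (l * j)) < int (srt n \<mu> (?q + (t - 1) * k + (k - 1)))"
        by (rule gap) (use pos pq(2) in linarith)+
      moreover have "int t * int (n * (l * j)) = int (t - 1) * int (n * (l * j)) + int (n * (l * j))"
        using \<open>t \<noteq> 0\<close> by (simp add: of_nat_diff algebra_simps)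
      ultimately show False using absurd[OF _ t(2)] pos by simp
    qed
  next
    assume "?\<delta> = - (of_nat l * c0)"
    then have "of_nat (lookup \<mu> i) - of_nat l * c0 * of_nat ?p =
        of_nat (lookup \<mu> (Suc i)) - of_nat l * c0 * (of_nat (Suc ?q) :: complex)"
      unfolding \<delta>_eq by (simp add: algebra_simps)
    then have "int k * (int (lookup \<mu> i) - int (lookup \<mu> (Suc i))) = int l * int j * (int ?p - int (Suc ?q))"
      by (simp only: wt_diff_iff)
    moreover have "int ?p - int (Suc ?q) = int (?p - Suc ?q)" using pq by simp
    ultimately have "int k * int D = int j * int (?p - Suc ?q)"
      using D_int by (intro cancel_l) (simp only:)
    then obtain t where t: "?p - Suc ?q = k * t" "D = j * t" by (rule mult_k_dvd)
    have "D \<noteq> 0" using less D by auto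
    then have "0 < t" using t(2) by (cases t) auto
    have p: "?p = Suc (?q + t * k)" using t(1) pq by (simp add: mult.commute)
    have "int (srt n \<mu> ?q) + int t * int (n * (l * j)) < int (srt n \<mu> (?q + t * k))"
      using \<open>0 < t\<close> pq(2) p by (intro strict) auto
    moreover have "int (srt n \<mu> (?q + t * k)) < int (srt n \<mu> ?p)"
      using pq(2) p by (intro mono) auto
    ultimately show False using absurd[OF _ t(2)] by simp
  qed
qed

definition dist2 :: "(nat \<Rightarrow>\<^sub>0 nat) \<Rightarrow> (nat \<Rightarrow>\<^sub>0 nat) \<Rightarrow> nat" where
  "dist2 \<nu> \<mu> = (\<Sum>m<n. (srt n \<mu> m - srt n \<nu> m)\<^sup>2)"

text \<open>Where the excess of \<open>\<mu>\<close> over \<open>\<nu>\<close> drops, the gap condition for \<open>\<nu>\<close> protects the one for \<open>\<mu>\<close>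
  against the exchange of the two entries.\<close>

lemma swap_towards:
  assumes \<mu>: "\<mu> \<in> A" and \<nu>: "\<nu> \<in> A" and le: "\<And>m. m < n \<Longrightarrow> srt n \<nu> m \<le> srt n \<mu> m"
    and a: "Suc a < n" and drop: "excess n \<nu> \<mu> (Suc a) < excess n \<nu> \<mu> a"
  shows "lookup \<mu> a \<noteq> lookup \<mu> (Suc a)" "pexp (sw a) \<mu> \<in> A"
    and "m < n \<Longrightarrow> srt n \<nu> m \<le> srt n (pexp (sw a) \<mu>) m"
    and "dist2 \<nu> (pexp (sw a) \<mu>) < dist2 \<nu> \<mu>"
proof -
  let ?p = "rk n \<mu> a" and ?q = "rk n \<mu> (Suc a)" and ?\<kappa> = "pexp (sw a) \<mu>"
  let ?Np = "code n \<mu> a" and ?Nq = "code n \<mu> (Suc a)"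
  have pq: "?p < n" "?q < n" using a by (simp_all add: rk_less)
  have le_p: "srt n \<nu> ?p \<le> ?Np" and le_q: "srt n \<nu> ?q \<le> ?Nq" using le[OF pq(1)] le[OF pq(2)] by simp_all
  have drop': "?Nq + srt n \<nu> ?p < ?Np + srt n \<nu> ?q" using drop le_p le_q by (simp add: excess_def)
  have c: "?Np + n * lookup \<mu> (Suc a) = ?Nq + n * lookup \<mu> a + 1" using a by (simp add: code_def)
  show ne: "lookup \<mu> a \<noteq> lookup \<mu> (Suc a)"
  proof
    assume eq: "lookup \<mu> a = lookup \<mu> (Suc a)"
    then have "?Np = Suc ?Nq" using c by simp
    moreover have "?q < ?p" using rk_Suc[OF a eq] by simp
    then have "srt n \<nu> ?q < srt n \<nu> ?p" using pq by (simp add: srt_less_iff)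
    ultimately show False using drop' by simp
  qed
  have pq_ne: "?p \<noteq> ?q" using inj_eq[OF permutes_inj[OF rk_permutes[of n \<mu>]], of a "Suc a"] by simp
  \<comment> \<open>A difference of exactly 1 would give two sorted codes of \<open>\<nu>\<close>
    the same residue modulo \<open>n\<close>.\<close>
  have two: "?Nq + srt n \<nu> ?p + 2 \<le> ?Np + srt n \<nu> ?q"
  proof (rule ccontr)
    assume "\<not> ?thesis"
    then have "?Np + srt n \<nu> ?q = ?Nq + srt n \<nu> ?p + 1" using drop' by simp
    then have "srt n \<nu> ?q + n * lookup \<mu> a = srt n \<nu> ?p + n * lookup \<mu> (Suc a)" using c by simp
    then have "srt n \<nu> ?q mod n = srt n \<nu> ?p mod n" by (metis mod_mult_self2)
    then show False using srt_mod_neq[OF pq(2,1)] pq_ne by auto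
  qed
  show \<kappa>: "?\<kappa> \<in> A"
  proof (rule ccontr)
    assume "?\<kappa> \<notin> A"
    then obtain x where x: "\<not> gap_at n (l * j) k ?\<kappa> x" using swap_A[OF \<mu> a ne] by blast
    have gap: "\<And>x. gap_at n (l * j) k \<mu> x" using \<mu> by (simp add: A_iff)
    have lu: "lookup \<mu> a = lookup \<mu> (Suc a) + l * j" and rk: "?p = ?q + (k - 1)"
      using swap_not_admissible[OF a ne gap x] by auto
    have "gap_at n (l * j) k \<nu> ?q" using \<nu> by (simp add: A_iff)
    then have "srt n \<nu> ?q + n * (l * j) < srt n \<nu> ?p" using pq rk by (simp add: gap_at_def)
    moreover have "?Np = ?Nq + n * (l * j) + 1" using c by (simp add: lu distrib_left)
    ultimately show False using drop' by simp
  qed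
  have \<kappa>_srt: "srt n ?\<kappa> m + (if m = ?p then 1 else 0) = srt n \<mu> m + (if m = ?q then 1 else 0)" if "m < n" for m
    using srt_swap[OF a ne that] .
  have sp: "Suc (srt n ?\<kappa> ?p) = ?Np" using \<kappa>_srt[OF pq(1)] pq_ne by simp
  have sq: "srt n ?\<kappa> ?q = Suc ?Nq" using \<kappa>_srt[OF pq(2)] pq_ne by simp
  have other: "srt n ?\<kappa> m = srt n \<mu> m" if "m < n" "m \<noteq> ?p" "m \<noteq> ?q" for m using \<kappa>_srt[OF that(1)] that by simp
  have lp: "srt n \<nu> ?p \<le> srt n ?\<kappa> ?p" using two le_q sp by simp
  show "srt n \<nu> m \<le> srt n ?\<kappa> m" if "m < n"
    using other[OF that] le[OF that] lp sq le_q by (cases "m = ?p"; cases "m = ?q") auto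
  have split: "sum f {..<n} = f ?p + (f ?q + sum f ({..<n} - {?p} - {?q}))" for f :: "nat \<Rightarrow> nat"
  proof -
    have "sum f {..<n} = f ?p + sum f ({..<n} - {?p})" using pq by (intro sum.remove) auto
    moreover have "sum f ({..<n} - {?p}) = f ?q + sum f ({..<n} - {?p} - {?q})" using pq pq_ne by (intro sum.remove) auto
    ultimately show ?thesis by simp
  qed
  have rest: "(\<Sum>m\<in>{..<n} - {?p} - {?q}. (srt n ?\<kappa> m - srt n \<nu> m)\<^sup>2) = (\<Sum>m\<in>{..<n} - {?p} - {?q}. (srt n \<mu> m - srt n \<nu> m)\<^sup>2)"
    using other by (intro sum.cong) auto
  obtain u where u: "srt n ?\<kappa> ?p = srt n \<nu> ?p + u" using lp by (metis le_iff_add)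
  obtain v where v: "?Nq = srt n \<nu> ?q + v" using le_q by (metis le_iff_add)
  \<comment> \<open>One unit of excess passes from rank \<open>?p\<close>, where it was
    \<open>u + 1\<close>, to rank \<open>?q\<close>, where it was the smaller \<open>v\<close>; this
    lowers the sum of squares.\<close>
  have "v < u" using two sp u v by simp
  then have "u\<^sup>2 + (Suc v)\<^sup>2 < (Suc u)\<^sup>2 + v\<^sup>2" by (simp add: power2_eq_square)
  moreover have "srt n \<mu> ?p - srt n \<nu> ?p = Suc u" using sp u by simp
  moreover have "srt n \<mu> ?q - srt n \<nu> ?q = v" using v by simp
  moreover have "srt n ?\<kappa> ?q - srt n \<nu> ?q = Suc v" using sq v by simp
  ultimately show "dist2 \<nu> ?\<kappa> < dist2 \<nu> \<mu>"
    unfolding dist2_def split[of "\<lambda>m. (srt n ?\<kappa> m - srt n \<nu> m)\<^sup>2"] split[of "\<lambda>m. (srt n \<mu> m - srt n \<nu> m)\<^sup>2"] rest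
    using u by simp
qed

end

context socle_setting
begin

context
  fixes M
  assumes M: "submodule_H l n \<zeta> c0 d M"
begin

text \<open>Up to a cyclic permutation, \<open>y_n\<close> inverts \<open>Phi\<close> with the
  scalar \<open>C.wt 0 \<nu>\<close>, which is nonzero on \<open>A\<close>.\<close>

lemma submodule_unshift:
  assumes \<nu>: "\<nu> \<in> A" and E: "E (shift n \<nu>) \<in> M"
  shows "E \<nu> \<in> M"
proof -
  let ?w = "C.wt 0 \<nu>" and ?\<rho> = "pinv (cyc n)"
  have "dunkl l n \<zeta> c0 d (n - 1) (E (shift n \<nu>)) = scale ?w (perm (cyc n) (E \<nu>))"
    using \<nu> by (intro dunkl_E_shift) (auto simp: A_iff)
  moreover have "dunkl l n \<zeta> c0 d (n - 1) (E (shift n \<nu>)) \<in> M" using n0 by (intro submodule_dunkl[OF M _ E]) simp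
  ultimately have "scale ?w (perm (cyc n) (E \<nu>)) \<in> M" by simp
  then have "perm ?\<rho> (scale ?w (perm (cyc n) (E \<nu>))) \<in> M" by (rule submodule_perm[OF M permutes_inv[OF cyc_permutes]])
  then have "scale (inverse ?w) (perm ?\<rho> (scale ?w (perm (cyc n) (E \<nu>)))) \<in> M"
    by (rule mpol.subspace_scale[OF submodule_subspace[OF M]])
  moreover have "perm ?\<rho> (perm (cyc n) (E \<nu>)) = E \<nu>"
    by (simp add: perm_comp bij_imp_bij_inv inj_iff[THEN iffD1] bij_is_inj)
  ultimately show ?thesis using wt_0_nonzero[OF \<nu>] by (simp add: linopD(2)[OF linop_perm] scale_linear(4,8))
qed

lemma submodule_swap:
  assumes \<mu>: "\<mu> \<in> A" and E: "E \<mu> \<in> M" and i: "Suc i < n" and ne: "lookup \<mu> i \<noteq> lookup \<mu> (Suc i)"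
    and \<nu>: "pexp (sw i) \<mu> \<in> A"
  shows "E (pexp (sw i) \<mu>) \<in> M"
proof -
  let ?\<nu> = "pexp (sw i) \<mu>"
  define g where "g = perm (sw i) (E \<mu>) + scale (C.swap_coeff i \<mu>) (E \<mu>)"
  note g = swap_E[OF \<mu> i ne, folded g_def]
  have "sw i permutes {0..<n}" using i by (intro transpose_permutes) auto
  then have "g \<in> M" unfolding g_def
    by (intro mpol.subspace_add[OF submodule_subspace[OF M]] mpol.subspace_scale[OF submodule_subspace[OF M]] submodule_perm[OF M] E)
  have nz: "lookup g ?\<nu> \<noteq> 0"
  proof (cases "lookup \<mu> i < lookup \<mu> (Suc i)")
    case True
    then show ?thesis using g(2,4) by simp
  next
    case False
    then have less: "lookup \<mu> (Suc i) < lookup \<mu> i" using ne by simp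
    then have "lookup g ?\<nu> = 1 - C.swap_coeff i \<mu> * C.swap_coeff i \<mu>" using g(2,3) by simp
    then show ?thesis using swap_coeff_neq[OF \<mu> i less \<nu>] by simp
  qed
  have "scale (inverse (lookup g ?\<nu>)) g \<in> M" by (rule mpol.subspace_scale[OF submodule_subspace[OF M] \<open>g \<in> M\<close>])
  also have "scale (inverse (lookup g ?\<nu>)) g = E ?\<nu>"
    by (subst g(1)) (use nz in \<open>simp add: scale_linear(4,8)\<close>)
  finally show ?thesis .
qed

text \<open>The induction is on the squared distance of sorted codes. An excess that is not constant
  drops somewhere in the cyclic order of positions, and an exchange there reduces the distance; a
  constant positive excess is reduced by lowering \<open>\<mu>\<close>.\<close>

lemma submodule_descend:
  assumes "\<mu> \<in> A" "\<nu> \<in> A" "\<And>m. m < n \<Longrightarrow> srt n \<nu> m \<le> srt n \<mu> m" "E \<mu> \<in> M"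
  shows "E \<nu> \<in> M"
  using assms
proof (induction "dist2 \<nu> \<mu>" arbitrary: \<mu> \<nu> rule: less_induct)
  case less
  note \<mu> = less.prems(1) and \<nu> = less.prems(2) and le = less.prems(3) and E = less.prems(4)
  have \<mu>e: "\<mu> \<in> exponents n" and \<nu>e: "\<nu> \<in> exponents n" using \<mu> \<nu> by (auto simp: A_iff)
  let ?D = "excess n \<nu> \<mu>"
  have ex: "?D a = srt n \<mu> (rk n \<mu> a) - srt n \<nu> (rk n \<mu> a)" for a by (simp add: excess_def)
  consider (drop) a where "Suc a < n" "?D (Suc a) < ?D a" | (wrap) "?D 0 < ?D (n - 1)"
    | (const) "\<And>a. a < n \<Longrightarrow> ?D a = ?D 0"
  proof (cases "\<exists>a. Suc a < n \<and> ?D (Suc a) < ?D a")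
    case True
    then show ?thesis using that by blast
  next
    case False
    have mono: "?D a \<le> ?D b" if "a \<le> b" "b < n" for a b
      using that
    proof (induction b rule: dec_induct)
      case (step b)
      then show ?case using False by (metis Suc_lessD le_trans not_le)
    qed simp
    show ?thesis
    proof (cases "?D 0 < ?D (n - 1)")
      case False
      have "?D a = ?D 0" if "a < n" for a
        using mono[of 0 a] mono[of a "n - 1"] that False by linarith
      then show ?thesis using that by blast
    qed (use that in blast)
  qed
  then show ?case
  proof cases
    case drop
    note sw = swap_towards[OF \<mu> \<nu> le drop]
    have "E (pexp (sw a) \<mu>) \<in> M" by (rule submodule_swap[OF \<mu> E drop(1) sw(1,2)])
    then show ?thesis using less.hyps[OF sw(4) sw(2) \<nu> sw(3)] by blast
  next
    case wrap
    \<comment> \<open>A drop from position \<open>n - 1\<close> to position 0 becomes one between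
      the neighbours \<open>n - 2\<close> and \<open>n - 1\<close> once both exponents are shifted,
      which does not change \<open>dist2\<close>.\<close>
    let ?\<mu> = "shift n \<mu>" and ?\<nu> = "shift n \<nu>"
    have n2: "2 \<le> n" using k2 kn by simp
    define a where "a = n - 2"
    have a: "Suc a < n" "cyc n (n - 1) = a" "cyc n 0 = Suc a" using n2 by (auto simp: a_def cyc_def)
    have shift_ex: "excess n ?\<nu> ?\<mu> (cyc n b) = ?D b" if "b < n" for b
      using that rk_shift[OF that, of \<mu>] rk_less[OF that, of \<mu>] by (simp add: excess_def code_shift srt_shift)
    have drop: "excess n ?\<nu> ?\<mu> (Suc a) < excess n ?\<nu> ?\<mu> a"
      using wrap shift_ex[of 0] shift_ex[of "n - 1"] a n0 by simp
    have le': "srt n ?\<nu> m \<le> srt n ?\<mu> m" if "m < n" for m using le[OF that] that by (simp add: srt_shift)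
    note sw = swap_towards[OF shift_A[OF \<mu>] shift_A[OF \<nu>] le' a(1) drop]
    have "E (pexp (sw a) ?\<mu>) \<in> M"
      by (rule submodule_swap[OF shift_A[OF \<mu>] submodule_shift[OF M \<mu> E] a(1) sw(1,2)])
    moreover have "dist2 ?\<nu> ?\<mu> = dist2 \<nu> \<mu>" by (simp add: dist2_def srt_shift)
    ultimately have "E ?\<nu> \<in> M" using less.hyps[OF _ sw(2) shift_A[OF \<nu>] sw(3)] sw(4) by simp
    then show ?thesis by (rule submodule_unshift[OF \<nu>])
  next
    case const
    have D: "srt n \<mu> m - srt n \<nu> m = ?D 0" if "m < n" for m
    proof -
      have "pinv (rk n \<mu>) m < n" using that by simp
      then have "?D (pinv (rk n \<mu>) m) = ?D 0" by (rule const)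
      then show ?thesis unfolding ex by simp
    qed
    show ?thesis
    proof (cases "?D 0 = 0")
      case True
      have "srt n \<mu> m = srt n \<nu> m" if "m < n" for m using D[OF that] le[OF that] True by simp
      then have "\<mu> = \<nu>" by (rule srt_inject[OF \<mu>e \<nu>e])
      then show ?thesis using E by simp
    next
      case False
      then have lt: "srt n \<nu> m < srt n \<mu> m" if "m < n" for m using D[OF that] by simp
      have "0 < code n \<mu> (n - 1)" using lt[of "rk n \<mu> (n - 1)"] rk_less[of "n - 1" n \<mu>] n0 by simp
      then have "0 < lookup \<mu> (n - 1)" by (simp add: code_def)
      then obtain \<kappa> where \<kappa>: "\<kappa> \<in> exponents n" "\<mu> = shift n \<kappa>" using shift_surj[OF \<mu>e n0] by blast
      have srt: "srt n \<mu> m = Suc (srt n \<kappa> m)" if "m < n" for m using srt_shift[OF that] \<kappa>(2) by simp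
      have le': "srt n \<nu> m \<le> srt n \<kappa> m" if "m < n" for m using lt[OF that] srt[OF that] by simp
      \<comment> \<open>The lowered codes still dominate those of \<open>\<nu>\<close>, so the
        bounds are inherited from \<open>\<nu>\<close> rather than from
        \<open>\<mu>\<close>.\<close>
      have "low \<kappa>"
        unfolding low_def
      proof (intro allI impI)
        fix m p assume H: "m \<le> n - 1 \<and> p > 0 \<and> \<not> l dvd p \<and> d 0 - d (- int p) + of_nat l * of_nat m * c0 = of_nat p"
        then have m: "m < n" using n0 by auto
        have "p \<le> rearr n \<nu> m" using H \<nu> by (simp add: A_iff low_def)
        also have "\<dots> \<le> rearr n \<kappa> m" using le'[OF m] m by (simp add: rearr_srt div_le_mono)
        finally show "p \<le> rearr n \<kappa> m" .
      qed
      then have \<kappa>A: "\<kappa> \<in> A" using \<mu> \<kappa> by (simp add: A_iff gap_at_shift)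
      have "dist2 \<nu> \<kappa> < dist2 \<nu> \<mu>"
        unfolding dist2_def
      proof (rule sum_strict_mono)
        fix m assume "m \<in> {..<n}"
        then show "(srt n \<kappa> m - srt n \<nu> m)\<^sup>2 < (srt n \<mu> m - srt n \<nu> m)\<^sup>2"
          using srt[of m] le'[of m] by (intro power_strict_mono) auto
      qed (use n0 in auto)
      moreover have "E \<kappa> \<in> M" using E \<kappa>(2) submodule_unshift[OF \<kappa>A] by simp
      ultimately show ?thesis using less.hyps[OF _ \<kappa>A \<nu> le'] by blast
    qed
  qed
qed

text \<open>Shifting raises all sorted codes uniformly, so \<open>\<mu>\<close> eventually dominates
  \<open>\<nu>\<close> and the descent applies. The sum \<open>t\<close> of the codes of
  \<open>\<nu>\<close> is a crude but sufficient number of shifts.\<close>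

lemma submodule_connected:
  assumes \<mu>: "\<mu> \<in> A" and \<nu>: "\<nu> \<in> A" and E: "E \<mu> \<in> M"
  shows "E \<nu> \<in> M"
proof -
  have up: "(shift n ^^ t) \<mu> \<in> A \<and> E ((shift n ^^ t) \<mu>) \<in> M \<and> (\<forall>m<n. srt n ((shift n ^^ t) \<mu>) m = srt n \<mu> m + t)" for t
    by (induction t) (use \<mu> E in \<open>auto simp: shift_A submodule_shift[OF M] srt_shift\<close>)
  define t where "t = (\<Sum>m<n. srt n \<nu> m)"
  have "srt n \<nu> m \<le> t" if "m < n" for m
    unfolding t_def using that by (intro member_le_sum) auto
  then have "srt n \<nu> m \<le> srt n ((shift n ^^ t) \<mu>) m" if "m < n" for m
    using up[of t] that by (simp add: trans_le_add2)
  then show ?thesis using submodule_descend[OF _ \<nu>, of "(shift n ^^ t) \<mu>"] up[of t] by blast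
qed

lemma S_subset_submodule:
  assumes nz: "M \<noteq> {0}" and A: "A \<noteq> {}"
  shows "S \<subseteq> M"
proof -
  obtain f where f: "f \<in> M" "f \<noteq> 0" using nz mpol.subspace_0[OF submodule_subspace[OF M]] by blast
  obtain \<mu> where \<mu>: "\<mu> \<in> A" using A by blast
  \<comment> \<open>The product lies in \<open>M\<close> and in \<open>S\<close>, because both are
    stable under multiplication by polynomials.\<close>
  let ?h = "f * E \<mu>"
  have "E \<mu> \<noteq> 0" using E_eig_A(3)[OF \<mu>] by auto
  then have h0: "?h \<noteq> 0" using f(2) by simp
  have "E \<mu> * f \<in> M" by (rule submodule_mult[OF M E_eig_A(4)[OF \<mu>] f(1)])
  then have hM: "?h \<in> M" by (simp add: mult.commute)
  have "?h \<in> mpol.span (E ` A)" using mult_S[OF submodule_poly_ring[OF M f(1)] E_in_S[OF \<mu>]] by (simp add: S_def)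
  then obtain B r where B: "finite B" "B \<subseteq> E ` A" "?h = (\<Sum>b\<in>B. scale (r b) b)"
    unfolding mpol.span_explicit by blast
  obtain F where F: "F \<subseteq> A" "inj_on E F" "B = E ` F" using B(2) subset_image_inj by metis
  have fin: "finite F" using B(1) F(2,3) finite_imageD by blast
  have h: "?h = (\<Sum>\<mu>\<in>F. scale (r (E \<mu>)) (E \<mu>))" unfolding B(3) F(3) by (rule sum.reindex_cong[OF F(2)]) auto
  have "\<exists>\<mu>\<in>F. r (E \<mu>) \<noteq> 0"
  proof (rule ccontr)
    assume "\<not> ?thesis"
    then have "?h = 0" unfolding h by (intro sum.neutral) (auto simp: scale_algebra)
    then show False using h0 by simp
  qed
  then obtain \<kappa> where "\<kappa> \<in> A" "E \<kappa> \<in> M" using submodule_extract[OF M fin F(1), of "\<lambda>\<mu>. r (E \<mu>)"] hM unfolding h by blast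
  then have "E ` A \<subseteq> M" using submodule_connected by blast
  then show ?thesis unfolding S_def by (rule mpol.span_minimal[OF _ submodule_subspace[OF M]])
qed

end

section \<open>Existence, simplicity and linear independence\<close>

lemma A_nonempty: "A \<noteq> {}"
proof -
  \<comment> \<open>\<open>K\<close> bounds the norm of every \<open>d i\<close> by periodicity, so
    \<open>b\<close> bounds every \<open>p\<close> that can satisfy an equation in
    \<open>low\<close>. The entries of \<open>\<mu>\<close> are the multiples of \<open>b\<close>
    from \<open>b\<close> to \<open>n * b\<close>; their steps exceed \<open>l * j\<close>.\<close>
  define K where "K = (\<Sum>r<l. norm (d (int r)))"
  define b where "b = l * j + 1 + nat \<lceil>norm (d 0) + K + norm (of_nat l * c0) * real n\<rceil>"
  define \<mu> :: "nat \<Rightarrow>\<^sub>0 nat" where "\<mu> = (\<Sum>a<n. Poly_Mapping.single a (b * Suc a))"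
  have \<mu>: "lookup \<mu> a = (if a < n then b * Suc a else 0)" for a
    by (simp add: \<mu>_def lookup_sum lookup_single when_def)
  have exp: "\<mu> \<in> exponents n" by (auto simp: exponents_def in_keys_iff \<mu> split: if_splits)
  have b: "l * j + 1 \<le> b" by (simp add: b_def)
  have b0: "0 < b" using b by simp
  have "code n \<mu> x < code n \<mu> y \<longleftrightarrow> x < y" if "x < n" "y < n" for x y
    using that b0 by (auto simp: code_less_iff \<mu>)
  then have "{y. y < n \<and> code n \<mu> y < code n \<mu> x} = {..<x}" if "x < n" for x using that by auto
  then have rk: "rk n \<mu> x = x" if "x < n" for x using that by (simp add: rk_def)
  have inv: "pinv (rk n \<mu>) x = x" if "x < n" for x using rk[OF that] rk_inv(2)[of n \<mu> x] by simp
  have "gap_at n (l * j) k \<mu> x" for x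
    unfolding gap_at_def
  proof
    assume x: "x + (k - 1) < n"
    then have xn: "x < n" by simp
    have "b * Suc x + (l * j + 1) \<le> b * Suc x + b" using b by simp
    also have "\<dots> = b * Suc (x + 1)" by simp
    also have "\<dots> \<le> b * Suc (x + (k - 1))" using k2 by (intro mult_le_mono2) simp
    finally have "n * (b * Suc x + (l * j + 1)) \<le> n * (b * Suc (x + (k - 1)))" by (rule mult_le_mono2)
    then have "n * (b * Suc x) + n * (l * j) + n \<le> n * (b * Suc (x + (k - 1)))" by (simp only: distrib_left mult_1_right)
    moreover have "srt n \<mu> x = n * (b * Suc x) + (n - 1 - x)" using inv[OF xn] xn by (simp add: srt_def code_def \<mu>)
    moreover have "srt n \<mu> (x + (k - 1)) \<ge> n * (b * Suc (x + (k - 1)))"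
      using inv[OF x] x by (simp add: srt_def code_def \<mu>)
    ultimately show "srt n \<mu> x + n * (l * j) < srt n \<mu> (x + (k - 1))" using n0 by linarith
  qed
  moreover have "low \<mu>"
    unfolding low_def
  proof (intro allI impI)
    fix m p assume H: "m \<le> n - 1 \<and> p > 0 \<and> \<not> l dvd p \<and> d 0 - d (- int p) + of_nat l * of_nat m * c0 = of_nat p"
    then have m: "m < n" using n0 by auto
    have "0 \<le> (- int p) mod int l" "(- int p) mod int l < int l" using l1 by simp_all
    then obtain r where r: "(- int p) mod int l = int r" "r < l" by (metis nonneg_int_cases of_nat_less_iff)
    have "norm (d (- int p)) = norm (d (int r))" using C.d_mod[of "- int p"] r(1) by simp
    also have "\<dots> \<le> K" unfolding K_def using r(2) by (intro member_le_sum) auto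
    finally have dK: "norm (d (- int p)) \<le> K" .
    have "real p = norm (of_nat p :: complex)" by simp
    also have "\<dots> = norm (d 0 - d (- int p) + of_nat l * of_nat m * c0)" using H by simp
    also have "\<dots> \<le> norm (d 0) + norm (d (- int p)) + norm (of_nat l * of_nat m * c0)"
      by (rule order_trans[OF norm_triangle_ineq add_right_mono[OF norm_triangle_ineq4]])
    also have "norm (of_nat l * of_nat m * c0) = norm (of_nat l * c0) * real m" by (simp add: norm_mult)
    also have "\<dots> \<le> norm (of_nat l * c0) * real n" using m by (intro mult_left_mono) auto
    finally have "real p \<le> norm (d 0) + K + norm (of_nat l * c0) * real n" using dK by simp
    also have "\<dots> \<le> real b" unfolding b_def by linarith
    finally have "p \<le> b" by simp
    also have "\<dots> \<le> rearr n \<mu> m" using m by (simp add: rearr_inv_rk inv \<mu>)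
    finally show "p \<le> rearr n \<mu> m" .
  qed
  ultimately have "\<mu> \<in> A" using exp by (simp add: A_iff)
  then show ?thesis by blast
qed

lemma S_nonzero: "S \<noteq> {0}"
proof -
  obtain \<mu> where \<mu>: "\<mu> \<in> A" using A_nonempty by blast
  have "E \<mu> \<noteq> 0" using E_eig_A(3)[OF \<mu>] by auto
  then show ?thesis using E_in_S[OF \<mu>] by blast
qed

lemma socle_eq: "socle l n \<zeta> c0 d = S"
proof -
  have "simple_submodule_H l n \<zeta> c0 d N \<longleftrightarrow> N = S" for N
  proof
    assume N: "simple_submodule_H l n \<zeta> c0 d N"
    then have "S \<subseteq> N" using S_subset_submodule A_nonempty by (auto simp: simple_submodule_H_def)
    then show "N = S" using N S_submodule S_nonzero by (auto simp: simple_submodule_H_def)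
  next
    assume "N = S"
    then show "simple_submodule_H l n \<zeta> c0 d N"
      using S_submodule S_nonzero S_subset_submodule A_nonempty by (auto simp: simple_submodule_H_def)
  qed
  then have "\<Union>{N. simple_submodule_H l n \<zeta> c0 d N} = S" by auto
  then show ?thesis unfolding socle_def by (simp add: mpol.span_eq_iff[THEN iffD2] S_subspace)
qed

text \<open>In a vanishing combination, an exponent of maximal energy among those with nonzero
  coefficient occurs in no other eigenvector of the combination, so its coefficient would be
  zero.\<close>

lemma E_independent: "mpol.independent (E ` A)"
proof
  assume "mpol.dependent (E ` A)"
  then obtain B u where B: "finite B" "B \<subseteq> E ` A" "\<exists>v\<in>B. u v \<noteq> 0" "(\<Sum>v\<in>B. scale (u v) v) = 0"
    unfolding mpol.dependent_explicit by blast
  obtain F where F: "F \<subseteq> A" "inj_on E F" "B = E ` F" using B(2) subset_image_inj by metis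
  have fin: "finite F" using B(1) F(2,3) finite_imageD by blast
  define G where "G = {\<mu> \<in> F. u (E \<mu>) \<noteq> 0}"
  have "finite G" "G \<noteq> {}" using fin B(3) F(3) by (auto simp: G_def)
  then have "Max (energy n ` G) \<in> energy n ` G" by (intro Max_in) auto
  then obtain \<mu> where \<mu>: "\<mu> \<in> G" "energy n \<mu> = Max (energy n ` G)" by (metis imageE)
  have sum: "(\<Sum>\<nu>\<in>F. scale (u (E \<nu>)) (E \<nu>)) = 0"
    using B(4) unfolding F(3) by (simp add: sum.reindex[OF F(2)])
  have "u (E \<nu>) * lookup (E \<nu>) \<mu> = (if \<nu> = \<mu> then u (E \<mu>) else 0)" if "\<nu> \<in> F" for \<nu>
  proof (cases "\<nu> \<in> G \<and> \<nu> \<noteq> \<mu>")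
    case True
    then have "energy n \<nu> \<le> energy n \<mu>" using \<mu>(2) \<open>finite G\<close> by simp
    then have "lookup (E \<nu>) \<mu> = 0"
      using True that F(1) by (intro C.eig_lookup_eq_0[OF E_eig_A(1,2)]) auto
    then show ?thesis using True by simp
  next
    case False
    then show ?thesis using that F(1) \<mu>(1) E_eig_A(3)[of \<mu>] by (auto simp: G_def)
  qed
  then have "lookup (\<Sum>\<nu>\<in>F. scale (u (E \<nu>)) (E \<nu>)) \<mu> = (\<Sum>\<nu>\<in>F. if \<nu> = \<mu> then u (E \<mu>) else 0)"
    by (simp add: lookup_sum)
  also have "\<dots> = u (E \<mu>)" using fin \<mu>(1) by (simp add: G_def)
  finally show False using sum \<mu>(1) by (simp add: G_def)
qed

end

theorem theorem4p4:
  fixes l n j k :: nat and \<zeta> c0 :: complex and d :: "int \<Rightarrow> complex"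
  assumes "l \<ge> 1"
    and "\<zeta> ^ l = 1" and "\<And>t. 0 < t \<Longrightarrow> t < l \<Longrightarrow> \<zeta> ^ t \<noteq> 1"
    and "(\<Sum>i<l. d (int i)) = 0" and "\<And>i. d (i + int l) = d i"
    and "j > 0" and "coprime j k" and "2 \<le> k" and "k \<le> n"
    and "c0 = of_nat j / of_nat k"
  shows "let B = {specialize c0 (jack l n \<zeta> d \<mu>) | \<mu>.
      \<mu> \<in> exponents n \<and> admissible n (l * j) k \<mu> \<and>
      (\<forall>m p :: nat. m \<le> n - 1 \<and> p > 0 \<and> \<not> l dvd p \<and>
         d 0 - d (- int p) + of_nat l * of_nat m * c0 = of_nat p
         \<longrightarrow> rearr n \<mu> m \<ge> p)}
    in mpol.independent B \<and> mpol.span B = socle l n \<zeta> c0 d"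
proof -
  interpret socle_setting l n \<zeta> c0 d j k
    using assms by unfold_locales auto
  have "{specialize c0 (jack l n \<zeta> d \<mu>) | \<mu>.
      \<mu> \<in> exponents n \<and> admissible n (l * j) k \<mu> \<and>
      (\<forall>m p :: nat. m \<le> n - 1 \<and> p > 0 \<and> \<not> l dvd p \<and>
         d 0 - d (- int p) + of_nat l * of_nat m * c0 = of_nat p
         \<longrightarrow> rearr n \<mu> m \<ge> p)} = E ` A"
    unfolding E_def A_def low_def by blast
  then show ?thesis using E_independent socle_eq by (simp add: S_def)
qed

end
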